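(* Let $T>0$, let $\omega\subsetneq\Omega$ be a fixed open set, and let $A=(a_1,\dots,a_N)\in C^\infty(\overline{Q})$ be a vector field. If $\mathcal{O}=\omega\times(0,T)$, then the system $$ \begin{cases} y_t-\Delta y_t+\operatorname{div}(A(x,t)y)=v\chi_{\mathcal{O}} & \text{in } Q,\\ y=0 & \text{on }\Sigma,\\ y(\cdot,0)=y_0 & \text{in }\Omega\end{cases} $$ is not null controllable at time $T$; that is, there exists $y_0\in H^2(\Omega)\cap H^1_0(\Omega)$ for which the null controllability of the system does not hold.
   Context: $\Omega\subset\mathbb{R}^N$ ($N\ge 1$) is a bounded connected open set whose boundary is regular enough, $Q=\Omega\times(0,T)$, $\Sigma=\partial\Omega\times(0,T)$, and $\mathcal{O}$ is a nonempty subset of $Q$. $\chi_{\mathcal{O}}\in C^\infty(Q)$ is a function with $\operatorname{supp}\chi_{\mathcal{O}}\subset\overline{\mathcal{O}}$. The divergence is taken in the spatial variable. Null controllability at time $T$ for the initial datum $y_0$ means: there exists a control $v\in L^2(\mathcal{O})$ such that the associated solution satisfies $y(\cdot,T)=0$ in $\Omega$.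
   Formalization: The uncontrolled part Ω∖ω is additionally assumed to have positive Lebesgue measure; for a merely proper open ω the claim fails, e.g. ω = Ω minus a point with χ_O = 1, where y = (1 − t/T)y_0 is steered to 0. *)

theory Defs
  imports "HOL-Analysis.Analysis"
begin

section \<open>Classical differentiability classes on open sets\<close>

definition partial_deriv ::
    "'e::euclidean_space \<Rightarrow> ('e \<Rightarrow> 'b::real_normed_vector) \<Rightarrow> 'e \<Rightarrow> 'b" where
  "partial_deriv b f x = frechet_derivative f (at x) b"

text \<open>Multi-indices are lists of basis vectors: \<open>iter_deriv [b1, ..., bk] f\<close> is
  \<open>\<partial>b1 ... \<partial>bk f\<close>, and \<open>iter_deriv [] f\<close> is \<open>f\<close>.\<close>

definition iter_deriv ::
    "'e::euclidean_space list \<Rightarrow> ('e \<Rightarrow> 'b::real_normed_vector) \<Rightarrow> 'e \<Rightarrow> 'b" where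
  "iter_deriv bs f = foldr partial_deriv bs f"

definition Ck_on :: "nat \<Rightarrow> 'e::euclidean_space set \<Rightarrow> ('e \<Rightarrow> 'b::real_normed_vector) set" where
  "Ck_on k S = {f.
     (\<forall>bs. set bs \<subseteq> Basis \<and> length bs < k \<longrightarrow> iter_deriv bs f differentiable_on S) \<and>
     (\<forall>bs. set bs \<subseteq> Basis \<and> length bs \<le> k \<longrightarrow> continuous_on S (iter_deriv bs f))}"

definition Cinf_on :: "'e::euclidean_space set \<Rightarrow> ('e \<Rightarrow> 'b::real_normed_vector) set" where
  "Cinf_on S = (\<Inter>k. Ck_on k S)"

text \<open>\<open>C\<^sup>\<infinity>\<close> up to the boundary of the open set \<open>S\<close>: smooth in \<open>S\<close>, and every derivative
  extends continuously to the closure of \<open>S\<close>.\<close>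

definition Cinf_closure :: "'e::euclidean_space set \<Rightarrow> ('e \<Rightarrow> 'b::real_normed_vector) set" where
  "Cinf_closure S = {f \<in> Cinf_on S. \<forall>bs. set bs \<subseteq> Basis \<longrightarrow>
     (\<exists>g. continuous_on (closure S) g \<and> (\<forall>x\<in>S. g x = iter_deriv bs f x))}"

definition test_functions :: "'e::euclidean_space set \<Rightarrow> ('e \<Rightarrow> real) set" where
  "test_functions S = {\<phi> \<in> Cinf_on UNIV.
     compact (closure {x. \<phi> x \<noteq> 0}) \<and> closure {x. \<phi> x \<noteq> 0} \<subseteq> S}"

text \<open>Boundary of class \<open>C\<^sup>2\<close>, by local defining functions with nonvanishing gradient. This is
  the regularity under which the Dirichlet Laplacian has \<open>H\<^sup>2\<close> regularity.\<close>

definition C2_boundary :: "'a::euclidean_space set \<Rightarrow> bool" where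
  "C2_boundary \<Omega> \<longleftrightarrow> (\<forall>p\<in>frontier \<Omega>. \<exists>U (\<rho> :: 'a \<Rightarrow> real).
     open U \<and> p \<in> U \<and> \<rho> \<in> Ck_on 2 U \<and>
     (\<forall>x\<in>U. \<exists>b\<in>Basis. partial_deriv b \<rho> x \<noteq> 0) \<and>
     \<Omega> \<inter> U = {x \<in> U. \<rho> x < 0})"


section \<open>Lebesgue and Sobolev spaces\<close>

text \<open>Elements are representatives; all notions below are invariant under changes on null
  subsets of \<open>S\<close>, and values outside \<open>S\<close> are irrelevant.\<close>

definition L2 :: "'e::euclidean_space set \<Rightarrow> ('e \<Rightarrow> real) set" where
  "L2 S = {u \<in> borel_measurable (lebesgue_on S). integrable (lebesgue_on S) (\<lambda>x. (u x)\<^sup>2)}"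

definition L1_loc :: "'e::euclidean_space set \<Rightarrow> ('e \<Rightarrow> real) set" where
  "L1_loc S = {u. \<forall>K. compact K \<and> K \<subseteq> S \<longrightarrow> u absolutely_integrable_on K}"

definition has_weak_deriv ::
    "'e::euclidean_space set \<Rightarrow> 'e list \<Rightarrow> ('e \<Rightarrow> real) \<Rightarrow> ('e \<Rightarrow> real) \<Rightarrow> bool" where
  "has_weak_deriv S bs u g \<longleftrightarrow> u \<in> L1_loc S \<and> g \<in> L1_loc S \<and>
     (\<forall>\<phi>\<in>test_functions S.
        (LINT x|lebesgue_on S. u x * iter_deriv bs \<phi> x) =
        (- 1) ^ length bs * (LINT x|lebesgue_on S. g x * \<phi> x))"

text \<open>A representative of the (almost everywhere unique) weak derivative; meaningful only if
  that derivative exists.\<close>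

definition weak_deriv ::
    "'e::euclidean_space set \<Rightarrow> 'e list \<Rightarrow> ('e \<Rightarrow> real) \<Rightarrow> 'e \<Rightarrow> real" where
  "weak_deriv S bs u = (SOME g. has_weak_deriv S bs u g)"

definition Hk :: "nat \<Rightarrow> 'e::euclidean_space set \<Rightarrow> ('e \<Rightarrow> real) set" where
  "Hk k S = {u \<in> L2 S. \<forall>bs. set bs \<subseteq> Basis \<and> length bs \<le> k \<longrightarrow>
     (\<exists>g\<in>L2 S. has_weak_deriv S bs u g)}"

text \<open>The closure of the test functions in the \<open>H\<^sup>1\<close> norm.\<close>

definition H10 :: "'e::euclidean_space set \<Rightarrow> ('e \<Rightarrow> real) set" where
  "H10 S = {u \<in> Hk 1 S. \<exists>\<phi> :: nat \<Rightarrow> 'e \<Rightarrow> real.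
     (\<forall>n. \<phi> n \<in> test_functions S) \<and>
     (\<lambda>n. LINT x|lebesgue_on S. (u x - \<phi> n x)\<^sup>2) \<longlonglongrightarrow> 0 \<and>
     (\<forall>b\<in>Basis.
        (\<lambda>n. LINT x|lebesgue_on S. (weak_deriv S [b] u x - partial_deriv b (\<phi> n) x)\<^sup>2)
          \<longlonglongrightarrow> 0)}"


section \<open>The controlled equation\<close>

text \<open>Space-time points are pairs \<open>(x, t)\<close>.\<close>

abbreviation cylinder :: "'a::euclidean_space set \<Rightarrow> real \<Rightarrow> ('a \<times> real) set" where
  "cylinder \<Omega> T \<equiv> \<Omega> \<times> {0<..<T}"

abbreviation dir_t :: "'a::euclidean_space \<times> real" where
  "dir_t \<equiv> (0, 1)"

abbreviation dir_x :: "'a::euclidean_space \<Rightarrow> 'a \<times> real" where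
  "dir_x b \<equiv> (b, 0)"

text \<open>The space \<open>H\<^sup>1(0,T; H\<^sup>2(\<Omega>) \<inter> H\<^sup>1\<^sub>0(\<Omega>))\<close>, in which the problem is well posed for
  initial data in \<open>H\<^sup>2(\<Omega>) \<inter> H\<^sup>1\<^sub>0(\<Omega>)\<close> and right-hand sides in \<open>L\<^sup>2(Q)\<close>: \<open>y\<close> and its time
  derivative have all weak space derivatives up to order two in \<open>L\<^sup>2(Q)\<close>. The last condition
  (continuity of \<open>y\<close> from \<open>[0,T]\<close> to \<open>L\<^sup>2(\<Omega>)\<close>) selects the time-continuous representative, so
  that \<open>y(\<cdot>,0)\<close> and \<open>y(\<cdot>,T)\<close> make sense; the Dirichlet condition is \<open>y(\<cdot>,t) \<in> H\<^sup>1\<^sub>0(\<Omega>)\<close>.\<close>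

definition solution_space :: "'a::euclidean_space set \<Rightarrow> real \<Rightarrow> ('a \<times> real \<Rightarrow> real) set" where
  "solution_space \<Omega> T = {y.
     (\<forall>bs. set bs \<subseteq> Basis \<and> length bs \<le> 2 \<longrightarrow>
        (\<exists>g\<in>L2 (cylinder \<Omega> T). has_weak_deriv (cylinder \<Omega> T) (map dir_x bs) y g) \<and>
        (\<exists>g\<in>L2 (cylinder \<Omega> T). has_weak_deriv (cylinder \<Omega> T) (dir_t # map dir_x bs) y g)) \<and>
     (\<forall>t\<in>{0..T}. (\<lambda>x. y (x, t)) \<in> Hk 2 \<Omega> \<inter> H10 \<Omega>) \<and>
     (\<forall>t\<in>{0..T}.
        ((\<lambda>s. LINT x|lebesgue_on \<Omega>. (y (x, s) - y (x, t))\<^sup>2) \<longlongrightarrow> 0) (at t within {0..T}))}"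

text \<open>\<open>y\<close> solves \<open>y\<^sub>t - \<Delta>y\<^sub>t + div(A y) = v chi\<close> in \<open>Q\<close>, \<open>y = 0\<close> on the lateral boundary,
  \<open>y(\<cdot>,0) = y\<^sub>0\<close>. The control \<open>v\<close> lives on \<open>D\<close> and is extended by zero to \<open>Q\<close>.\<close>

definition is_solution ::
    "'a::euclidean_space set \<Rightarrow> real \<Rightarrow> ('a \<times> real \<Rightarrow> 'a) \<Rightarrow> ('a \<times> real) set \<Rightarrow>
     ('a \<times> real \<Rightarrow> real) \<Rightarrow> ('a \<times> real \<Rightarrow> real) \<Rightarrow> ('a \<Rightarrow> real) \<Rightarrow> ('a \<times> real \<Rightarrow> real) \<Rightarrow> bool" where
  "is_solution \<Omega> T A D chi v y0 y \<longleftrightarrow>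
     (let Q = cylinder \<Omega> T in
       y \<in> solution_space \<Omega> T \<and>
       (AE p in lebesgue_on Q.
          weak_deriv Q [dir_t] y p
          - (\<Sum>b\<in>Basis. weak_deriv Q [dir_t, dir_x b, dir_x b] y p)
          + (\<Sum>b\<in>Basis. weak_deriv Q [dir_x b] (\<lambda>q. (A q \<bullet> b) * y q) p)
          = (if p \<in> D then v p * chi p else 0)) \<and>
       (AE x in lebesgue_on \<Omega>. y (x, 0) = y0 x))"

definition null_controllable_from ::
    "'a::euclidean_space set \<Rightarrow> real \<Rightarrow> ('a \<times> real \<Rightarrow> 'a) \<Rightarrow> ('a \<times> real) set \<Rightarrow>
     ('a \<times> real \<Rightarrow> real) \<Rightarrow> ('a \<Rightarrow> real) \<Rightarrow> bool" where
  "null_controllable_from \<Omega> T A D chi y0 \<longleftrightarrow>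
     (\<exists>v\<in>L2 D. \<exists>y. is_solution \<Omega> T A D chi v y0 y \<and> (AE x in lebesgue_on \<Omega>. y (x, T) = 0))"

end

theory Submission imports Defs begin

text \<open>
  Why the system is not null controllable. The equation does not transport information in the space
  variable: for \<open>z = y - \<Delta>y\<close> it reads \<open>z\<^sub>t + div(A y) = v chi\<close>, which at each point is an ordinary
  differential equation in time with a forcing that depends on \<open>y\<close>. Outside \<open>\<omega>\<close> the control is
  absent. If \<open>y(\<cdot>,T) = 0\<close>, integration over \<open>(0,T)\<close> gives, almost everywhere on \<open>\<Omega> - \<omega>\<close>,
  the identity \<open>y0 - \<Delta>y0 = K\<close>, where \<open>K\<close> is the time integral of \<open>div(A y)\<close>. But \<open>y\<close> has
  two space derivatives and \<open>div(A y)\<close> uses only one of them, so \<open>K\<close> has an integrable weak gradient,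
  whereas \<open>y0 - \<Delta>y0\<close> is in general no better than \<open>L\<^sup>2\<close>. It remains to exhibit one \<open>y0\<close> for which
  \<open>y0 - \<Delta>y0\<close> does not agree on \<open>\<Omega> - \<omega>\<close> with a function that has an integrable derivative in
  one fixed coordinate direction \<open>c\<close>.

  The set \<open>\<Omega> - \<omega>\<close> has positive measure but may have empty interior, so the obstruction has to be
  visible on an arbitrary set of positive measure. The quantity used is the integral over thin slabs: if
  \<open>\<partial>\<^sub>c K\<close> is integrable, then the integral of \<open>K\<close> over any compact part of the slab
  \<open>\<bar>x \<bullet> c - s0\<bar> \<le> \<delta>\<close> is at most a constant times \<open>\<delta>\<close>, because a function bounded by one and
  supported in the slab has an antiderivative in direction \<open>c\<close> bounded by \<open>2\<delta>\<close>
  (\<open>slab_estimate\<close>). A compact \<open>F \<subseteq> \<Omega> - \<omega>\<close> of positive measure has a position \<open>s0\<close> at which the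
  measure of \<open>F\<close> in the slab is not \<open>o(\<delta>)\<close>; otherwise the distribution function of \<open>x \<bullet> c\<close> on
  \<open>F\<close> would have derivative zero everywhere (\<open>thick_slice_exists\<close>). The initial datum is
  \<open>y0(x) = \<zeta>(x) \<bar>x \<bullet> c - s0\<bar>\<^bsup>7/4\<^esup>\<close> with a cutoff \<open>\<zeta>\<close> equal to one near \<open>F\<close>. It belongs to
  \<open>H\<^sup>2 \<inter> H\<^sup>1\<^sub>0\<close> (\<open>singular_datum\<close>), and \<open>\<Delta>y0\<close> behaves like \<open>\<bar>x \<bullet> c - s0\<bar>\<^bsup>-1/4\<^esup>\<close>, so that the
  integral of \<open>y0 - \<Delta>y0\<close> over the part of \<open>F\<close> in the slab is at least of order \<open>\<delta>\<^bsup>-1/4\<^esup>\<close> times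
  its measure. Hence this measure is \<open>O(\<delta>\<^bsup>5/4\<^esup>)\<close>, which contradicts the choice of \<open>s0\<close>.

  All functions involved are given by weak formulations, so the argument is carried out by testing with
  products \<open>\<phi>(x) \<eta>(t)\<close>. Letting \<open>\<eta>\<close> increase to one turns the time derivative into the traces at
  \<open>0\<close> and \<open>T\<close> (\<open>trace_pairing\<close>, \<open>pseudo_parabolic_term\<close>); letting \<open>\<phi>\<close> tend to the
  indicator of a compact set then localizes the identity on \<open>F\<close>, away from the control
  (\<open>null_controllable_imp_slab_bound\<close>). Weak derivatives of \<open>A y\<close> come from the product rule with
  smooth coefficients (\<open>transport_term\<close>).
\<close>

section \<open>Smooth functions on open sets\<close>

lemma iter_deriv_Nil [simp]: "iter_deriv [] f = f"
  by (simp add: iter_deriv_def)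

lemma iter_deriv_Cons [simp]: "iter_deriv (b # bs) f = partial_deriv b (iter_deriv bs f)"
  by (simp add: iter_deriv_def)

lemma iter_deriv_append: "iter_deriv (as @ bs) f = iter_deriv as (iter_deriv bs f)"
  by (simp add: iter_deriv_def)

lemma has_derivative_cong_open:
  assumes "open S" "x \<in> S" "\<And>y. y \<in> S \<Longrightarrow> f y = g y"
  shows "(f has_derivative D) (at x) \<longleftrightarrow> (g has_derivative D) (at x)"
  using assms has_derivative_transform_within_open[of _ D x UNIV S] by metis

lemma partial_deriv_cong:
  assumes "open S" "x \<in> S" "\<And>y. y \<in> S \<Longrightarrow> f y = g y"
  shows "partial_deriv b f x = partial_deriv b g x"
  unfolding partial_deriv_def frechet_derivative_def
  using has_derivative_cong_open[OF assms] by simp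

lemma iter_deriv_cong:
  assumes "open S" "x \<in> S" "\<And>y. y \<in> S \<Longrightarrow> f y = g y"
  shows "iter_deriv bs f x = iter_deriv bs g x"
  using assms(2)
proof (induction bs arbitrary: x)
  case Nil then show ?case using assms(3) by simp
next
  case (Cons b bs) then show ?case
    using partial_deriv_cong[OF assms(1) Cons.prems, of "iter_deriv bs f" "iter_deriv bs g"] by simp
qed

lemma partial_derivI: "(f has_derivative D) (at x) \<Longrightarrow> partial_deriv b f x = D b"
  unfolding partial_deriv_def using frechet_derivative_at by metis

lemma Cinf_on_iff:
  assumes "open S"
  shows "f \<in> Cinf_on S \<longleftrightarrow>
    (\<forall>bs. set bs \<subseteq> Basis \<longrightarrow> (\<forall>x\<in>S. iter_deriv bs f differentiable (at x)))"
proof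
  assume f: "f \<in> Cinf_on S"
  show "\<forall>bs. set bs \<subseteq> Basis \<longrightarrow> (\<forall>x\<in>S. iter_deriv bs f differentiable (at x))"
  proof (intro allI impI)
    fix bs :: "'a list" assume bs: "set bs \<subseteq> Basis"
    have "f \<in> Ck_on (Suc (length bs)) S" using f by (auto simp: Cinf_on_def)
    then have "iter_deriv bs f differentiable_on S" using bs by (auto simp: Ck_on_def)
    then show "\<forall>x\<in>S. iter_deriv bs f differentiable (at x)"
      using assms differentiable_on_eq_differentiable_at by auto
  qed
next
  assume *: "\<forall>bs. set bs \<subseteq> Basis \<longrightarrow> (\<forall>x\<in>S. iter_deriv bs f differentiable (at x))"
  then have d: "set bs \<subseteq> Basis \<Longrightarrow> iter_deriv bs f differentiable_on S" for bs
    using assms by (auto simp: differentiable_on_def intro: differentiable_at_withinI)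
  then show "f \<in> Cinf_on S"
    unfolding Cinf_on_def Ck_on_def using differentiable_imp_continuous_on by blast
qed

text \<open>Smoothness is a greatest fixed point: any family of differentiable functions that is closed under
  partial derivatives, up to equality on the open set, consists of smooth functions. This replaces inductions
  over multi-indices in the closure properties below.\<close>

lemma Cinf_on_coinduct:
  assumes "open S" "f \<in> X"
    and "\<And>g x. g \<in> X \<Longrightarrow> x \<in> S \<Longrightarrow> g differentiable (at x)"
    and "\<And>g b. g \<in> X \<Longrightarrow> b \<in> Basis \<Longrightarrow> \<exists>h\<in>X. \<forall>x\<in>S. partial_deriv b g x = h x"
  shows "f \<in> Cinf_on S"
proof -
  have "set bs \<subseteq> Basis \<Longrightarrow> \<exists>h\<in>X. \<forall>x\<in>S. iter_deriv bs f x = h x" for bs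
  proof (induction bs)
    case Nil then show ?case using assms(2) by auto
  next
    case (Cons b bs)
    then obtain h where h: "h \<in> X" "\<forall>x\<in>S. iter_deriv bs f x = h x" by auto
    obtain k where k: "k \<in> X" "\<forall>x\<in>S. partial_deriv b h x = k x"
      using assms(4)[OF h(1), of b] Cons.prems by auto
    have "\<forall>x\<in>S. partial_deriv b (iter_deriv bs f) x = k x"
      using partial_deriv_cong[OF assms(1), of _ "iter_deriv bs f" h] h(2) k(2) by simp
    then show ?case using k by auto
  qed
  then have "set bs \<subseteq> Basis \<Longrightarrow> x \<in> S \<Longrightarrow> iter_deriv bs f differentiable (at x)" for bs x
    using assms(3) has_derivative_cong_open[OF assms(1), of x "iter_deriv bs f"]
    unfolding differentiable_def by metis
  then show ?thesis by (simp add: Cinf_on_iff[OF assms(1)])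
qed

lemma Cinf_on_differentiable:
  assumes "open S" "f \<in> Cinf_on S" "x \<in> S"
  shows "f differentiable (at x)"
proof -
  have "iter_deriv [] f differentiable (at x)"
    using assms Cinf_on_iff[OF assms(1)] by (metis empty_set empty_subsetI)
  then show ?thesis by simp
qed

lemma Cinf_on_iter_deriv:
  assumes "open S" "f \<in> Cinf_on S" "set as \<subseteq> Basis"
  shows "iter_deriv as f \<in> Cinf_on S"
  unfolding Cinf_on_iff[OF assms(1)]
proof (intro allI impI)
  fix bs :: "'a list" assume "set bs \<subseteq> Basis"
  then have "set (bs @ as) \<subseteq> Basis" using assms by auto
  then show "\<forall>x\<in>S. iter_deriv bs (iter_deriv as f) differentiable at x"
    using assms(2) unfolding Cinf_on_iff[OF assms(1)] iter_deriv_append[symmetric] by blast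
qed

lemma Cinf_on_partial_deriv:
  "open S \<Longrightarrow> f \<in> Cinf_on S \<Longrightarrow> b \<in> Basis \<Longrightarrow> partial_deriv b f \<in> Cinf_on S"
  using Cinf_on_iter_deriv[of S f "[b]"] by simp

lemma Cinf_on_cong:
  assumes "open S" "\<And>x. x \<in> S \<Longrightarrow> f x = g x" "f \<in> Cinf_on S"
  shows "g \<in> Cinf_on S"
proof -
  have "iter_deriv bs f differentiable (at x) \<longleftrightarrow> iter_deriv bs g differentiable (at x)" if "x \<in> S" for bs x
    unfolding differentiable_def
    using has_derivative_cong_open[OF assms(1) that, of "iter_deriv bs f" "iter_deriv bs g"]
      iter_deriv_cong[OF assms(1), of _ f g] assms(2) by auto
  then show ?thesis using assms(3) by (simp add: Cinf_on_iff[OF assms(1)])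
qed

lemma Cinf_on_Un:
  "open S \<Longrightarrow> open T \<Longrightarrow> f \<in> Cinf_on S \<Longrightarrow> f \<in> Cinf_on T \<Longrightarrow> f \<in> Cinf_on (S \<union> T)"
  by (auto simp: Cinf_on_iff open_Un)

lemma Cinf_on_subset:
  "open S \<Longrightarrow> open T \<Longrightarrow> T \<subseteq> S \<Longrightarrow> f \<in> Cinf_on S \<Longrightarrow> f \<in> Cinf_on T"
  by (auto simp: Cinf_on_iff)

lemma Cinf_on_imp_continuous_on:
  "open S \<Longrightarrow> f \<in> Cinf_on S \<Longrightarrow> continuous_on S f"
  using Cinf_on_differentiable differentiable_imp_continuous_on differentiable_at_imp_differentiable_on by metis

text \<open>A family whose partial derivatives are polynomials in the family itself generates an algebra of
  smooth functions (\<open>algebra_hull_Cinf\<close>). Products, chain rules, real powers and the flat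
  exponentials at the origin are all instances.\<close>

inductive_set algebra_hull :: "('e::euclidean_space \<Rightarrow> real) set \<Rightarrow> ('e \<Rightarrow> real) set"
  for X where
  base: "f \<in> X \<Longrightarrow> f \<in> algebra_hull X"
| const: "(\<lambda>_. c) \<in> algebra_hull X"
| add: "f \<in> algebra_hull X \<Longrightarrow> g \<in> algebra_hull X \<Longrightarrow> (\<lambda>x. f x + g x) \<in> algebra_hull X"
| mult: "f \<in> algebra_hull X \<Longrightarrow> g \<in> algebra_hull X \<Longrightarrow> (\<lambda>x. f x * g x) \<in> algebra_hull X"

lemma partial_deriv_const: "partial_deriv b (\<lambda>_. c) x = 0"
  by (rule partial_derivI[of _ "\<lambda>_. 0"]) simp

lemma partial_deriv_add:
  assumes "f differentiable (at x)" "g differentiable (at x)"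
  shows "partial_deriv b (\<lambda>x. f x + g x) x = partial_deriv b f x + partial_deriv b g x"
proof -
  obtain F G where "(f has_derivative F) (at x)" "(g has_derivative G) (at x)"
    using assms by (auto simp: differentiable_def)
  then show ?thesis using partial_derivI[OF has_derivative_add[of f F "at x" g G]] by (simp add: partial_derivI)
qed

lemma partial_deriv_mult:
  fixes f g :: "'e::euclidean_space \<Rightarrow> real"
  assumes "f differentiable (at x)" "g differentiable (at x)"
  shows "partial_deriv b (\<lambda>x. f x * g x) x = partial_deriv b f x * g x + f x * partial_deriv b g x"
proof -
  obtain F G where "(f has_derivative F) (at x)" "(g has_derivative G) (at x)"
    using assms by (auto simp: differentiable_def)
  then show ?thesis using partial_derivI[OF has_derivative_mult[of f F x UNIV g G]] by (simp add: partial_derivI)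
qed

lemma algebra_hull_Cinf:
  assumes S: "open S"
    and d: "\<And>g x. g \<in> X \<Longrightarrow> x \<in> S \<Longrightarrow> g differentiable (at x)"
    and p: "\<And>g b. g \<in> X \<Longrightarrow> b \<in> Basis \<Longrightarrow> \<exists>h\<in>algebra_hull X. \<forall>x\<in>S. partial_deriv b g x = h x"
  shows "algebra_hull X \<subseteq> Cinf_on S"
proof
  fix f assume f: "f \<in> algebra_hull X"
  have D: "g differentiable (at x)" if "g \<in> algebra_hull X" "x \<in> S" for g x
    using that by (induction) (auto intro: d)
  show "f \<in> Cinf_on S"
  proof (rule Cinf_on_coinduct[OF S f])
    fix g :: "'a \<Rightarrow> real" and b :: 'a assume "g \<in> algebra_hull X" "b \<in> Basis"
    then show "\<exists>h\<in>algebra_hull X. \<forall>x\<in>S. partial_deriv b g x = h x"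
    proof (induction)
      case (base f) then show ?case by (rule p)
    next
      case (const c) then show ?case using algebra_hull.const[of 0 X] by (auto simp: partial_deriv_const intro!: bexI)
    next
      case (add f g)
      then obtain h k where "h \<in> algebra_hull X" "k \<in> algebra_hull X"
        "\<forall>x\<in>S. partial_deriv b f x = h x" "\<forall>x\<in>S. partial_deriv b g x = k x" by auto
      then show ?case using add.hyps D
        by (intro bexI[of _ "\<lambda>x. h x + k x"]) (auto intro: algebra_hull.intros simp: partial_deriv_add)
    next
      case (mult f g)
      then obtain h k where "h \<in> algebra_hull X" "k \<in> algebra_hull X"
        "\<forall>x\<in>S. partial_deriv b f x = h x" "\<forall>x\<in>S. partial_deriv b g x = k x" by auto
      then show ?case using mult.hyps D
        by (intro bexI[of _ "\<lambda>x. h x * g x + f x * k x"]) (auto intro: algebra_hull.intros simp: partial_deriv_mult)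
    qed
  qed (use D in auto)
qed

lemma Cinf_on_const: "open S \<Longrightarrow> (\<lambda>_. c :: real) \<in> Cinf_on S"
  using algebra_hull_Cinf[of S "{}"] algebra_hull.const[of c "{}"] by auto

lemma
  fixes f g :: "'e::euclidean_space \<Rightarrow> real"
  assumes S: "open S" and f: "f \<in> Cinf_on S" and g: "g \<in> Cinf_on S"
  shows Cinf_on_add: "(\<lambda>x. f x + g x) \<in> Cinf_on S"
    and Cinf_on_mult: "(\<lambda>x. f x * g x) \<in> Cinf_on S"
proof -
  have "algebra_hull (Cinf_on S) \<subseteq> (Cinf_on S :: ('e \<Rightarrow> real) set)"
    by (rule algebra_hull_Cinf[OF S]) (auto intro: Cinf_on_differentiable[OF S] algebra_hull.base Cinf_on_partial_deriv[OF S])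
  then show "(\<lambda>x. f x + g x) \<in> Cinf_on S" "(\<lambda>x. f x * g x) \<in> Cinf_on S"
    using f g by (auto intro: algebra_hull.intros)
qed

lemma Cinf_on_sum:
  "open S \<Longrightarrow> (\<And>i. i \<in> I \<Longrightarrow> f i \<in> Cinf_on S) \<Longrightarrow> (\<lambda>x. \<Sum>i\<in>I. f i x :: real) \<in> Cinf_on S"
  by (induction I rule: infinite_finite_induct) (auto intro: Cinf_on_const Cinf_on_add)

lemma Cinf_on_prod:
  "open S \<Longrightarrow> (\<And>i. i \<in> I \<Longrightarrow> f i \<in> Cinf_on S) \<Longrightarrow> (\<lambda>x. \<Prod>i\<in>I. f i x :: real) \<in> Cinf_on S"
  by (induction I rule: infinite_finite_induct) (auto intro: Cinf_on_const Cinf_on_mult)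

lemma Cinf_on_minus:
  assumes "open S" "f \<in> Cinf_on S" shows "(\<lambda>x. - f x :: real) \<in> Cinf_on S"
  using Cinf_on_mult[OF assms(1) Cinf_on_const[of S "-1"] assms(2)] assms(1) by simp

lemma Cinf_on_diff:
  "open S \<Longrightarrow> f \<in> Cinf_on S \<Longrightarrow> g \<in> Cinf_on S \<Longrightarrow> (\<lambda>x. f x - g x :: real) \<in> Cinf_on S"
  using Cinf_on_add[of S f "\<lambda>x. - g x"] Cinf_on_minus[of S g] by simp

lemma Cinf_on_inner_left:
  assumes "open S" shows "(\<lambda>x. x \<bullet> c) \<in> Cinf_on S"
proof (rule Cinf_on_coinduct[OF assms, of _ "insert (\<lambda>x. x \<bullet> c) (range (\<lambda>r _. r))"])
  show "\<exists>h\<in>insert (\<lambda>x. x \<bullet> c) (range (\<lambda>r _. r)). \<forall>x\<in>S. partial_deriv b g x = h x"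
    if "g \<in> insert (\<lambda>x. x \<bullet> c) (range (\<lambda>r _. r))" for g b
  proof -
    have "((\<lambda>x. x \<bullet> c) has_derivative (\<lambda>h. h \<bullet> c)) (at x)" for x :: 'a
      by (auto intro!: derivative_eq_intros)
    then have "partial_deriv b (\<lambda>x. x \<bullet> c) x = b \<bullet> c" for x by (rule partial_derivI)
    then show ?thesis using that by (auto simp: partial_deriv_const)
  qed
qed (auto intro: bounded_linear_imp_differentiable bounded_linear_inner_left)

lemma Cinf_on_component:
  assumes "open S" "f \<in> Cinf_on S" shows "(\<lambda>x. f x \<bullet> c) \<in> Cinf_on S"
proof (rule Cinf_on_coinduct[OF assms(1), of _ "(\<lambda>g x. g x \<bullet> c) ` Cinf_on S"])
  fix g b assume "g \<in> (\<lambda>g x. g x \<bullet> c) ` Cinf_on S" "b \<in> (Basis :: 'a set)"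
  then obtain k where k: "k \<in> Cinf_on S" "g = (\<lambda>x. k x \<bullet> c)" by auto
  have "partial_deriv b g x = partial_deriv b k x \<bullet> c" if x: "x \<in> S" for x
  proof -
    obtain K where K: "(k has_derivative K) (at x)"
      using Cinf_on_differentiable[OF assms(1) k(1) x] by (auto simp: differentiable_def)
    have "(g has_derivative (\<lambda>h. K h \<bullet> c)) (at x)"
      unfolding k(2) by (auto intro!: derivative_eq_intros K)
    then show ?thesis using K by (simp add: partial_derivI)
  qed
  then show "\<exists>h\<in>(\<lambda>g x. g x \<bullet> c) ` Cinf_on S. \<forall>x\<in>S. partial_deriv b g x = h x"
    using Cinf_on_partial_deriv[OF assms(1) k(1) \<open>b \<in> Basis\<close>] by auto
next
  fix g x assume "g \<in> (\<lambda>g x. g x \<bullet> c) ` Cinf_on S" "x \<in> S"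
  then show "g differentiable (at x)"
    using Cinf_on_differentiable[OF assms(1)] by (auto intro!: differentiable_inner)
qed (use assms in auto)

lemma has_derivative_partial_derivs:
  fixes f :: "'e::euclidean_space \<Rightarrow> 'b::real_normed_vector"
  assumes "f differentiable (at x)"
  shows "(f has_derivative (\<lambda>h. \<Sum>b\<in>Basis. (h \<bullet> b) *\<^sub>R partial_deriv b f x)) (at x)"
proof -
  obtain F where F: "(f has_derivative F) (at x)" using assms by (auto simp: differentiable_def)
  have "F h = (\<Sum>b\<in>Basis. (h \<bullet> b) *\<^sub>R partial_deriv b f x)" for h
  proof -
    have "F h = F (\<Sum>b\<in>Basis. (h \<bullet> b) *\<^sub>R b)" by (simp add: euclidean_representation)
    also have "\<dots> = (\<Sum>b\<in>Basis. (h \<bullet> b) *\<^sub>R F b)"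
      using has_derivative_linear[OF F] by (simp add: linear_sum linear_scale)
    finally show ?thesis by (simp add: partial_derivI[OF F])
  qed
  then show ?thesis using F by (metis (no_types, lifting) ext)
qed

lemma partial_deriv_compose_affine:
  fixes L :: "'e::euclidean_space \<Rightarrow> 'd::euclidean_space" and f :: "'d \<Rightarrow> real"
  assumes f: "f differentiable (at (L x))" and L: "(L has_derivative L') (at x)"
  shows "partial_deriv b (\<lambda>x. f (L x)) x = (\<Sum>d\<in>Basis. (L' b \<bullet> d) * partial_deriv d f (L x))"
  using partial_derivI[OF has_derivative_compose[OF L has_derivative_partial_derivs[OF f]]] by simp

lemma Cinf_on_compose_affine:
  fixes L :: "'e::euclidean_space \<Rightarrow> 'd::euclidean_space" and f :: "'d \<Rightarrow> real"
  assumes f: "f \<in> Cinf_on V" and V: "open V" and S: "open S"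
    and L: "\<And>x. (L has_derivative L') (at x)" and LS: "\<And>x. x \<in> S \<Longrightarrow> L x \<in> V"
  shows "(\<lambda>x. f (L x)) \<in> Cinf_on S"
proof (rule Cinf_on_coinduct[OF S, of _ "(\<lambda>f x. f (L x)) ` Cinf_on V"])
  fix g x assume "g \<in> (\<lambda>f x. f (L x)) ` (Cinf_on V :: ('d \<Rightarrow> real) set)" "x \<in> S"
  then show "g differentiable (at x)"
    using Cinf_on_differentiable[OF V _ LS] has_derivative_compose[OF L] unfolding differentiable_def by blast
next
  fix g b assume "g \<in> (\<lambda>f x. f (L x)) ` (Cinf_on V :: ('d \<Rightarrow> real) set)" "b \<in> (Basis :: 'e set)"
  then obtain k where k: "k \<in> Cinf_on V" "g = (\<lambda>x. k (L x))" by auto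
  let ?k = "\<lambda>y. \<Sum>d\<in>Basis. (L' b \<bullet> d) * partial_deriv d k y"
  have "?k \<in> Cinf_on V"
    by (intro Cinf_on_sum V Cinf_on_mult Cinf_on_const Cinf_on_partial_deriv k)
  moreover have "partial_deriv b g x = ?k (L x)" if "x \<in> S" for x
    unfolding k(2) by (rule partial_deriv_compose_affine[OF Cinf_on_differentiable[OF V k(1) LS[OF that]] L])
  ultimately show "\<exists>h\<in>(\<lambda>f x. f (L x)) ` Cinf_on V. \<forall>x\<in>S. partial_deriv b g x = h x"
    by (intro bexI[of _ "\<lambda>x. ?k (L x)"]) auto
qed (use f in auto)

lemma partial_deriv_compose:
  fixes f :: "'e::euclidean_space \<Rightarrow> real" and g :: "real \<Rightarrow> real"
  assumes "f differentiable (at x)" "g differentiable (at (f x))"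
  shows "(\<lambda>x. g (f x)) differentiable (at x)"
    and "partial_deriv b (\<lambda>x. g (f x)) x = partial_deriv 1 g (f x) * partial_deriv b f x"
proof -
  obtain F G where F: "(f has_derivative F) (at x)" and G: "(g has_derivative G) (at (f x))"
    using assms by (auto simp: differentiable_def)
  have C: "((\<lambda>x. g (f x)) has_derivative (\<lambda>h. G (F h))) (at x)"
    using has_derivative_compose[OF F G] .
  then show "(\<lambda>x. g (f x)) differentiable (at x)" by (auto simp: differentiable_def)
  have "G (F b) = G (F b *\<^sub>R 1)" by simp
  also have "\<dots> = F b *\<^sub>R G 1" using linear_scale[OF has_derivative_linear[OF G]] by blast
  finally show "partial_deriv b (\<lambda>x. g (f x)) x = partial_deriv 1 g (f x) * partial_deriv b f x"
    by (simp add: partial_derivI[OF C] partial_derivI[OF F] partial_derivI[OF G])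
qed

lemma Cinf_on_compose:
  fixes f :: "'e::euclidean_space \<Rightarrow> real" and g :: "real \<Rightarrow> real"
  assumes S: "open S" and V: "open V" and g: "g \<in> Cinf_on V" and f: "f \<in> Cinf_on S"
    and fS: "\<And>x. x \<in> S \<Longrightarrow> f x \<in> V"
  shows "(\<lambda>x. g (f x)) \<in> Cinf_on S"
proof -
  let ?X = "Cinf_on S \<union> (\<lambda>(g :: real \<Rightarrow> real) x. g (f x)) ` Cinf_on V"
  have "algebra_hull ?X \<subseteq> Cinf_on S"
  proof (rule algebra_hull_Cinf[OF S])
    fix h x assume h: "h \<in> ?X" and x: "x \<in> S"
    show "h differentiable (at x)"
    proof (cases "h \<in> Cinf_on S")
      case True then show ?thesis by (rule Cinf_on_differentiable[OF S _ x])
    next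
      case False
      then obtain k where k: "k \<in> Cinf_on V" "h = (\<lambda>x. k (f x))" using h by auto
      show ?thesis unfolding k(2)
        by (rule partial_deriv_compose(1)[OF Cinf_on_differentiable[OF S f x] Cinf_on_differentiable[OF V k(1) fS[OF x]]])
    qed
  next
    fix h b assume h: "h \<in> ?X" and b: "b \<in> (Basis :: 'e set)"
    show "\<exists>k\<in>algebra_hull ?X. \<forall>x\<in>S. partial_deriv b h x = k x"
    proof (cases "h \<in> Cinf_on S")
      case True then show ?thesis
        using Cinf_on_partial_deriv[OF S _ b] by (intro bexI[of _ "partial_deriv b h"]) (auto intro: algebra_hull.base)
    next
      case False
      then obtain k where k: "k \<in> Cinf_on V" "h = (\<lambda>x. k (f x))" using h by auto
      have "\<forall>x\<in>S. partial_deriv b h x = partial_deriv 1 k (f x) * partial_deriv b f x"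
        unfolding k(2) using partial_deriv_compose(2)[OF Cinf_on_differentiable[OF S f] Cinf_on_differentiable[OF V k(1) fS]] by simp
      moreover have "partial_deriv 1 k \<in> Cinf_on V" using Cinf_on_partial_deriv[OF V k(1)] by simp
      ultimately show ?thesis using Cinf_on_partial_deriv[OF S f b]
        by (intro bexI[of _ "\<lambda>x. partial_deriv 1 k (f x) * partial_deriv b f x"])
          (auto intro!: algebra_hull.mult intro: algebra_hull.base)
    qed
  qed
  then show ?thesis using g by (auto intro: algebra_hull.base)
qed

lemma partial_deriv_real:
  assumes "(g has_real_derivative D) (at x)" shows "partial_deriv b g x = D * b"
  using partial_derivI[of g "(*) D" x b] assms by (simp add: has_field_derivative_def)

lemma Cinf_on_real:
  fixes X :: "(real \<Rightarrow> real) set"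
  assumes S: "open S" and d: "\<And>g. g \<in> X \<Longrightarrow> \<exists>h\<in>algebra_hull X. \<forall>x\<in>S. (g has_real_derivative h x) (at x)"
  shows "X \<subseteq> Cinf_on S"
proof -
  have "algebra_hull X \<subseteq> Cinf_on S"
  proof (rule algebra_hull_Cinf[OF S])
    fix g x assume "g \<in> X" "x \<in> S" then show "g differentiable (at x)"
      using d[of g] by (auto simp: real_differentiable_def)
  next
    fix g and b :: real assume "g \<in> X" "b \<in> Basis"
    then show "\<exists>h\<in>algebra_hull X. \<forall>x\<in>S. partial_deriv b g x = h x"
      using d[of g] partial_deriv_real[of g _ _ b] by (metis Basis_real_def mult.right_neutral singletonD)
  qed
  then show ?thesis using algebra_hull.base by blast
qed

lemma Cinf_on_inverse: "(\<lambda>x::real. inverse x) \<in> Cinf_on {0<..}"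
proof -
  have "{\<lambda>x::real. inverse x} \<subseteq> Cinf_on {0<..}"
  proof (rule Cinf_on_real)
    fix g :: "real \<Rightarrow> real" assume "g \<in> {\<lambda>x. inverse x}"
    then show "\<exists>h\<in>algebra_hull {\<lambda>x::real. inverse x}. \<forall>x\<in>{0<..}. (g has_real_derivative h x) (at x)"
      by (intro bexI[of _ "\<lambda>x. (-1) * (inverse x * inverse x)"] algebra_hull.mult algebra_hull.const algebra_hull.base)
        (auto intro!: derivative_eq_intros)
  qed auto
  then show ?thesis by auto
qed

lemma Cinf_on_powr: "(\<lambda>x::real. x powr a) \<in> Cinf_on {0<..}"
proof -
  have "range (\<lambda>a x::real. x powr a) \<subseteq> Cinf_on {0<..}"
  proof (rule Cinf_on_real)
    fix g :: "real \<Rightarrow> real" assume "g \<in> range (\<lambda>a x. x powr a)"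
    then obtain a where g: "g = (\<lambda>x. x powr a)" by auto
    show "\<exists>h\<in>algebra_hull (range (\<lambda>a x::real. x powr a)). \<forall>x\<in>{0<..}. (g has_real_derivative h x) (at x)"
      unfolding g
      by (intro bexI[of _ "\<lambda>x. a * x powr (a - 1)"] algebra_hull.mult algebra_hull.const algebra_hull.base)
        (auto intro!: derivative_eq_intros)
  qed auto
  then show ?thesis by auto
qed

section \<open>Smooth cutoffs\<close>

definition flat :: "nat \<Rightarrow> real \<Rightarrow> real" where
  "flat n s = (if s > 0 then (1 / s) ^ n * exp (- (1 / s)) else 0)"

lemma flat_tendsto_0: "(flat n \<longlongrightarrow> 0) (at_right 0)"
proof -
  have "((\<lambda>x::real. x ^ n / exp x) \<longlongrightarrow> 0) at_top" by (rule tendsto_power_div_exp_0)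
  then have "((\<lambda>s::real. (inverse s) ^ n / exp (inverse s)) \<longlongrightarrow> 0) (at_right 0)"
    using filterlim_compose[OF _ filterlim_inverse_at_top_right] by blast
  moreover have "eventually (\<lambda>s. (inverse s) ^ n / exp (inverse s) = flat n s) (at_right (0::real))"
    by (auto simp: flat_def eventually_at_filter exp_minus field_simps)
  ultimately show ?thesis by (rule Lim_transform_eventually)
qed

text \<open>The family \<open>s\<^bsup>-n\<^esup> exp(-1/s)\<close>, extended by zero, is closed under
  differentiation up to linear combinations; the only point that needs an argument is the origin, where the
  exponential beats every power.\<close>

lemma flat_deriv: "(flat n has_real_derivative (flat (n + 2) s - real n * flat (n + 1) s)) (at s)"
proof -
  consider "s > 0" | "s < 0" | "s = 0" by linarith
  then show ?thesis
  proof cases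
    case 1
    have "((\<lambda>s. (1 / s) ^ n * exp (- (1 / s))) has_real_derivative (flat (n + 2) s - real n * flat (n + 1) s)) (at s)"
    proof -
      define u where "u = 1 / s"
      have r: "((\<lambda>s. 1 / s) has_real_derivative - (u * u)) (at s)"
        using 1 by (auto intro!: derivative_eq_intros simp: u_def)
      have e: "((\<lambda>s. exp (- (1 / s))) has_real_derivative exp (- u) * (u * u)) (at s)"
        using DERIV_chain2[OF DERIV_exp DERIV_minus[OF r]] by (simp add: u_def)
      have "real n * (- (u * u) * u ^ (n - Suc 0)) * exp (- u) + exp (- u) * (u * u) * u ^ n
          = flat (n + 2) s - real n * flat (n + 1) s"
        using 1 by (cases n) (simp_all add: flat_def u_def[symmetric] algebra_simps power2_eq_square)
      then show ?thesis
        using DERIV_mult[OF DERIV_power[OF r, of n] e] unfolding u_def[symmetric] by (rule DERIV_cong[rotated])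
    qed
    then show ?thesis
      by (rule has_field_derivative_transform_within_open[of _ _ _ "{0<..}"]) (use 1 in \<open>auto simp: flat_def\<close>)
  next
    case 2
    have "((\<lambda>s. 0) has_real_derivative (flat (n + 2) s - real n * flat (n + 1) s)) (at s)"
      using 2 by (auto simp: flat_def)
    then show ?thesis
      by (rule has_field_derivative_transform_within_open[of _ _ _ "{..<0}"]) (use 2 in \<open>auto simp: flat_def\<close>)
  next
    case 3
    have "((\<lambda>h. (flat n h) / h) \<longlongrightarrow> 0) (at_right 0)"
      by (rule Lim_transform_eventually[OF flat_tendsto_0[of "Suc n"]])
        (auto simp: flat_def eventually_at_filter)
    moreover have "((\<lambda>h. (flat n h) / h) \<longlongrightarrow> 0) (at_left 0)"
      by (rule Lim_transform_eventually[OF tendsto_const])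
        (auto simp: flat_def eventually_at_filter)
    ultimately have "((\<lambda>h. (flat n h) / h) \<longlongrightarrow> 0) (at 0)"
      by (simp add: filterlim_split_at)
    then show ?thesis using 3 by (simp add: DERIV_def flat_def)
  qed
qed

lemma Cinf_on_flat: "open S \<Longrightarrow> flat n \<in> Cinf_on S"
proof -
  assume S: "open S"
  have "range flat \<subseteq> Cinf_on S"
  proof (rule Cinf_on_real[OF S])
    fix g assume "g \<in> range flat"
    then obtain n where g: "g = flat n" by auto
    show "\<exists>h\<in>algebra_hull (range flat). \<forall>x\<in>S. (g has_real_derivative h x) (at x)"
      unfolding g
      by (intro bexI[of _ "\<lambda>x. flat (n + 2) x + (- real n) * flat (n + 1) x"] ballI
          algebra_hull.add algebra_hull.mult algebra_hull.const algebra_hull.base)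
        (auto intro: flat_deriv[THEN DERIV_cong])
  qed
  then show ?thesis by auto
qed

definition smooth_step :: "real \<Rightarrow> real" where
  "smooth_step s = flat 0 s * inverse (flat 0 s + flat 0 (1 - s))"

lemma flat_sum_pos: "flat 0 s + flat 0 (1 - s) > 0"
  by (auto simp: flat_def add_pos_pos)

lemma Cinf_on_smooth_step: "smooth_step \<in> Cinf_on UNIV"
proof -
  have 1: "(\<lambda>s::real. 1 - s) \<in> Cinf_on UNIV"
    using Cinf_on_diff[OF open_UNIV Cinf_on_const Cinf_on_inner_left[of UNIV "1::real"]] by simp
  have 2: "(\<lambda>s. flat 0 (1 - s)) \<in> Cinf_on UNIV"
    by (rule Cinf_on_compose[OF open_UNIV open_UNIV Cinf_on_flat[OF open_UNIV] 1]) auto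
  have "(\<lambda>s. inverse (flat 0 s + flat 0 (1 - s))) \<in> Cinf_on UNIV"
    by (rule Cinf_on_compose[OF open_UNIV open_greaterThan Cinf_on_inverse Cinf_on_add[OF open_UNIV Cinf_on_flat[OF open_UNIV] 2]]) (auto simp: flat_sum_pos)
  then show ?thesis unfolding smooth_step_def[abs_def]
    by (intro Cinf_on_mult Cinf_on_flat) auto
qed

lemma smooth_step_bounds: "0 \<le> smooth_step s" "smooth_step s \<le> 1"
  using flat_sum_pos[of s] by (auto simp: smooth_step_def flat_def field_simps)

lemma smooth_step_eq: "s \<le> 0 \<Longrightarrow> smooth_step s = 0" "s \<ge> 1 \<Longrightarrow> smooth_step s = 1"
  by (auto simp: smooth_step_def flat_def)

section \<open>Test functions\<close>

lemma testI:
  assumes "\<phi> \<in> Cinf_on UNIV" "compact K" "K \<subseteq> S" "\<And>x. x \<notin> K \<Longrightarrow> \<phi> x = 0"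
  shows "\<phi> \<in> test_functions S"
proof -
  have sub: "closure {x. \<phi> x \<noteq> 0} \<subseteq> K"
  proof (rule closure_minimal)
    show "{x. \<phi> x \<noteq> 0} \<subseteq> K" using assms(4) by blast
  qed (rule compact_imp_closed[OF assms(2)])
  have "compact (closure {x. \<phi> x \<noteq> 0})"
    using compact_Int_closed[OF assms(2) closed_closure] Int_absorb1[OF sub] by metis
  then show ?thesis unfolding test_functions_def
    by (intro CollectI conjI assms(1) order_trans[OF sub assms(3)])
qed

lemma testE:
  assumes "\<phi> \<in> test_functions S"
  obtains K where "compact K" "K \<subseteq> S" "\<And>x. x \<notin> K \<Longrightarrow> \<phi> x = 0"
proof (rule that[of "closure {x. \<phi> x \<noteq> 0}"])
  show "\<phi> x = 0" if "x \<notin> closure {x. \<phi> x \<noteq> 0}" for x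
    using that closure_subset[of "{x. \<phi> x \<noteq> 0}"] by blast
qed (use assms in \<open>simp_all add: test_functions_def\<close>)

lemma test_Cinf: "\<phi> \<in> test_functions S \<Longrightarrow> \<phi> \<in> Cinf_on UNIV"
  by (simp add: test_functions_def)

lemma test_outside: "\<phi> \<in> test_functions S \<Longrightarrow> x \<notin> S \<Longrightarrow> \<phi> x = 0"
  by (metis testE subsetD)

lemma test_mono: "S \<subseteq> S' \<Longrightarrow> \<phi> \<in> test_functions S \<Longrightarrow> \<phi> \<in> test_functions S'"
  by (auto simp: test_functions_def)

lemma test_continuous: "\<phi> \<in> test_functions S \<Longrightarrow> continuous_on X \<phi>"
  using Cinf_on_imp_continuous_on[OF open_UNIV test_Cinf] continuous_on_subset by blast

lemma test_bounded:
  assumes "\<phi> \<in> test_functions S" obtains C where "C > 0" "\<And>x. \<bar>\<phi> x\<bar> \<le> C"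
proof -
  obtain K where K: "compact K" "\<And>x. x \<notin> K \<Longrightarrow> \<phi> x = 0" using testE[OF assms] by metis
  have "bounded (\<phi> ` K)"
    using compact_imp_bounded compact_continuous_image test_continuous[OF assms] K(1) by blast
  then obtain C where "C > 0" "\<And>x. x \<in> K \<Longrightarrow> \<bar>\<phi> x\<bar> \<le> C" by (auto simp: bounded_pos)
  then show thesis using that[of C] K(2) by (metis abs_zero less_imp_le)
qed

lemma test_partial_deriv:
  assumes "\<phi> \<in> test_functions S" "b \<in> Basis"
  shows "partial_deriv b \<phi> \<in> test_functions S"
proof -
  obtain K where K: "compact K" "K \<subseteq> S" "\<And>x. x \<notin> K \<Longrightarrow> \<phi> x = 0" using testE[OF assms(1)] by metis
  have "partial_deriv b \<phi> x = 0" if "x \<notin> K" for x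
    using partial_deriv_cong[of "-K" x \<phi> "\<lambda>_. 0" b] that K compact_imp_closed[OF K(1)]
    by (simp add: open_Compl partial_deriv_const)
  then show ?thesis
    by (rule testI[OF Cinf_on_partial_deriv[OF open_UNIV test_Cinf[OF assms(1)] assms(2)] K(1,2)])
qed

lemma test_iter_deriv:
  "\<phi> \<in> test_functions S \<Longrightarrow> set bs \<subseteq> Basis \<Longrightarrow> iter_deriv bs \<phi> \<in> test_functions S"
  by (induction bs) (auto intro: test_partial_deriv)

text \<open>The product is smooth on the whole space, since it vanishes near the complement of
  \<open>S\<close>, whatever values the coefficient takes there.\<close>

lemma test_mult:
  assumes S: "open S" and f: "f \<in> Cinf_on S" and \<phi>: "\<phi> \<in> test_functions S"
  shows "(\<lambda>x. f x * \<phi> x) \<in> test_functions S"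
proof -
  obtain K where K: "compact K" "K \<subseteq> S" "\<And>x. x \<notin> K \<Longrightarrow> \<phi> x = 0" using testE[OF \<phi>] by metis
  have oK: "open (- K)" using K(1) compact_imp_closed by auto
  have "(\<lambda>x. f x * \<phi> x) \<in> Cinf_on S"
    using Cinf_on_mult[OF S f Cinf_on_subset[OF open_UNIV S _ test_Cinf[OF \<phi>]]] by simp
  moreover have "(\<lambda>x. f x * \<phi> x) \<in> Cinf_on (- K)"
    by (rule Cinf_on_cong[OF oK _ Cinf_on_const[OF oK, of 0]]) (simp add: K)
  ultimately have "(\<lambda>x. f x * \<phi> x) \<in> Cinf_on (S \<union> - K)" by (rule Cinf_on_Un[OF S oK])
  moreover have "S \<union> - K = UNIV" using K(2) by auto
  ultimately show ?thesis using K by (intro testI[of _ K]) auto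
qed

lemma test_zero: "(\<lambda>_. 0) \<in> test_functions S"
  by (rule testI[of _ "{}"]) (auto intro: Cinf_on_const)

lemma test_borel: "\<phi> \<in> test_functions S \<Longrightarrow> \<phi> \<in> borel_measurable borel"
  by (intro borel_measurable_continuous_onI test_continuous)

lemma test_lebesgue: "\<phi> \<in> test_functions S \<Longrightarrow> \<phi> \<in> borel_measurable lebesgue"
  by (rule measurable_completion) (simp add: test_borel)

definition box_bump :: "'e::euclidean_space \<Rightarrow> 'e \<Rightarrow> 'e \<Rightarrow> real" where
  "box_bump l u x = (\<Prod>b\<in>Basis. flat 0 (x \<bullet> b - l \<bullet> b) * flat 0 (u \<bullet> b - x \<bullet> b))"

lemma flat_0_pos_iff: "flat 0 s > 0 \<longleftrightarrow> s > 0" and flat_nonneg: "flat 0 s \<ge> 0"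
  and flat_zero: "s \<le> 0 \<Longrightarrow> flat n s = 0"
  by (auto simp: flat_def)

lemma box_bump_pos: "x \<in> box l u \<Longrightarrow> box_bump l u x > 0"
  unfolding box_bump_def by (intro prod_pos) (auto simp: mem_box flat_0_pos_iff)

lemma box_bump_nonneg: "box_bump l u x \<ge> 0"
  unfolding box_bump_def by (intro prod_nonneg) (auto simp: flat_nonneg)

lemma box_bump_zero: "x \<notin> box l u \<Longrightarrow> box_bump l u x = 0"
  unfolding box_bump_def by (force simp: mem_box not_less intro!: prod_zero flat_zero)

lemma Cinf_on_box_bump: "box_bump l u \<in> Cinf_on UNIV"
  unfolding box_bump_def[abs_def]
  by (intro Cinf_on_prod Cinf_on_mult Cinf_on_compose[OF open_UNIV open_UNIV Cinf_on_flat]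
      Cinf_on_diff Cinf_on_inner_left Cinf_on_const) auto

text \<open>Finitely many box bumps whose supports lie in \<open>U\<close> have a positive sum on
  \<open>K\<close>; a smooth step applied to a multiple of this sum is equal to one near
  \<open>K\<close>.\<close>

lemma smooth_Urysohn:
  fixes K U :: "'e::euclidean_space set"
  assumes K: "compact K" and U: "open U" "K \<subseteq> U"
  obtains \<phi> V where "\<phi> \<in> test_functions U" "\<And>x. 0 \<le> \<phi> x" "\<And>x. \<phi> x \<le> 1"
    "open V" "K \<subseteq> V" "\<And>x. x \<in> V \<Longrightarrow> \<phi> x = 1"
proof (cases "K = {}")
  case True
  show thesis by (rule that[of "\<lambda>_. 0" "{}"]) (use True in \<open>auto intro: test_zero\<close>)
next
  case False
  have "\<exists>l u. p \<in> box l u \<and> cbox l u \<subseteq> U" if p: "p \<in> K" for p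
  proof -
    have "p \<in> U" using U(2) p by auto
    from open_contains_cbox[OF U(1) this] show ?thesis by metis
  qed
  then obtain l u where lu: "\<And>p. p \<in> K \<Longrightarrow> p \<in> box (l p) (u p) \<and> cbox (l p) (u p) \<subseteq> U" by metis
  obtain P where P: "P \<subseteq> K" "finite P" "K \<subseteq> (\<Union>p\<in>P. box (l p) (u p))"
  proof (rule compactE_image[OF K, of K "\<lambda>p. box (l p) (u p)"])
    show "K \<subseteq> (\<Union>p\<in>K. box (l p) (u p))" using lu by blast
  qed (auto intro: that)
  define B where "B x = (\<Sum>p\<in>P. box_bump (l p) (u p) x)" for x
  have B_Cinf: "B \<in> Cinf_on UNIV"
    unfolding B_def[abs_def] by (intro Cinf_on_sum Cinf_on_box_bump open_UNIV)
  have B_cont: "continuous_on X B" for X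
    using Cinf_on_imp_continuous_on[OF open_UNIV B_Cinf] continuous_on_subset by blast
  have B_pos: "B x > 0" if "x \<in> K" for x
  proof -
    obtain p where "p \<in> P" "x \<in> box (l p) (u p)" using subsetD[OF P(3) \<open>x \<in> K\<close>] by auto
    then show ?thesis unfolding B_def
      by (intro sum_pos2[OF P(2)]) (auto intro: box_bump_pos box_bump_nonneg)
  qed
  obtain x0 where x0: "x0 \<in> K" "\<And>x. x \<in> K \<Longrightarrow> B x0 \<le> B x"
    using continuous_attains_inf[OF K False B_cont] by blast
  define m where "m = B x0 / 2"
  have m: "m > 0" "\<And>x. x \<in> K \<Longrightarrow> m < B x"
    using B_pos[OF x0(1)] x0(2) unfolding m_def by force+
  define \<phi> where "\<phi> x = smooth_step (inverse m * B x)" for x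
  define C where "C = (\<Union>p\<in>P. cbox (l p) (u p))"
  show thesis
  proof (rule that[of \<phi> "{x. m < B x}"])
    have "\<phi> \<in> Cinf_on UNIV" unfolding \<phi>_def[abs_def]
      by (intro Cinf_on_compose[OF open_UNIV open_UNIV Cinf_on_smooth_step] Cinf_on_mult Cinf_on_const B_Cinf) auto
    moreover have "compact C" unfolding C_def using P(2) by (intro compact_UN) auto
    moreover have "C \<subseteq> U" unfolding C_def using lu P(1) by blast
    moreover have "\<phi> x = 0" if "x \<notin> C" for x
    proof -
      have "B x = 0" unfolding B_def
        using that box_subset_cbox by (intro sum.neutral ballI box_bump_zero) (auto simp: C_def)
      then show ?thesis by (simp add: \<phi>_def smooth_step_eq)
    qed
    ultimately show "\<phi> \<in> test_functions U" by (rule testI)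
    show "open {x. m < B x}"
      using open_Collect_less[OF continuous_on_const B_cont] by simp
    show "\<phi> x = 1" if "x \<in> {x. m < B x}" for x
      using that m(1) by (auto simp: \<phi>_def field_simps intro!: smooth_step_eq)
  qed (use m in \<open>auto simp: \<phi>_def smooth_step_bounds\<close>)
qed

section \<open>Weak derivatives\<close>

lemma integrable_mult_bounded:
  fixes f g :: "'x \<Rightarrow> real"
  assumes "integrable M f" "g \<in> borel_measurable M" "\<And>x. x \<in> space M \<Longrightarrow> \<bar>g x\<bar> \<le> C"
  shows "integrable M (\<lambda>x. f x * g x)"
proof (rule Bochner_Integration.integrable_bound[of M "\<lambda>x. C * f x"])
  show "AE x in M. norm (f x * g x) \<le> norm (C * f x)"
  proof (rule AE_I2)
    fix x assume "x \<in> space M"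
    then have "\<bar>g x\<bar> \<le> \<bar>C\<bar>" using assms(3) by fastforce
    then show "norm (f x * g x) \<le> norm (C * f x)"
      by (simp add: abs_mult mult.commute[of "\<bar>f x\<bar>"] mult_right_mono)
  qed
qed (use assms in auto)

lemma L1_loc_integrable:
  assumes "u \<in> L1_loc S" "compact K" "K \<subseteq> S"
  shows "integrable lebesgue (\<lambda>x. indicator K x * u x)"
  using assms by (auto simp: L1_loc_def set_integrable_def)

lemma L1_loc_test_integrable:
  assumes "u \<in> L1_loc S" "\<phi> \<in> test_functions S"
  shows "integrable lebesgue (\<lambda>x. u x * \<phi> x)"
proof -
  obtain K where K: "compact K" "K \<subseteq> S" "\<And>x. x \<notin> K \<Longrightarrow> \<phi> x = 0" using testE[OF assms(2)] by metis
  obtain C where C: "\<And>x. \<bar>\<phi> x\<bar> \<le> C" using test_bounded[OF assms(2)] by metis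
  have "integrable lebesgue (\<lambda>x. (indicator K x * u x) * \<phi> x)"
    by (rule integrable_mult_bounded[OF L1_loc_integrable[OF assms(1) K(1,2)] test_lebesgue[OF assms(2)] C])
  also have "(\<lambda>x. (indicator K x * u x) * \<phi> x) = (\<lambda>x. u x * \<phi> x)"
  proof
    show "(indicator K x * u x) * \<phi> x = u x * \<phi> x" for x by (cases "x \<in> K") (simp_all add: K(3))
  qed
  finally show ?thesis .
qed

lemma LINT_lebesgue_on_test:
  assumes "S \<in> sets lebesgue" "\<And>x. x \<notin> S \<Longrightarrow> \<phi> x = 0"
  shows "(LINT x|lebesgue_on S. u x * \<phi> x) = (LINT x|lebesgue. u x * \<phi> x :: real)"
proof -
  have "(LINT x|lebesgue_on S. u x * \<phi> x) = (LINT x|lebesgue. indicator S x *\<^sub>R (u x * \<phi> x))"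
    using assms by (intro integral_restrict_space) auto
  also have "\<dots> = (LINT x|lebesgue. u x * \<phi> x)"
    using assms(2) by (intro Bochner_Integration.integral_cong) (auto simp: indicator_def)
  finally show ?thesis .
qed

lemma L1_loc_mult_continuous:
  assumes f: "continuous_on S f" and u: "u \<in> L1_loc S"
  shows "(\<lambda>x. f x * u x) \<in> L1_loc S"
  unfolding L1_loc_def
proof (intro CollectI allI impI)
  fix K assume K: "compact K \<and> K \<subseteq> S"
  then have cf: "continuous_on K f" using f continuous_on_subset by blast
  have "bounded (f ` K)" using compact_imp_bounded compact_continuous_image[OF cf] K by blast
  moreover have "K \<in> sets lebesgue" using K by (simp add: lmeasurable_compact fmeasurableD)
  moreover have "f \<in> borel_measurable (lebesgue_on K)"
    using continuous_imp_measurable_on_sets_lebesgue[OF cf] calculation by simp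
  moreover have "u absolutely_integrable_on K" using u K by (simp add: L1_loc_def)
  ultimately show "(\<lambda>x. f x * u x) absolutely_integrable_on K"
    using absolutely_integrable_bounded_measurable_product[OF bilinear_times] by blast
qed

lemma L1_loc_add: "u \<in> L1_loc S \<Longrightarrow> v \<in> L1_loc S \<Longrightarrow> (\<lambda>x. u x + v x) \<in> L1_loc S"
  unfolding L1_loc_def by (auto intro: set_integral_add(1))

lemma open_sets_lebesgue: "open S \<Longrightarrow> S \<in> sets lebesgue"
  by (simp add: lmeasurable_open borel_open sets_completionI_sets)

text \<open>A test function vanishes outside \<open>S\<close>, so that all pairings may be taken over the
  whole space.\<close>

lemma has_weak_deriv_iff:
  assumes "open S" "set bs \<subseteq> Basis"
  shows "has_weak_deriv S bs u g \<longleftrightarrow> u \<in> L1_loc S \<and> g \<in> L1_loc S \<and>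
     (\<forall>\<phi>\<in>test_functions S. (LINT x|lebesgue. u x * iter_deriv bs \<phi> x) =
        (- 1) ^ length bs * (LINT x|lebesgue. g x * \<phi> x))"
proof -
  have "(LINT x|lebesgue_on S. u x * iter_deriv bs \<phi> x) = (LINT x|lebesgue. u x * iter_deriv bs \<phi> x)"
    "(LINT x|lebesgue_on S. g x * \<phi> x) = (LINT x|lebesgue. g x * \<phi> x)"
    if "\<phi> \<in> test_functions S" for \<phi>
    using LINT_lebesgue_on_test[OF open_sets_lebesgue[OF assms(1)]] that
      test_outside[OF test_iter_deriv[OF that assms(2)]] test_outside[OF that]
    by blast+
  then show ?thesis unfolding has_weak_deriv_def by auto
qed

text \<open>The product rule: test the weak derivative of \<open>u\<close> with \<open>f \<phi>\<close>, which
  is again a test function.\<close>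

lemma has_weak_deriv_mult_smooth:
  assumes S: "open S" and b: "b \<in> Basis" and w: "has_weak_deriv S [b] u g" and f: "f \<in> Cinf_on S"
  shows "has_weak_deriv S [b] (\<lambda>x. f x * u x) (\<lambda>x. f x * g x + partial_deriv b f x * u x)"
proof -
  have b': "set [b] \<subseteq> Basis" using b by simp
  note W = w[unfolded has_weak_deriv_iff[OF S b']]
  have u: "u \<in> L1_loc S" and g: "g \<in> L1_loc S" using W by auto
  have df: "partial_deriv b f \<in> Cinf_on S" by (rule Cinf_on_partial_deriv[OF S f b])
  note cont = Cinf_on_imp_continuous_on[OF S f] Cinf_on_imp_continuous_on[OF S df]
  have "(LINT x|lebesgue. f x * u x * iter_deriv [b] \<phi> x) =
        (- 1) ^ length [b] * (LINT x|lebesgue. (f x * g x + partial_deriv b f x * u x) * \<phi> x)"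
    if \<phi>: "\<phi> \<in> test_functions S" for \<phi>
  proof -
    let ?f\<phi> = "\<lambda>x. f x * \<phi> x" and ?d\<phi> = "\<lambda>x. partial_deriv b f x * \<phi> x"
    have t: "?f\<phi> \<in> test_functions S" "?d\<phi> \<in> test_functions S"
      by (rule test_mult[OF S f \<phi>], rule test_mult[OF S df \<phi>])
    have d: "partial_deriv b ?f\<phi> x = partial_deriv b f x * \<phi> x + f x * partial_deriv b \<phi> x" if "x \<in> S" for x
      by (rule partial_deriv_mult[OF Cinf_on_differentiable[OF S f that] Cinf_on_differentiable[OF open_UNIV test_Cinf[OF \<phi>]]]) simp
    have "f x * u x * iter_deriv [b] \<phi> x = u x * partial_deriv b ?f\<phi> x - u x * ?d\<phi> x" for x
    proof (cases "x \<in> S")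
      case True then show ?thesis using d by (simp add: algebra_simps)
    next
      case False
      then show ?thesis
        using test_outside[OF \<phi>] test_outside[OF test_partial_deriv[OF \<phi> b]]
          test_outside[OF test_partial_deriv[OF t(1) b]] by simp
    qed
    then have "(LINT x|lebesgue. f x * u x * iter_deriv [b] \<phi> x)
        = (LINT x|lebesgue. u x * partial_deriv b ?f\<phi> x - u x * ?d\<phi> x)" by simp
    also have "\<dots> = (LINT x|lebesgue. u x * partial_deriv b ?f\<phi> x) - (LINT x|lebesgue. u x * ?d\<phi> x)"
      by (intro Bochner_Integration.integral_diff L1_loc_test_integrable[OF u] t test_partial_deriv b)
    also have "(LINT x|lebesgue. u x * partial_deriv b ?f\<phi> x) = - (LINT x|lebesgue. g x * ?f\<phi> x)"
      using W t(1) by auto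
    also have "- (LINT x|lebesgue. g x * ?f\<phi> x) - (LINT x|lebesgue. u x * ?d\<phi> x)
       = - ((LINT x|lebesgue. g x * ?f\<phi> x) + (LINT x|lebesgue. u x * ?d\<phi> x))" by simp
    also have "(LINT x|lebesgue. g x * ?f\<phi> x) + (LINT x|lebesgue. u x * ?d\<phi> x)
       = (LINT x|lebesgue. g x * ?f\<phi> x + u x * ?d\<phi> x)"
      by (rule Bochner_Integration.integral_add[symmetric, OF L1_loc_test_integrable[OF g t(1)] L1_loc_test_integrable[OF u t(2)]])
    finally show ?thesis by (simp add: algebra_simps)
  qed
  then show ?thesis unfolding has_weak_deriv_iff[OF S b']
    by (intro conjI ballI L1_loc_add L1_loc_mult_continuous[OF cont(1)] L1_loc_mult_continuous[OF cont(2)] u g)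
qed

lemma has_weak_deriv_Nil_trans:
  assumes S: "open S" and b: "b \<in> Basis"
    and 0: "has_weak_deriv S [] u u0" and 1: "has_weak_deriv S [b] u g"
  shows "has_weak_deriv S [b] u0 g"
  using 0 1 b S by (auto simp: has_weak_deriv_iff test_partial_deriv)

text \<open>Testing with \<open>\<partial>\<^sub>c \<phi>\<close> shows that a mixed second weak derivative is
  a weak derivative of the first one.\<close>

lemma has_weak_deriv_Cons_trans:
  assumes S: "open S" and bc: "b \<in> Basis" "c \<in> Basis"
    and 1: "has_weak_deriv S [b] u g" and 2: "has_weak_deriv S [b, c] u h"
  shows "has_weak_deriv S [c] g h"
proof -
  have "(LINT x|lebesgue. g x * partial_deriv c \<phi> x) = - (LINT x|lebesgue. h x * \<phi> x)"
    if "\<phi> \<in> test_functions S" for \<phi>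
  proof -
    have "(LINT x|lebesgue. u x * partial_deriv b (partial_deriv c \<phi>) x) = - (LINT x|lebesgue. g x * partial_deriv c \<phi> x)"
      using 1 S bc test_partial_deriv[OF that bc(2)] by (auto simp: has_weak_deriv_iff)
    moreover have "(LINT x|lebesgue. u x * partial_deriv b (partial_deriv c \<phi>) x) = (LINT x|lebesgue. h x * \<phi> x)"
      using 2 S bc that by (auto simp: has_weak_deriv_iff)
    ultimately show ?thesis by simp
  qed
  then show ?thesis using 1 2 S bc by (auto simp: has_weak_deriv_iff)
qed

lemma weak_deriv_works: "has_weak_deriv S bs u g \<Longrightarrow> has_weak_deriv S bs u (weak_deriv S bs u)"
  unfolding weak_deriv_def by (rule someI[of "has_weak_deriv S bs u"])

lemma has_weak_deriv_unique_test:
  assumes "open S" "set bs \<subseteq> Basis" "has_weak_deriv S bs u g" "has_weak_deriv S bs u h" "\<phi> \<in> test_functions S"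
  shows "(LINT x|lebesgue. g x * \<phi> x) = (LINT x|lebesgue. h x * \<phi> x)"
  using assms(3-5) unfolding has_weak_deriv_iff[OF assms(1,2)] by auto

section \<open>Antiderivatives and integration by parts\<close>

lemma sum_Basis_single:
  fixes f :: "'e::euclidean_space \<Rightarrow> real"
  assumes "c \<in> Basis" shows "(\<Sum>b\<in>Basis. (c \<bullet> b) * f b) = f c"
proof -
  have "(\<Sum>b\<in>Basis. (c \<bullet> b) * f b) = (\<Sum>b\<in>Basis. if b = c then f c else 0)"
    by (rule sum.cong) (use assms in \<open>auto simp: inner_Basis\<close>)
  then show ?thesis using assms by simp
qed

text \<open>An antiderivative in direction \<open>c\<close>, up to a translate:
  \<open>\<partial>\<^sub>c\<close> of it is \<open>\<phi>(x) - \<phi>(x - M c)\<close>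
  (\<open>partial_deriv_ray_integral\<close>), and the second term is harmless once \<open>M\<close> exceeds
  the diameter of the region considered. The finite length \<open>M\<close> permits differentiation under the
  integral without decay assumptions.\<close>

definition ray_integral :: "'e::euclidean_space \<Rightarrow> real \<Rightarrow> ('e \<Rightarrow> real) \<Rightarrow> 'e \<Rightarrow> real" where
  "ray_integral c M \<phi> x = integral (cbox 0 M) (\<lambda>s. \<phi> (x - s *\<^sub>R c))"

lemma ray_integral_has_derivative:
  fixes \<phi> :: "'e::euclidean_space \<Rightarrow> real"
  assumes \<phi>: "\<phi> \<in> Cinf_on UNIV"
  shows "ray_integral c M \<phi> differentiable (at x)"
    and "d \<in> Basis \<Longrightarrow> partial_deriv d (ray_integral c M \<phi>) x = ray_integral c M (partial_deriv d \<phi>) x"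
proof -
  define D :: "'e \<Rightarrow> real \<Rightarrow> 'e \<Rightarrow>\<^sub>L real" where
    "D x s = (\<Sum>b\<in>Basis. partial_deriv b \<phi> (x - s *\<^sub>R c) *\<^sub>R blinfun_inner_left b)" for x s
  have D_apply: "blinfun_apply (D x s) h = (\<Sum>b\<in>Basis. (h \<bullet> b) *\<^sub>R partial_deriv b \<phi> (x - s *\<^sub>R c))" for x s h
    by (simp add: D_def blinfun.sum_left blinfun.scaleR_left mult.commute)
  have der: "((\<lambda>x. \<phi> (x - s *\<^sub>R c)) has_derivative blinfun_apply (D x s)) (at x within UNIV)" for x s
  proof -
    have "((\<lambda>x. x - s *\<^sub>R c) has_derivative (\<lambda>h. h)) (at x)" by (auto intro!: derivative_eq_intros)
    from has_derivative_compose[OF this has_derivative_partial_derivs[OF Cinf_on_differentiable[OF open_UNIV \<phi>]]]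
    show ?thesis by (simp add: D_apply[abs_def])
  qed
  have c\<phi>: "continuous_on X \<phi>" for X
    using Cinf_on_imp_continuous_on[OF open_UNIV \<phi>] continuous_on_subset by blast
  have cd: "continuous_on X (partial_deriv b \<phi>)" if "b \<in> Basis" for X b
    using Cinf_on_imp_continuous_on[OF open_UNIV Cinf_on_partial_deriv[OF open_UNIV \<phi> that]] continuous_on_subset by blast
  have int: "(\<lambda>s. \<phi> (x - s *\<^sub>R c)) integrable_on cbox 0 M" for x
    by (intro integrable_continuous continuous_on_compose2[OF c\<phi>[of UNIV]] continuous_intros) auto
  have cD: "continuous_on (UNIV \<times> cbox 0 M) (\<lambda>(x, s). D x s)"
    unfolding D_def split_beta
    by (intro continuous_intros continuous_on_compose2[OF cd[of _ UNIV]]) auto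
  have L: "(ray_integral c M \<phi> has_derivative blinfun_apply (integral (cbox 0 M) (D x))) (at x)"
    using leibniz_rule[of UNIV 0 M "\<lambda>x s. \<phi> (x - s *\<^sub>R c)" D x, OF der int cD]
    by (simp add: ray_integral_def[abs_def])
  then show "ray_integral c M \<phi> differentiable (at x)" by (auto simp: differentiable_def)
  have cDx: "continuous_on (cbox 0 M) (D x)"
  proof -
    have "continuous_on (cbox 0 M) (\<lambda>s. (x, s))" by (intro continuous_on_Pair continuous_on_const continuous_on_id)
    then have "continuous_on (cbox 0 M) (\<lambda>s. case (x, s) of (x, s) \<Rightarrow> D x s)"
      by (rule continuous_on_compose2[OF cD]) auto
    then show ?thesis by simp
  qed
  show "partial_deriv d (ray_integral c M \<phi>) x = ray_integral c M (partial_deriv d \<phi>) x" if d: "d \<in> Basis"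
  proof -
    have "partial_deriv d (ray_integral c M \<phi>) x = blinfun_apply (integral (cbox 0 M) (D x)) d"
      by (rule partial_derivI[OF L])
    also have "\<dots> = integral (cbox 0 M) (\<lambda>s. blinfun_apply (D x s) d)"
      by (rule blinfun_apply_integral[OF integrable_continuous[OF cDx]])
    also have "(\<lambda>s. blinfun_apply (D x s) d) = (\<lambda>s. partial_deriv d \<phi> (x - s *\<^sub>R c))"
      using sum_Basis_single[OF d] by (simp add: D_apply)
    finally show ?thesis unfolding ray_integral_def[of c M "partial_deriv d \<phi>" x] .
  qed
qed

lemma Cinf_on_ray_integral:
  assumes "\<phi> \<in> Cinf_on UNIV" shows "ray_integral c M \<phi> \<in> Cinf_on UNIV"
proof (rule Cinf_on_coinduct[OF open_UNIV, of _ "ray_integral c M ` Cinf_on UNIV"])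
  fix g x assume "g \<in> ray_integral c M ` Cinf_on UNIV"
  then show "g differentiable (at x)" using ray_integral_has_derivative(1) by auto
next
  fix g b assume "g \<in> ray_integral c M ` Cinf_on UNIV" "b \<in> (Basis :: 'a set)"
  then show "\<exists>h\<in>ray_integral c M ` Cinf_on UNIV. \<forall>x\<in>UNIV. partial_deriv b g x = h x"
    using ray_integral_has_derivative(2) Cinf_on_partial_deriv[OF open_UNIV] by blast
qed (use assms in auto)

lemma partial_deriv_ray_integral:
  fixes \<phi> :: "'e::euclidean_space \<Rightarrow> real"
  assumes \<phi>: "\<phi> \<in> Cinf_on UNIV" and c: "c \<in> Basis" and M: "M \<ge> 0"
  shows "partial_deriv c (ray_integral c M \<phi>) x = \<phi> x - \<phi> (x - M *\<^sub>R c)"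
proof -
  have "((\<lambda>s. - \<phi> (x - s *\<^sub>R c)) has_vector_derivative partial_deriv c \<phi> (x - s *\<^sub>R c)) (at s within {0..M})" for s
  proof -
    have 1: "((\<lambda>s. x - s *\<^sub>R c) has_derivative (\<lambda>h. - (h *\<^sub>R c))) (at s within {0..M})"
      by (auto intro!: derivative_eq_intros)
    have 2: "(\<phi> has_derivative (\<lambda>h. \<Sum>b\<in>Basis. (h \<bullet> b) *\<^sub>R partial_deriv b \<phi> (x - s *\<^sub>R c))) (at (x - s *\<^sub>R c))"
      by (rule has_derivative_partial_derivs[OF Cinf_on_differentiable[OF open_UNIV \<phi>]]) simp
    have "(\<Sum>b\<in>Basis. ((- (h *\<^sub>R c)) \<bullet> b) *\<^sub>R partial_deriv b \<phi> (x - s *\<^sub>R c))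
        = - (h * partial_deriv c \<phi> (x - s *\<^sub>R c))" for h
    proof -
      have "(\<Sum>b\<in>Basis. ((- (h *\<^sub>R c)) \<bullet> b) *\<^sub>R partial_deriv b \<phi> (x - s *\<^sub>R c))
        = - h * (\<Sum>b\<in>Basis. (c \<bullet> b) * partial_deriv b \<phi> (x - s *\<^sub>R c))"
        by (simp add: sum_distrib_left sum_negf mult.assoc)
      then show ?thesis by (simp only: sum_Basis_single[OF c] mult_minus_left)
    qed
    then show ?thesis
      using has_derivative_minus[OF has_derivative_compose[OF 1 2]]
      by (simp add: has_vector_derivative_def)
  qed
  then have "((\<lambda>s. partial_deriv c \<phi> (x - s *\<^sub>R c)) has_integral (- \<phi> (x - M *\<^sub>R c)) - (- \<phi> (x - 0 *\<^sub>R c))) {0..M}"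
    using M by (intro fundamental_theorem_of_calculus) auto
  then show ?thesis
    by (simp add: ray_integral_has_derivative(2)[OF \<phi> c] ray_integral_def integral_unique)
qed

text \<open>The segment meets the slab in an interval of length at most \<open>2\<delta>\<close>. This bound
  is the source of the factor \<open>\<delta>\<close> in the slab estimate.\<close>

lemma ray_integral_bound:
  fixes \<phi> :: "'e::euclidean_space \<Rightarrow> real"
  assumes \<phi>: "\<phi> \<in> Cinf_on UNIV" and c: "c \<in> Basis" and \<delta>: "\<delta> > 0"
    and b: "\<And>x. \<bar>\<phi> x\<bar> \<le> 1" and slab: "\<And>x. \<bar>x \<bullet> c - s0\<bar> > \<delta> \<Longrightarrow> \<phi> x = 0"
  shows "\<bar>ray_integral c M \<phi> x\<bar> \<le> 2 * \<delta>"
proof -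
  define a where "a = x \<bullet> c - s0"
  define f where "f s = \<phi> (x - s *\<^sub>R c)" for s
  have z: "f s = 0" if "s \<notin> {a - \<delta>..a + \<delta>}" for s
    unfolding f_def using c that by (intro slab) (auto simp: a_def inner_diff_left abs_if)
  have cont: "continuous_on X f" for X
    unfolding f_def
    by (rule continuous_on_compose2[OF Cinf_on_imp_continuous_on[OF open_UNIV \<phi>]]) (auto intro!: continuous_intros)
  have "ray_integral c M \<phi> x = integral {0..M} (\<lambda>s. if s \<in> {a - \<delta>..a + \<delta>} then f s else 0)"
    unfolding ray_integral_def f_def[symmetric] box_real(2) by (intro integral_cong) (use z in auto)
  also have "\<dots> = integral ({0..M} \<inter> {a - \<delta>..a + \<delta>}) f"
    by (simp only: integral_restrict_Int Int_commute)
  also have "{0..M} \<inter> {a - \<delta>..a + \<delta>} = {max 0 (a - \<delta>)..min M (a + \<delta>)}" by auto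
  finally have eq: "ray_integral c M \<phi> x = integral {max 0 (a - \<delta>)..min M (a + \<delta>)} f" .
  show ?thesis
  proof (cases "max 0 (a - \<delta>) \<le> min M (a + \<delta>)")
    case True
    have "norm (integral {max 0 (a - \<delta>)..min M (a + \<delta>)} f) \<le> 1 * (min M (a + \<delta>) - max 0 (a - \<delta>))"
      using True cont b by (intro integral_bound) (auto simp: f_def)
    then show ?thesis unfolding eq using \<delta> by auto
  next
    case False then show ?thesis unfolding eq using \<delta> by simp
  qed
qed

lemma integrable_test: "\<phi> \<in> test_functions S \<Longrightarrow> integrable lebesgue \<phi>"
proof -
  assume \<phi>: "\<phi> \<in> test_functions S"
  obtain K where K: "compact K" "K \<subseteq> S" "\<And>x. x \<notin> K \<Longrightarrow> \<phi> x = 0" using testE[OF \<phi>] by metis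
  obtain C where C: "\<And>x. \<bar>\<phi> x\<bar> \<le> C" using test_bounded[OF \<phi>] by metis
  have "integrable lebesgue (\<lambda>x. indicator K x * \<phi> x)"
    by (rule integrable_mult_bounded[OF _ test_lebesgue[OF \<phi>] C])
      (use lmeasurable_compact[OF K(1)] in \<open>auto simp: fmeasurable_def intro!: integrable_real_indicator\<close>)
  also have "(\<lambda>x. indicator K x * \<phi> x) = \<phi>"
  proof
    show "indicator K x * \<phi> x = \<phi> x" for x by (cases "x \<in> K") (simp_all add: K(3))
  qed
  finally show ?thesis .
qed

lemma partial_deriv_line:
  fixes \<phi> :: "'e::euclidean_space \<Rightarrow> real"
  assumes "\<phi> \<in> Cinf_on UNIV" "b \<in> Basis"
  shows "((\<lambda>s. \<phi> (x + s *\<^sub>R b)) has_real_derivative partial_deriv b \<phi> (x + s *\<^sub>R b)) (at s)"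
proof -
  have 1: "((\<lambda>s. x + s *\<^sub>R b) has_derivative (\<lambda>h. h *\<^sub>R b)) (at s)"
    by (auto intro!: derivative_eq_intros)
  have 2: "(\<phi> has_derivative (\<lambda>h. \<Sum>d\<in>Basis. (h \<bullet> d) *\<^sub>R partial_deriv d \<phi> (x + s *\<^sub>R b))) (at (x + s *\<^sub>R b))"
    by (rule has_derivative_partial_derivs[OF Cinf_on_differentiable[OF open_UNIV assms(1)]]) simp
  have "(\<Sum>d\<in>Basis. ((h *\<^sub>R b) \<bullet> d) *\<^sub>R partial_deriv d \<phi> (x + s *\<^sub>R b)) = h * partial_deriv b \<phi> (x + s *\<^sub>R b)" for h
  proof -
    have "(\<Sum>d\<in>Basis. ((h *\<^sub>R b) \<bullet> d) *\<^sub>R partial_deriv d \<phi> (x + s *\<^sub>R b))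
        = h * (\<Sum>d\<in>Basis. (b \<bullet> d) * partial_deriv d \<phi> (x + s *\<^sub>R b))"
      by (simp add: sum_distrib_left mult.assoc)
    then show ?thesis by (simp only: sum_Basis_single[OF assms(2)])
  qed
  then have "((\<lambda>s. \<phi> (x + s *\<^sub>R b)) has_derivative (\<lambda>h. h * partial_deriv b \<phi> (x + s *\<^sub>R b))) (at s)"
    using has_derivative_compose[OF 1 2] by presburger
  then show ?thesis by (rule has_derivative_imp_has_field_derivative) simp
qed

text \<open>Difference quotients of \<open>\<phi>\<close> have integral zero by translation invariance, and
  they converge with a common bound and inside a common ball.\<close>

lemma integral_partial_deriv_test:
  fixes \<phi> :: "'e::euclidean_space \<Rightarrow> real"
  assumes \<phi>: "\<phi> \<in> test_functions S" and b: "b \<in> Basis"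
  shows "(LINT x|lebesgue. partial_deriv b \<phi> x) = 0"
proof -
  obtain K where K: "compact K" "K \<subseteq> S" "\<And>x. x \<notin> K \<Longrightarrow> \<phi> x = 0" using testE[OF \<phi>] by metis
  obtain R where R: "\<And>x. x \<in> K \<Longrightarrow> norm x \<le> R" using compact_imp_bounded[OF K(1)] by (auto simp: bounded_iff)
  note \<phi>' = test_partial_deriv[OF \<phi> b]
  obtain C where C: "C > 0" "\<And>x. \<bar>partial_deriv b \<phi> x\<bar> \<le> C" using test_bounded[OF \<phi>'] by metis
  have borel: "\<phi> \<in> borel_measurable borel" by (rule test_borel[OF \<phi>])
  have intl: "integrable lborel \<phi>"
    using integrable_test[OF \<phi>] integrable_completion[of \<phi> lborel] borel by simp
  define h where "h n = inverse (real (Suc n))" for n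
  have h: "h n > 0" "h n \<le> 1" for n by (auto simp: h_def field_simps)
  define D where "D n x = (\<phi> (x + h n *\<^sub>R b) - \<phi> x) / h n" for n x
  have shift: "integrable lborel (\<lambda>x. \<phi> (x + v))" "(LINT x|lborel. \<phi> (x + v)) = (LINT x|lborel. \<phi> x)" for v
    using integral_distr[of "(+) v" lborel borel \<phi>] integrable_distr_eq[of "(+) v" lborel borel \<phi>] borel intl
    by (simp_all add: lborel_distr_plus add.commute)
  have D0: "(LINT x|lborel. D n x) = 0" for n
    unfolding D_def using shift intl by simp
  have "(\<lambda>n. LINT x|lborel. D n x) \<longlonglongrightarrow> (LINT x|lborel. partial_deriv b \<phi> x)"
  proof (rule integral_dominated_convergence[where w = "\<lambda>x. C * indicator (cball 0 (R + 1)) x"])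
    show "partial_deriv b \<phi> \<in> borel_measurable lborel" using test_borel[OF \<phi>'] by simp
    show "D n \<in> borel_measurable lborel" for n
      unfolding D_def using borel by simp
    show "integrable lborel (\<lambda>x. C * indicator (cball 0 (R + 1)) x :: real)"
      by (intro integrable_mult_right integrable_real_indicator)
        (auto intro: emeasure_lborel_cball_finite[unfolded infinity_ennreal_def] emeasure_bounded_finite)
    show "AE x in lborel. (\<lambda>n. D n x) \<longlonglongrightarrow> partial_deriv b \<phi> x"
    proof (rule AE_I2)
      fix x
      have "((\<lambda>s. (\<phi> (x + s *\<^sub>R b) - \<phi> x) / s) \<longlongrightarrow> partial_deriv b \<phi> x) (at 0)"
        using partial_deriv_line[OF test_Cinf[OF \<phi>] b, of x 0] by (simp add: DERIV_def)
      moreover have "filterlim h (at 0) sequentially"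
        unfolding filterlim_at using LIMSEQ_inverse_real_of_nat h(1)
        by (auto simp: h_def[abs_def] intro!: always_eventually)
      ultimately show "(\<lambda>n. D n x) \<longlonglongrightarrow> partial_deriv b \<phi> x"
        unfolding D_def by (rule filterlim_compose)
    qed
    show "AE x in lborel. norm (D n x) \<le> C * indicator (cball 0 (R + 1)) x" for n
    proof (rule AE_I2)
      fix x
      show "norm (D n x) \<le> C * indicator (cball 0 (R + 1)) x"
      proof (cases "x \<in> cball 0 (R + 1)")
        case True
        obtain z where "\<phi> (x + h n *\<^sub>R b) - \<phi> (x + 0 *\<^sub>R b) = (h n - 0) * partial_deriv b \<phi> (x + z *\<^sub>R b)"
          using MVT2[of 0 "h n" "\<lambda>s. \<phi> (x + s *\<^sub>R b)" "\<lambda>s. partial_deriv b \<phi> (x + s *\<^sub>R b)"] h(1)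
            partial_deriv_line[OF test_Cinf[OF \<phi>] b] by auto
        then have "D n x = partial_deriv b \<phi> (x + z *\<^sub>R b)" using h(1)[of n] by (simp add: D_def)
        then show ?thesis using C(2) True by simp
      next
        case False
        then have "norm x > R + 1" by (simp add: dist_norm)
        moreover have "norm x \<le> norm (x + h n *\<^sub>R b) + h n"
          using norm_triangle_ineq4[of "x + h n *\<^sub>R b" "h n *\<^sub>R b"] b h(1)[of n] by simp
        ultimately have "x \<notin> K" "x + h n *\<^sub>R b \<notin> K" using R[of x] R[of "x + h n *\<^sub>R b"] h(2)[of n] by auto
        then show ?thesis using K(3) C(1) by (simp add: D_def)
      qed
    qed
  qed
  then have "(LINT x|lborel. partial_deriv b \<phi> x) = 0" unfolding D0 by (simp add: LIMSEQ_const_iff)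
  then show ?thesis using integral_completion[of "partial_deriv b \<phi>" lborel] test_borel[OF \<phi>'] by simp
qed

lemma integral_by_parts_test:
  assumes u: "u \<in> Cinf_on UNIV" and \<phi>: "\<phi> \<in> test_functions S" and b: "b \<in> Basis"
  shows "(LINT x|lebesgue. u x * partial_deriv b \<phi> x) = - (LINT x|lebesgue. partial_deriv b u x * \<phi> x)"
proof -
  have t: "(\<lambda>x. v x * \<psi> x) \<in> test_functions UNIV" if "v \<in> Cinf_on UNIV" "\<psi> \<in> test_functions S" for v \<psi>
    using test_mult[OF open_UNIV that(1)] test_mono[of S UNIV] that(2) by blast
  note t1 = t[OF u test_partial_deriv[OF \<phi> b]] and t2 = t[OF Cinf_on_partial_deriv[OF open_UNIV u b] \<phi>]
  have "0 = (LINT x|lebesgue. partial_deriv b (\<lambda>x. u x * \<phi> x) x)"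
    by (rule integral_partial_deriv_test[OF t[OF u \<phi>] b, symmetric])
  also have "partial_deriv b (\<lambda>x. u x * \<phi> x) = (\<lambda>x. partial_deriv b u x * \<phi> x + u x * partial_deriv b \<phi> x)"
    by (intro ext partial_deriv_mult Cinf_on_differentiable[OF open_UNIV] u test_Cinf[OF \<phi>]) auto
  also have "(LINT x|lebesgue. partial_deriv b u x * \<phi> x + u x * partial_deriv b \<phi> x)
     = (LINT x|lebesgue. partial_deriv b u x * \<phi> x) + (LINT x|lebesgue. u x * partial_deriv b \<phi> x)"
    by (rule Bochner_Integration.integral_add[OF integrable_test[OF t2] integrable_test[OF t1]])
  finally show ?thesis by simp
qed

text \<open>Derivatives move to \<open>u\<close> one at a time, which reverses their order.\<close>

lemma integral_by_parts_iter:
  assumes "u \<in> Cinf_on UNIV" and "\<phi> \<in> test_functions S" and "set bs \<subseteq> Basis"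
  shows "(LINT x|lebesgue. u x * iter_deriv bs \<phi> x) = (-1) ^ length bs * (LINT x|lebesgue. iter_deriv (rev bs) u x * \<phi> x)"
  using assms
proof (induction bs arbitrary: u)
  case (Cons b bs)
  then have b: "b \<in> Basis" "set bs \<subseteq> Basis" by auto
  have "(LINT x|lebesgue. u x * iter_deriv (b # bs) \<phi> x) = - (LINT x|lebesgue. partial_deriv b u x * iter_deriv bs \<phi> x)"
    using integral_by_parts_test[OF Cons.prems(1) test_iter_deriv[OF Cons.prems(2) b(2)] b(1)] by simp
  also have "\<dots> = - ((-1) ^ length bs * (LINT x|lebesgue. iter_deriv (rev bs) (partial_deriv b u) x * \<phi> x))"
    using Cons.IH[OF Cinf_on_partial_deriv[OF open_UNIV Cons.prems(1) b(1)] Cons.prems(2) b(2)] by simp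
  finally show ?case by (simp add: iter_deriv_append)
qed simp

section \<open>The fundamental lemma of the calculus of variations\<close>

text \<open>Cutoffs for shrinking neighbourhoods of \<open>E\<close> converge to the indicator at every point,
  not only almost everywhere, because \<open>E\<close> is closed. The common compact support \<open>K\<close>
  provides a dominating function.\<close>

lemma indicator_approx:
  fixes E U :: "'e::euclidean_space set"
  assumes E: "compact E" and U: "open U" "E \<subseteq> U"
  obtains \<phi> :: "nat \<Rightarrow> 'e \<Rightarrow> real" and K where
    "compact K" "K \<subseteq> U" "\<And>n x. x \<notin> K \<Longrightarrow> \<phi> n x = 0"
    "\<And>n. \<phi> n \<in> test_functions U" "\<And>n x. 0 \<le> \<phi> n x" "\<And>n x. \<phi> n x \<le> 1"
    "\<And>x. (\<lambda>n. \<phi> n x) \<longlonglongrightarrow> indicator E x"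
proof -
  obtain \<psi> V where \<psi>: "\<psi> \<in> test_functions U" "open V" "E \<subseteq> V" "\<And>x. x \<in> V \<Longrightarrow> \<psi> x = 1"
    using smooth_Urysohn[OF E U] by metis
  obtain K where K: "compact K" "K \<subseteq> U" "\<And>x. x \<notin> K \<Longrightarrow> \<psi> x = 0" using testE[OF \<psi>(1)] by metis
  define W where "W n = (\<Union>x\<in>E. ball x (inverse (real (Suc n)))) \<inter> V" for n
  have W: "open (W n)" "E \<subseteq> W n" for n
    using \<psi>(2,3) by (auto simp: W_def)
  have "\<exists>\<phi>. \<phi> \<in> test_functions (W n) \<and> (\<forall>x. 0 \<le> \<phi> x \<and> \<phi> x \<le> 1) \<and> (\<forall>x\<in>E. \<phi> x = 1)" for n
    using smooth_Urysohn[OF E W[of n]] by (metis subsetD)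
  then obtain \<phi> where \<phi>: "\<And>n. \<phi> n \<in> test_functions (W n)" "\<And>n x. 0 \<le> \<phi> n x" "\<And>n x. \<phi> n x \<le> 1"
    "\<And>n x. x \<in> E \<Longrightarrow> \<phi> n x = 1" by metis
  have VK: "V \<subseteq> K" using \<psi>(4) K(3) by force
  show thesis
  proof (rule that[OF K(1,2), of \<phi>])
    show "\<phi> n x = 0" if "x \<notin> K" for n x
      using that VK by (intro test_outside[OF \<phi>(1)]) (auto simp: W_def)
    show "\<phi> n \<in> test_functions U" for n
      using VK K(2) by (intro test_mono[OF _ \<phi>(1)]) (auto simp: W_def)
    show "(\<lambda>n. \<phi> n x) \<longlonglongrightarrow> indicator E x" for x
    proof (cases "x \<in> E")
      case True then show ?thesis by (simp add: \<phi>(4))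
    next
      case False
      obtain r where r: "r > 0" "ball x r \<inter> E = {}"
        using compact_imp_closed[OF E] False open_contains_ball[of "- E"] by (force simp: open_Compl)
      obtain N where N: "inverse (real (Suc N)) < r" using reals_Archimedean[OF r(1)] by auto
      have "\<phi> n x = 0" if "n \<ge> N" for n
      proof (rule test_outside[OF \<phi>(1)])
        have le: "inverse (real (Suc n)) \<le> inverse (real (Suc N))" using that by (intro le_imp_inverse_le) auto
        have "x \<notin> ball y (inverse (real (Suc n)))" if "y \<in> E" for y
        proof -
          have "r \<le> dist x y" using r(2) that by (meson disjoint_iff mem_ball not_le)
          then have "inverse (real (Suc n)) < dist y x" using N le unfolding dist_commute[of y x] by linarith
          then show ?thesis by simp
        qed
        then show "x \<notin> W n" by (auto simp: W_def)
      qed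
      then have "eventually (\<lambda>n. \<phi> n x = 0) sequentially" by (auto simp: eventually_sequentially)
      then show ?thesis using False by (simp add: tendsto_eventually)
    qed
  qed (use \<phi> in auto)
qed

lemma nonnegligible_contains_compact:
  fixes X :: "'e::euclidean_space set"
  assumes X: "X \<in> sets lebesgue" and n: "\<not> negligible X"
  obtains K where "compact K" "K \<subseteq> X" "\<not> negligible K"
proof -
  obtain C N where C: "fsigma C" and N: "N \<in> null_sets lebesgue" and CN: "C \<union> N = X"
    using lebesgue_set_almost_fsigma[OF X] .
  obtain F :: "nat \<Rightarrow> 'e set" where F: "range F \<subseteq> Collect compact" "C = \<Union> (range F)"
    using C fsigma_Union_compact by metis
  have "\<exists>i. \<not> negligible (F i)"
  proof (rule ccontr)
    assume "\<not> (\<exists>i. \<not> negligible (F i))"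
    then have "negligible C" unfolding F(2) by (intro negligible_Union_nat) auto
    then have "negligible X" using N CN negligible_Un negligible_iff_null_sets by blast
    then show False using n by blast
  qed
  then obtain i where i: "\<not> negligible (F i)" by blast
  have "compact (F i)" "F i \<subseteq> X" using F CN by auto
  then show thesis using that i by blast
qed

text \<open>If \<open>h\<close> were positive on a set of positive measure, it would be positive on a compact
  set \<open>K\<close> of positive measure; approximation of the indicator of \<open>K\<close> gives
  \<open>h\<close> a zero integral over \<open>K\<close>.\<close>

lemma negligible_pos_part_if_test_zero:
  fixes h :: "'e::euclidean_space \<Rightarrow> real"
  assumes S: "open S" and h: "h \<in> L1_loc S" and L: "compact L" "L \<subseteq> S"
    and z: "\<And>\<phi>. \<phi> \<in> test_functions S \<Longrightarrow> (LINT x|lebesgue. h x * \<phi> x) = 0"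
  shows "negligible {x \<in> L. h x > 0}"
proof (rule ccontr)
  assume n: "\<not> negligible {x \<in> L. h x > 0}"
  have "(\<lambda>x. indicator L x * h x) \<in> borel_measurable lebesgue"
    using L1_loc_integrable[OF h L] by blast
  then have "{x \<in> space lebesgue. 0 < indicator L x * h x} \<in> sets lebesgue" by measurable
  moreover have "{x \<in> space lebesgue. 0 < indicator L x * h x} = {x \<in> L. h x > 0}"
    by (auto simp: indicator_def split: if_splits)
  ultimately have "{x \<in> L. h x > 0} \<in> sets lebesgue" by simp
  then obtain K where K: "compact K" "K \<subseteq> {x \<in> L. h x > 0}" "\<not> negligible K"
    using nonnegligible_contains_compact n by blast
  have KS: "K \<subseteq> S" using K L by auto
  obtain \<phi> :: "nat \<Rightarrow> 'e \<Rightarrow> real" and M where \<phi>: "compact M" "M \<subseteq> S" "\<And>n x. x \<notin> M \<Longrightarrow> \<phi> n x = 0"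
    "\<And>n. \<phi> n \<in> test_functions S" "\<And>n x. 0 \<le> \<phi> n x" "\<And>n x. \<phi> n x \<le> 1"
    "\<And>x. (\<lambda>n. \<phi> n x) \<longlonglongrightarrow> indicator K x"
    using indicator_approx[OF K(1) S KS] by metis
  have int: "integrable lebesgue (\<lambda>x. indicator K x * h x)"
    by (rule L1_loc_integrable[OF h K(1) KS])
  have "(\<lambda>n. LINT x|lebesgue. h x * \<phi> n x) \<longlonglongrightarrow> (LINT x|lebesgue. indicator K x * h x)"
  proof (rule integral_dominated_convergence[where w = "\<lambda>x. \<bar>indicator M x * h x\<bar>"])
    show "(\<lambda>x. indicator K x * h x) \<in> borel_measurable lebesgue" using int by blast
    show "(\<lambda>x. h x * \<phi> n x) \<in> borel_measurable lebesgue" for n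
      using L1_loc_test_integrable[OF h \<phi>(4)] by blast
    show "integrable lebesgue (\<lambda>x. \<bar>indicator M x * h x\<bar>)"
      by (intro integrable_abs L1_loc_integrable[OF h \<phi>(1,2)])
    show "AE x in lebesgue. (\<lambda>n. h x * \<phi> n x) \<longlonglongrightarrow> indicator K x * h x"
      using tendsto_mult[OF tendsto_const \<phi>(7)] by (auto simp: mult.commute)
    show "AE x in lebesgue. norm (h x * \<phi> n x) \<le> \<bar>indicator M x * h x\<bar>" for n
    proof (rule AE_I2)
      fix x show "norm (h x * \<phi> n x) \<le> \<bar>indicator M x * h x\<bar>"
        using \<phi>(3)[of x n] \<phi>(5,6)[of n x] mult_left_le[of "\<phi> n x" "\<bar>h x\<bar>"]
        by (cases "x \<in> M") (auto simp: abs_mult)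
    qed
  qed
  then have "(LINT x|lebesgue. indicator K x * h x) = 0"
    unfolding z[OF \<phi>(4)] by (simp add: LIMSEQ_const_iff)
  moreover have "AE x in lebesgue. 0 \<le> indicator K x * h x"
    using K(2) by (intro AE_I2) (auto simp: indicator_def)
  ultimately have "AE x in lebesgue. indicator K x * h x = 0"
    using integral_nonneg_eq_0_iff_AE[OF int] by simp
  then have "AE x in lebesgue. x \<notin> K"
    by (rule AE_mp) (use K(2) in \<open>auto intro!: AE_I2 simp: indicator_def\<close>)
  moreover have "K \<in> sets lebesgue" using lmeasurable_compact[OF K(1)] by (simp add: fmeasurableD)
  ultimately have "K \<in> null_sets lebesgue" by (simp add: AE_iff_null_sets)
  then show False using K(3) negligible_iff_null_sets by blast
qed

lemma negligible_if_test_zero: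
  fixes h :: "'e::euclidean_space \<Rightarrow> real"
  assumes S: "open S" and h: "h \<in> L1_loc S"
    and z: "\<And>\<phi>. \<phi> \<in> test_functions S \<Longrightarrow> (LINT x|lebesgue. h x * \<phi> x) = 0"
  shows "negligible {x \<in> S. h x \<noteq> 0}"
proof -
  obtain F :: "nat \<Rightarrow> 'e set" where F: "\<And>n. compact (F n)" "S = \<Union> (range F)"
    using open_Union_compact_subsets[OF S] by metis
  have "negligible {x \<in> F i. h x \<noteq> 0}" for i
  proof -
    have L: "compact (F i)" "F i \<subseteq> S" using F by auto
    have h': "(\<lambda>x. - h x) \<in> L1_loc S" using L1_loc_mult_continuous[OF continuous_on_const h, of "-1"] by simp
    have "negligible ({x \<in> F i. h x > 0} \<union> {x \<in> F i. - h x > 0})"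
      by (intro negligible_Un negligible_pos_part_if_test_zero[OF S h L z] negligible_pos_part_if_test_zero[OF S h' L]) (simp_all add: z)
    then show ?thesis by (rule negligible_subset) auto
  qed
  then have "negligible (\<Union>i. {x \<in> F i. h x \<noteq> 0})" by (intro negligible_Union_nat) auto
  then show ?thesis by (rule negligible_subset) (use F in auto)
qed

section \<open>Separation of space and time\<close>

text \<open>Completion destroys measurability of sections, so the integrand is replaced by a Borel function
  equal to it almost everywhere; almost every section is then unaffected.\<close>

lemma lebesgue_Fubini_snd:
  fixes u :: "'a::euclidean_space \<times> real \<Rightarrow> real"
  assumes u: "integrable lebesgue u"
  shows "(LINT p|lebesgue. u p) = (LINT t|lebesgue. LINT x|lebesgue. u (x, t))"
proof -
  obtain u' where u': "u' \<in> borel_measurable lborel" and eq: "AE p in lborel. u p = u' p"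
    using completion_ex_borel_measurable_real[of u lborel] borel_measurable_integrable[OF u] by auto
  have u'b: "u' \<in> borel_measurable borel" using u' by simp
  have eqL: "AE p in lebesgue. u p = u' p" using eq by (rule AE_completion)
  have intL: "integrable lebesgue u'"
    using u by (rule integrable_cong_AE_imp) (use eqL measurable_completion[OF u'] in auto)
  then have int: "integrable (lborel \<Otimes>\<^sub>M lborel) (case_prod (\<lambda>x t. u' (x, t)))"
    using integrable_completion[OF u'] by (simp add: lborel_prod)
  obtain N where N: "{p \<in> space lborel. \<not> u p = u' p} \<subseteq> N" "N \<in> null_sets lborel"
    using eq by (auto simp: eventually_ae_filter)
  have "AE p in lborel. p \<notin> N" using N(2) by (rule AE_not_in)
  then have "AE x in lborel. AE t in lborel. (x, t) \<notin> N"
    unfolding lborel_prod[symmetric] by (rule lborel_pair.AE_pair)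
  moreover have "{p \<in> space (lborel \<Otimes>\<^sub>M lborel). (fst p, snd p) \<notin> N} \<in> sets (lborel \<Otimes>\<^sub>M lborel)"
    unfolding lborel_prod using null_setsD2[OF N(2)] by (simp add: Compl_eq[symmetric] borel_comp)
  ultimately have ae: "AE t in lborel. AE x in lborel. (x, t) \<notin> N"
    using lborel_pair.AE_commute[of "\<lambda>x t. (x, t) \<notin> N"] by simp
  have sect: "(\<lambda>x. u' (x, t)) \<in> borel_measurable borel" for t
    by (rule measurable_compose[OF _ u'b]) simp
  have inner: "(LINT x|lebesgue. u (x, t)) = (LINT x|lborel. u' (x, t))" if "AE x in lborel. (x, t) \<notin> N" for t
  proof -
    have "AE x in lborel. u' (x, t) = u (x, t)"
    proof (rule AE_mp[OF that], intro AE_I2 impI)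
      fix x assume "(x, t) \<notin> N"
      then have "(x, t) \<notin> {p \<in> space lborel. \<not> u p = u' p}" using N(1) by blast
      then show "u' (x, t) = u (x, t)" by simp
    qed
    then have a: "AE x in lebesgue. u' (x, t) = u (x, t)" by (rule AE_completion)
    have m: "(\<lambda>x. u' (x, t)) \<in> borel_measurable lebesgue"
      using sect by (intro measurable_completion) simp
    have "(LINT x|lebesgue. u' (x, t)) = (LINT x|lebesgue. u (x, t))"
      by (rule integral_cong_AE[OF m borel_measurable_AE[OF m a] a])
    then show ?thesis using integral_completion[of "\<lambda>x. u' (x, t)" lborel] sect by simp
  qed
  have aeq: "AE t in lebesgue. (LINT x|lborel. u' (x, t)) = (LINT x|lebesgue. u (x, t))"
    by (rule AE_completion, rule AE_mp[OF ae]) (auto intro!: AE_I2 simp: inner)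
  have mt: "(\<lambda>t. LINT x|lborel. u' (x, t)) \<in> borel_measurable lborel"
    using lborel_pair.integrable_snd[OF int] by blast
  have mtL: "(\<lambda>t. LINT x|lborel. u' (x, t)) \<in> borel_measurable lebesgue"
    using mt by (rule measurable_completion)
  have "(LINT p|lebesgue. u p) = (LINT p|lebesgue. u' p)"
    by (rule integral_cong_AE) (use u eqL measurable_completion[OF u'] in auto)
  also have "\<dots> = (LINT p|lborel. u' p)" by (rule integral_completion[OF u'])
  also have "\<dots> = (LINT t|lborel. LINT x|lborel. u' (x, t))"
    using lborel_pair.integral_snd[OF int] by (simp add: lborel_prod case_prod_beta)
  also have "\<dots> = (LINT t|lebesgue. LINT x|lborel. u' (x, t))"
    by (rule integral_completion[OF mt, symmetric])
  also have "\<dots> = (LINT t|lebesgue. LINT x|lebesgue. u (x, t))"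
    by (rule integral_cong_AE[OF mtL borel_measurable_AE[OF mtL aeq] aeq])
  finally show ?thesis .
qed

lemma Basis_time [simp]: "dir_t \<in> Basis"
  and Basis_space [simp]: "b \<in> Basis \<Longrightarrow> dir_x b \<in> Basis"
  by (auto simp: Basis_prod_def)

lemma
  fixes \<phi> :: "'a::euclidean_space \<Rightarrow> real"
  assumes \<phi>: "\<phi> \<in> Cinf_on UNIV"
  shows Cinf_on_fst: "(\<lambda>p :: 'a \<times> real. \<phi> (fst p)) \<in> Cinf_on UNIV"
    and partial_deriv_fst: "partial_deriv (h, s) (\<lambda>p :: 'a \<times> real. \<phi> (fst p)) p = (\<Sum>d\<in>Basis. (h \<bullet> d) * partial_deriv d \<phi> (fst p))"
proof -
  have L: "(fst has_derivative fst) (at p)" for p :: "'a \<times> real"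
    by (intro bounded_linear_imp_has_derivative bounded_linear_fst)
  show "(\<lambda>p :: 'a \<times> real. \<phi> (fst p)) \<in> Cinf_on UNIV"
    by (rule Cinf_on_compose_affine[OF \<phi> open_UNIV open_UNIV L]) simp
  show "partial_deriv (h, s) (\<lambda>p :: 'a \<times> real. \<phi> (fst p)) p = (\<Sum>d\<in>Basis. (h \<bullet> d) * partial_deriv d \<phi> (fst p))"
    using partial_deriv_compose_affine[OF Cinf_on_differentiable[OF open_UNIV \<phi>] L, of p "(h, s)"] by simp
qed

lemma
  fixes \<eta> :: "real \<Rightarrow> real"
  assumes \<eta>: "\<eta> \<in> Cinf_on UNIV"
  shows Cinf_on_snd: "(\<lambda>p :: 'a::euclidean_space \<times> real. \<eta> (snd p)) \<in> Cinf_on UNIV"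
    and partial_deriv_snd: "partial_deriv (h, s) (\<lambda>p :: 'a \<times> real. \<eta> (snd p)) p = s * partial_deriv 1 \<eta> (snd p)"
proof -
  have L: "(snd has_derivative snd) (at p)" for p :: "'a \<times> real"
    by (intro bounded_linear_imp_has_derivative bounded_linear_snd)
  show "(\<lambda>p :: 'a \<times> real. \<eta> (snd p)) \<in> Cinf_on UNIV"
    by (rule Cinf_on_compose_affine[OF \<eta> open_UNIV open_UNIV L]) simp
  show "partial_deriv (h, s) (\<lambda>p :: 'a \<times> real. \<eta> (snd p)) p = s * partial_deriv 1 \<eta> (snd p)"
    using partial_deriv_compose_affine[OF Cinf_on_differentiable[OF open_UNIV \<eta>] L, of p "(h, s)"] by simp
qed

definition tensor :: "('a::euclidean_space \<Rightarrow> real) \<Rightarrow> (real \<Rightarrow> real) \<Rightarrow> 'a \<times> real \<Rightarrow> real" (infixl "\<otimes>" 75) where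
  "(\<phi> \<otimes> \<eta>) p = \<phi> (fst p) * \<eta> (snd p)"

lemma tensor_test:
  assumes \<phi>: "\<phi> \<in> test_functions S" and \<eta>: "\<eta> \<in> test_functions {0<..<T}"
  shows "\<phi> \<otimes> \<eta> \<in> test_functions (cylinder S T)"
proof -
  obtain K where K: "compact K" "K \<subseteq> S" "\<And>x. x \<notin> K \<Longrightarrow> \<phi> x = 0" using testE[OF \<phi>] by metis
  obtain L where L: "compact L" "L \<subseteq> {0<..<T}" "\<And>x. x \<notin> L \<Longrightarrow> \<eta> x = 0" using testE[OF \<eta>] by metis
  show ?thesis
  proof (rule testI[of _ "K \<times> L"])
    show "\<phi> \<otimes> \<eta> \<in> Cinf_on UNIV" unfolding tensor_def[abs_def]
      by (rule Cinf_on_mult[OF open_UNIV Cinf_on_fst[OF test_Cinf[OF \<phi>]] Cinf_on_snd[OF test_Cinf[OF \<eta>]]])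
    show "(\<phi> \<otimes> \<eta>) p = 0" if "p \<notin> K \<times> L" for p
      using that K(3) L(3) by (cases p) (auto simp: tensor_def)
  qed (use K L in \<open>auto intro: compact_Times\<close>)
qed

lemma
  assumes \<phi>: "\<phi> \<in> Cinf_on UNIV" and \<eta>: "\<eta> \<in> Cinf_on UNIV"
  shows partial_deriv_t_tensor: "partial_deriv dir_t (\<phi> \<otimes> \<eta>) = \<phi> \<otimes> partial_deriv 1 \<eta>"
    and partial_deriv_x_tensor: "b \<in> Basis \<Longrightarrow> partial_deriv (dir_x b) (\<phi> \<otimes> \<eta>) = partial_deriv b \<phi> \<otimes> \<eta>"
proof -
  have *: "partial_deriv (h, s) (\<phi> \<otimes> \<eta>) p = (\<Sum>d\<in>Basis. (h \<bullet> d) * partial_deriv d \<phi> (fst p)) * \<eta> (snd p)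
      + \<phi> (fst p) * (s * partial_deriv 1 \<eta> (snd p))" for h s p
    unfolding tensor_def[abs_def]
    by (subst partial_deriv_mult)
      (auto intro!: Cinf_on_differentiable[OF open_UNIV] Cinf_on_fst \<phi> Cinf_on_snd \<eta> simp: partial_deriv_fst[OF \<phi>] partial_deriv_snd[OF \<eta>])
  show "partial_deriv dir_t (\<phi> \<otimes> \<eta>) = \<phi> \<otimes> partial_deriv 1 \<eta>"
    by (rule ext) (simp add: * tensor_def)
  show "partial_deriv (dir_x b) (\<phi> \<otimes> \<eta>) = partial_deriv b \<phi> \<otimes> \<eta>" if "b \<in> Basis"
    by (rule ext) (simp add: * tensor_def sum_Basis_single[OF that])
qed

text \<open>The derivatives of the cutoffs are two bumps of mass one and minus one that concentrate at the end
  points, so pairing with them recovers the difference of the end values of a continuous function.\<close>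

lemma time_cutoffs:
  fixes T :: real assumes T: "T > 0"
  obtains \<eta> :: "nat \<Rightarrow> real \<Rightarrow> real" where
    "\<And>n. \<eta> n \<in> test_functions {0<..<T}" "\<And>n t. 0 \<le> \<eta> n t" "\<And>n t. \<eta> n t \<le> 1"
    "\<And>t. t \<in> {0<..<T} \<Longrightarrow> (\<lambda>n. \<eta> n t) \<longlonglongrightarrow> 1"
    "\<And>p. continuous_on {0..T} p \<Longrightarrow>
       (\<lambda>n. LINT t|lebesgue. p t * partial_deriv 1 (\<eta> n) t) \<longlonglongrightarrow> p 0 - p T"
proof -
  define st where "st s = smooth_step (s - 1)" for s
  define \<sigma> where "\<sigma> = partial_deriv 1 st"
  have st: "st \<in> Cinf_on UNIV" unfolding st_def[abs_def]
    using Cinf_on_diff[OF open_UNIV Cinf_on_inner_left[OF open_UNIV, of "1::real"] Cinf_on_const[OF open_UNIV, of 1]]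
    by (intro Cinf_on_compose[OF open_UNIV open_UNIV Cinf_on_smooth_step]) auto
  have st01: "0 \<le> st s" "st s \<le> 1" for s by (auto simp: st_def smooth_step_bounds)
  have st_eq: "s \<le> 1 \<Longrightarrow> st s = 0" "s \<ge> 2 \<Longrightarrow> st s = 1" for s
    by (auto simp: st_def smooth_step_eq)
  have st': "(st has_real_derivative \<sigma> s) (at s)" for s
    using partial_deriv_line[OF st, of 1 0 s] by (simp add: \<sigma>_def)
  have \<sigma>C: "\<sigma> \<in> Cinf_on UNIV" unfolding \<sigma>_def using Cinf_on_partial_deriv[OF open_UNIV st] by simp
  have \<sigma>0: "\<sigma> s = 0" if "s \<notin> {1..2}" for s
  proof (cases "s < 1")
    case True
    then show ?thesis using partial_deriv_cong[of "{..<1}" s st "\<lambda>_. 0" 1] st_eq(1)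
      by (simp add: \<sigma>_def partial_deriv_const)
  next
    case False
    then show ?thesis using that partial_deriv_cong[of "{2<..}" s st "\<lambda>_. 1" 1] st_eq(2)
      by (simp add: \<sigma>_def partial_deriv_const)
  qed
  have \<sigma>test: "\<sigma> \<in> test_functions UNIV" by (rule testI[OF \<sigma>C, of "{1..2}"]) (auto simp: \<sigma>0)
  have \<sigma>1: "(LINT s|lebesgue. \<sigma> s) = 1"
  proof -
    have "(LINT s|lebesgue. \<sigma> s) = integral UNIV \<sigma>"
      by (rule integral_lebesgue[symmetric, OF integrable_test[OF \<sigma>test]])
    also have "\<dots> = integral {1..2} \<sigma>"
      by (rule integral_spike_set[OF empty_imp_negligible negligible_subset[of "{}"]]) (use \<sigma>0 in auto)
    also have "\<dots> = st 2 - st 1"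
      by (intro integral_unique fundamental_theorem_of_calculus)
        (auto intro!: has_real_derivative_iff_has_vector_derivative[THEN iffD1] DERIV_subset[OF st'])
    finally show ?thesis by (simp add: st_eq)
  qed
  \<comment> \<open>With \<open>m T \<ge> 4\<close> the two transition zones \<open>[1/m, 2/m]\<close> and \<open>[T - 2/m, T - 1/m]\<close> lie in different halves of the time interval.\<close>
  obtain N0 :: nat where N0: "4 / T \<le> real N0" using real_arch_simple by blast
  define m where "m n = real (n + N0 + 1)" for n
  have m: "m n > 0" "m n * T \<ge> 4" for n
  proof -
    show "m n > 0" by (simp add: m_def)
    have "4 / T \<le> m n" using N0 by (simp add: m_def)
    then show "m n * T \<ge> 4" using T by (simp add: field_simps)
  qed
  define \<eta> where "\<eta> n t = st (m n * t) * st (m n * (T - t))" for n t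
  have lin: "(\<lambda>t::real. a * t + b) \<in> Cinf_on UNIV" for a b
    using Cinf_on_add[OF open_UNIV Cinf_on_mult[OF open_UNIV Cinf_on_const[OF open_UNIV, of a] Cinf_on_inner_left[OF open_UNIV, of "1::real"]]
      Cinf_on_const[OF open_UNIV, of b]] by simp
  have stlin: "(\<lambda>t. st (a * t + b)) \<in> Cinf_on UNIV" for a b
    by (rule Cinf_on_compose[OF open_UNIV open_UNIV st lin]) auto
  have \<eta>C: "\<eta> n \<in> Cinf_on UNIV" for n
    using Cinf_on_mult[OF open_UNIV stlin[of "m n" 0] stlin[of "- m n" "m n * T"]]
    by (simp add: \<eta>_def[abs_def] algebra_simps)
  have \<eta>': "partial_deriv 1 (\<eta> n) t = m n * \<sigma> (m n * t) - m n * \<sigma> (m n * (T - t))" for n t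
  proof -
    have "(\<eta> n has_real_derivative \<sigma> (m n * t) * m n * st (m n * (T - t)) + st (m n * t) * (\<sigma> (m n * (T - t)) * (- m n))) (at t)"
      unfolding \<eta>_def[abs_def]
      by (auto intro!: derivative_eq_intros DERIV_chain2[OF st'] simp: algebra_simps)
    then have "partial_deriv 1 (\<eta> n) t = m n * (\<sigma> (m n * t) * st (m n * (T - t))) - m n * (st (m n * t) * \<sigma> (m n * (T - t)))"
      by (subst partial_deriv_real) (auto simp: algebra_simps)
    moreover have "\<sigma> (m n * t) * st (m n * (T - t)) = \<sigma> (m n * t)"
      using \<sigma>0[of "m n * t"] st_eq(2)[of "m n * (T - t)"] m[of n] by (cases "m n * t \<le> 2") (auto simp: algebra_simps)
    moreover have "st (m n * t) * \<sigma> (m n * (T - t)) = \<sigma> (m n * (T - t))"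
      using \<sigma>0[of "m n * (T - t)"] st_eq(2)[of "m n * t"] m[of n] by (cases "m n * (T - t) \<le> 2") (auto simp: algebra_simps)
    ultimately show ?thesis by simp
  qed
  have inv_m: "(\<lambda>n. inverse (m n)) \<longlonglongrightarrow> 0"
    using LIMSEQ_ignore_initial_segment[OF LIMSEQ_inverse_real_of_nat, of N0] by (simp add: m_def)
  have \<eta>t: "\<eta> n \<in> test_functions {0<..<T}" for n
    proof (rule testI[OF \<eta>C, of "{inverse (m n)..T - inverse (m n)}"])
      show "{inverse (m n)..T - inverse (m n)} \<subseteq> {0<..<T}" using m(1)[of n] by (auto simp: less_le_trans dest: order_trans) (smt (verit) positive_imp_inverse_positive)+
      show "\<eta> n t = 0" if "t \<notin> {inverse (m n)..T - inverse (m n)}" for t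
        using that m(1)[of n] st_eq(1)[of "m n * t"] st_eq(1)[of "m n * (T - t)"]
        by (auto simp: \<eta>_def field_simps not_le)
    qed auto
  show thesis
  proof (rule that[of \<eta>])
    show "\<eta> n \<in> test_functions {0<..<T}" for n by (rule \<eta>t)
    show "0 \<le> \<eta> n t" "\<eta> n t \<le> 1" for n t
      using st01 by (auto simp: \<eta>_def intro!: mult_le_one)
    show "(\<lambda>n. \<eta> n t) \<longlonglongrightarrow> 1" if t: "t \<in> {0<..<T}" for t
    proof -
      have "eventually (\<lambda>n. inverse (m n) < t / 2 \<and> inverse (m n) < (T - t) / 2) sequentially"
        using t by (intro eventually_conj order_tendstoD(2)[OF inv_m]) auto
      then have "eventually (\<lambda>n. \<eta> n t = 1) sequentially"
      proof eventually_elim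
        case (elim n)
        then show ?case using m(1)[of n] st_eq(2)[of "m n * t"] st_eq(2)[of "m n * (T - t)"]
          by (auto simp: \<eta>_def field_simps)
      qed
      then show ?thesis by (rule tendsto_eventually)
    qed
    fix p :: "real \<Rightarrow> real" assume p: "continuous_on {0..T} p"
    \<comment> \<open>A continuous extension of \<open>p\<close> to the real line makes all integrands Borel measurable.\<close>
    define q where "q t = p (max 0 (min T t))" for t
    have q: "continuous_on UNIV q" unfolding q_def[abs_def]
      by (rule continuous_on_compose2[OF p]) (use T in \<open>auto intro!: continuous_intros\<close>)
    have qb: "q \<in> borel_measurable borel" by (rule borel_measurable_continuous_onI[OF q])
    have "bounded (p ` {0..T})" by (intro compact_imp_bounded compact_continuous_image p) auto
    then obtain C where C: "\<And>t. t \<in> {0..T} \<Longrightarrow> \<bar>p t\<bar> \<le> C" unfolding bounded_iff by force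
    have qC: "\<bar>q t\<bar> \<le> C" for t unfolding q_def by (rule C) (use T in auto)
    have \<sigma>b: "\<sigma> \<in> borel_measurable borel" by (rule test_borel[OF \<sigma>test])
    have \<sigma>int: "integrable lborel \<sigma>"
      using integrable_test[OF \<sigma>test] integrable_completion[of \<sigma> lborel] \<sigma>b by simp
    have \<sigma>1': "(LINT s|lborel. \<sigma> s) = 1"
      using \<sigma>1 integral_completion[of \<sigma> lborel] \<sigma>b by simp
    have lim: "(\<lambda>n. LINT s|lborel. q (a + inverse (m n) * e * s) * \<sigma> s) \<longlonglongrightarrow> q a" for a e
    proof -
      have "(\<lambda>n. LINT s|lborel. q (a + inverse (m n) * e * s) * \<sigma> s) \<longlonglongrightarrow> (LINT s|lborel. q a * \<sigma> s)"
      proof (rule integral_dominated_convergence[where w = "\<lambda>s. C * \<bar>\<sigma> s\<bar>"])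
        show "(\<lambda>s. q a * \<sigma> s) \<in> borel_measurable lborel" using \<sigma>b by simp
        show "(\<lambda>s. q (a + inverse (m n) * e * s) * \<sigma> s) \<in> borel_measurable lborel" for n
          using \<sigma>b qb by simp
        show "integrable lborel (\<lambda>s. C * \<bar>\<sigma> s\<bar>)" using \<sigma>int by simp
        show "AE s in lborel. norm (q (a + inverse (m n) * e * s) * \<sigma> s) \<le> C * \<bar>\<sigma> s\<bar>" for n
          using qC by (auto simp: abs_mult intro!: mult_right_mono)
        show "AE s in lborel. (\<lambda>n. q (a + inverse (m n) * e * s) * \<sigma> s) \<longlonglongrightarrow> q a * \<sigma> s"
        proof (rule AE_I2)
          fix s
          have "(\<lambda>n. a + inverse (m n) * e * s) \<longlonglongrightarrow> a + 0 * e * s"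
            by (intro tendsto_intros inv_m)
          then have "(\<lambda>n. q (a + inverse (m n) * e * s)) \<longlonglongrightarrow> q a"
            using isCont_tendsto_compose[of a q] q by (simp add: continuous_on_eq_continuous_at)
          then show "(\<lambda>n. q (a + inverse (m n) * e * s) * \<sigma> s) \<longlonglongrightarrow> q a * \<sigma> s" by (intro tendsto_intros)
        qed
      qed
      then show ?thesis using \<sigma>1' by simp
    qed
    have sub: "(LINT t|lborel. q t * (m n * \<sigma> (m n * t))) = (LINT s|lborel. q (0 + inverse (m n) * 1 * s) * \<sigma> s)" for n
      using m(1)[of n] lborel_integral_real_affine[of "inverse (m n)" "\<lambda>t. q t * (m n * \<sigma> (m n * t))" 0]
      by (simp add: field_simps flip: Bochner_Integration.integral_mult_right_zero)
    have sub2: "(LINT t|lborel. q t * (m n * \<sigma> (m n * (T - t)))) = (LINT s|lborel. q (T + inverse (m n) * (-1) * s) * \<sigma> s)" for n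
      using m(1)[of n] lborel_integral_real_affine[of "- inverse (m n)" "\<lambda>t. q t * (m n * \<sigma> (m n * (T - t)))" T]
      by (simp add: field_simps flip: Bochner_Integration.integral_mult_right_zero)
    have "(LINT t|lebesgue. p t * partial_deriv 1 (\<eta> n) t)
       = (LINT s|lborel. q (0 + inverse (m n) * 1 * s) * \<sigma> s) - (LINT s|lborel. q (T + inverse (m n) * (-1) * s) * \<sigma> s)" for n
    proof -
      have \<eta>'0: "partial_deriv 1 (\<eta> n) t = 0" if "t \<notin> {0<..<T}" for t
        using test_outside[OF test_partial_deriv[OF \<eta>t] that] by simp
      have int: "integrable lborel (\<lambda>t. q t * (m n * \<sigma> (c * t + d)))" if "c \<noteq> 0" for c d
        using integrable_mult_bounded[OF integrable_mult_right[OF lborel_integrable_real_affine[OF \<sigma>int that, of d], of "m n"], of q C] qb qC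
        by (simp add: algebra_simps)
      have "(LINT t|lebesgue. p t * partial_deriv 1 (\<eta> n) t) = (LINT t|lebesgue. q t * partial_deriv 1 (\<eta> n) t)"
      proof (rule Bochner_Integration.integral_cong)
        fix t show "p t * partial_deriv 1 (\<eta> n) t = q t * partial_deriv 1 (\<eta> n) t"
          using \<eta>'0[of t] by (cases "t \<in> {0<..<T}") (auto simp: q_def max_def min_def)
      qed simp
      also have "\<dots> = (LINT t|lborel. q t * partial_deriv 1 (\<eta> n) t)"
        using qb \<sigma>b unfolding \<eta>' by (intro integral_completion) simp
      also have "\<dots> = (LINT t|lborel. q t * (m n * \<sigma> (m n * t)) - q t * (m n * \<sigma> (m n * (T - t))))"
        unfolding \<eta>' by (simp add: right_diff_distrib)
      also have "\<dots> = (LINT t|lborel. q t * (m n * \<sigma> (m n * t))) - (LINT t|lborel. q t * (m n * \<sigma> (m n * (T - t))))"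
        using int[of "m n" 0] int[of "- m n" "m n * T"] m(1)[of n]
        by (intro Bochner_Integration.integral_diff) (auto simp: algebra_simps)
      finally show ?thesis unfolding sub sub2 .
    qed
    then show "(\<lambda>n. LINT t|lebesgue. p t * partial_deriv 1 (\<eta> n) t) \<longlonglongrightarrow> p 0 - p T"
      using tendsto_diff[OF lim[of 0 1] lim[of T "-1"]] T by (simp add: q_def)
  qed
qed

section \<open>Slices of sets and a singular weight\<close>

text \<open>Let \<open>m(s)\<close> be the measure of the part of \<open>F\<close> with \<open>x \<bullet> c
  \<le> s\<close>. The increment of \<open>m\<close> from \<open>s\<close> to \<open>t\<close> is bounded by
  the measure of \<open>F\<close> in the slab of half-width \<open>\<bar>t - s\<bar>\<close> around
  \<open>s\<close>. If these measures were \<open>o(\<delta>)\<close> at every \<open>s\<close>, then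
  \<open>m\<close> would have zero derivative, hence be constant, and \<open>F\<close> would be a null
  set.\<close>

lemma thick_slice_exists:
  fixes F :: "'a::euclidean_space set"
  assumes F: "compact F" and n: "\<not> negligible F" and c: "c \<in> Basis"
  obtains s0 where "\<not> ((\<lambda>\<delta>. measure lebesgue (F \<inter> {x. \<bar>x \<bullet> c - s0\<bar> \<le> \<delta>}) / \<delta>) \<longlongrightarrow> 0) (at_right 0)"
proof (rule ccontr)
  assume "\<not> thesis"
  then have lim: "((\<lambda>\<delta>. measure lebesgue (F \<inter> {x. \<bar>x \<bullet> c - s\<bar> \<le> \<delta>}) / \<delta>) \<longlongrightarrow> 0) (at_right 0)" for s
    using that by blast
  have FL: "F \<in> lmeasurable" by (rule lmeasurable_compact[OF F])
  have cl: "closed {x. x \<bullet> c \<le> s}" "closed {x. \<bar>x \<bullet> c - s\<bar> \<le> \<delta>}" for s \<delta>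
    by (intro closed_Collect_le continuous_intros)+
  have meas: "F \<inter> {x. x \<bullet> c \<le> s} \<in> lmeasurable" "F \<inter> {x. \<bar>x \<bullet> c - s\<bar> \<le> \<delta>} \<in> lmeasurable" for s \<delta>
    by (intro lmeasurable_compact compact_Int_closed F cl)+
  define m where "m s = measure lebesgue (F \<inter> {x. x \<bullet> c \<le> s})" for s
  have diff: "\<bar>m t - m s\<bar> \<le> measure lebesgue (F \<inter> {x. \<bar>x \<bullet> c - s\<bar> \<le> \<bar>t - s\<bar>})" for s t
  proof -
    let ?E = "measure lebesgue (F \<inter> {x. \<bar>x \<bullet> c - s\<bar> \<le> \<bar>t - s\<bar>})"
    have "m t \<le> measure lebesgue ((F \<inter> {x. x \<bullet> c \<le> s}) \<union> (F \<inter> {x. \<bar>x \<bullet> c - s\<bar> \<le> \<bar>t - s\<bar>}))"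
      unfolding m_def by (intro measure_mono_fmeasurable fmeasurable.Un meas fmeasurableD) auto
    also have "\<dots> \<le> m s + ?E" unfolding m_def by (intro measure_Un_le fmeasurableD meas)
    finally have 1: "m t \<le> m s + ?E" .
    have "m s \<le> measure lebesgue ((F \<inter> {x. x \<bullet> c \<le> t}) \<union> (F \<inter> {x. \<bar>x \<bullet> c - s\<bar> \<le> \<bar>t - s\<bar>}))"
      unfolding m_def by (intro measure_mono_fmeasurable fmeasurable.Un meas fmeasurableD) auto
    also have "\<dots> \<le> m t + ?E" unfolding m_def by (intro measure_Un_le fmeasurableD meas)
    finally show ?thesis using 1 by linarith
  qed
  have "(m has_real_derivative 0) (at s)" for s
  proof -
    let ?q = "\<lambda>h. measure lebesgue (F \<inter> {x. \<bar>x \<bullet> c - s\<bar> \<le> \<bar>h\<bar>}) / \<bar>h\<bar>"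
    have abs0: "filterlim (\<lambda>h::real. \<bar>h\<bar>) (at_right 0) (at 0)"
      unfolding filterlim_at by (auto intro!: tendsto_eq_intros simp: eventually_at_filter)
    have "(?q \<longlongrightarrow> 0) (at 0)"
      by (rule filterlim_compose[OF lim abs0])
    then have "((\<lambda>h. (m (s + h) - m s) / h) \<longlongrightarrow> 0) (at 0)"
    proof (rule Lim_null_comparison[rotated])
      show "\<forall>\<^sub>F h in at 0. norm ((m (s + h) - m s) / h) \<le> ?q h"
        using diff[of "s + _" s] by (intro always_eventually) (auto simp: abs_divide intro!: divide_right_mono)
    qed
    then show ?thesis by (simp add: DERIV_def)
  qed
  then have const: "m s = m t" for s t using DERIV_isconst_all by blast
  obtain R where R: "\<And>x. x \<in> F \<Longrightarrow> norm x \<le> R" using compact_imp_bounded[OF F] by (auto simp: bounded_iff)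
  have xc: "\<bar>x \<bullet> c\<bar> \<le> R" if "x \<in> F" for x
    using R[OF that] Basis_le_norm[OF c, of x] by linarith
  have "m R = measure lebesgue F"
  proof -
    have "F \<inter> {x. x \<bullet> c \<le> R} = F" using xc by force
    then show ?thesis by (simp add: m_def)
  qed
  moreover have "m (- R - 1) = 0"
  proof -
    have "F \<inter> {x. x \<bullet> c \<le> - R - 1} = {}" using xc by fastforce
    then show ?thesis by (simp add: m_def)
  qed
  ultimately have "measure lebesgue F = 0" using const[of R "- R - 1"] by simp
  then show False using n FL negligible_iff_measure by blast
qed

text \<open>The integrand is a product of functions of one coordinate each; the singular factor has the
  antiderivative \<open>2 sqrt(s - s0)\<close>, where \<open>sqrt\<close> is odd.\<close>

lemma integrable_inverse_sqrt_slab: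
  fixes c :: "'a::euclidean_space" and R s0 :: real
  assumes c: "c \<in> Basis"
  shows "integrable lborel (\<lambda>x :: 'a. indicator (cbox (- (R *\<^sub>R One)) (R *\<^sub>R One)) x * inverse (sqrt \<bar>x \<bullet> c - s0\<bar>))"
proof -
  have i1: "(\<lambda>s. inverse (sqrt \<bar>s - s0\<bar>)) integrable_on {-R..R}"
  proof (cases "- R \<le> R")
    case True
    have "((\<lambda>s. inverse (sqrt \<bar>s - s0\<bar>)) has_integral 2 * sqrt (R - s0) - 2 * sqrt (- R - s0)) {-R..R}"
    proof (rule fundamental_theorem_of_calculus_strong[of "{s0}"])
      show "continuous_on {-R..R} (\<lambda>s. 2 * sqrt (s - s0))" by (intro continuous_intros)
      fix s assume "s \<in> {-R..R} - {s0}"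
      then have "s - s0 \<noteq> 0" by auto
      then have "(sqrt has_real_derivative inverse (sqrt \<bar>s - s0\<bar>) / 2) (at (s - s0))"
        by (intro DERIV_real_sqrt_generic) (use real_sqrt_minus[of "s - s0"] in auto)
      moreover have "((\<lambda>s. s - s0) has_real_derivative 1) (at s)" by (auto intro!: derivative_eq_intros)
      ultimately have "((\<lambda>s. sqrt (s - s0)) has_real_derivative inverse (sqrt \<bar>s - s0\<bar>) / 2 * 1) (at s)"
        by (rule DERIV_chain2)
      from DERIV_cmult[OF this, of 2]
      have "((\<lambda>s. 2 * sqrt (s - s0)) has_real_derivative inverse (sqrt \<bar>s - s0\<bar>)) (at s)" by simp
      then show "((\<lambda>s. 2 * sqrt (s - s0)) has_vector_derivative inverse (sqrt \<bar>s - s0\<bar>)) (at s)"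
        by (simp add: has_real_derivative_iff_has_vector_derivative)
    qed (use True in auto)
    then show ?thesis by blast
  qed (simp add: integrable_on_empty)
  define f :: "'a \<Rightarrow> real \<Rightarrow> real" where
    "f b s = (if b = c then indicator {-R..R} s * inverse (sqrt \<bar>s - s0\<bar>) else indicator {-R..R} s)" for b s
  have fn: "f b s \<ge> 0" for b s by (auto simp: f_def)
  have fb: "f b \<in> borel_measurable borel" for b unfolding f_def by simp
  have fin: "(\<integral>\<^sup>+s. ennreal (f b s) \<partial>lborel) < \<infinity>" for b
  proof (cases "b = c")
    case True
    have "(\<lambda>s. inverse (sqrt \<bar>s - s0\<bar>)) absolutely_integrable_on {-R..R}"
      by (rule nonnegative_absolutely_integrable_1[OF i1]) auto
    then have "integrable lebesgue (f b)" unfolding set_integrable_def f_def using True by simp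
    then have "integrable lborel (f b)" using integrable_completion[of "f b" lborel] fb by simp
    then show ?thesis using fn by (simp add: integrable_iff_bounded)
  next
    case False
    then show ?thesis by (simp add: f_def ennreal_indicator emeasure_lborel_Icc_eq)
  qed
  have eq: "indicator (cbox (- (R *\<^sub>R One)) (R *\<^sub>R One)) x * inverse (sqrt \<bar>x \<bullet> c - s0\<bar>) = (\<Prod>b\<in>Basis. f b (x \<bullet> b))" for x :: 'a
  proof -
    have "(\<Prod>b\<in>Basis. f b (x \<bullet> b)) = (\<Prod>b\<in>Basis. indicator {-R..R} (x \<bullet> b) * (if b = c then inverse (sqrt \<bar>x \<bullet> c - s0\<bar>) else 1))"
      by (intro prod.cong) (auto simp: f_def)
    also have "\<dots> = (\<Prod>b\<in>Basis. indicator {-R..R} (x \<bullet> b)) * inverse (sqrt \<bar>x \<bullet> c - s0\<bar>)"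
      using c by (simp add: prod.distrib)
    also have "(\<Prod>b\<in>Basis. indicator {-R..R} (x \<bullet> b) :: real) = indicator (cbox (- (R *\<^sub>R One)) (R *\<^sub>R One)) x"
    proof (cases "x \<in> cbox (- (R *\<^sub>R One)) (R *\<^sub>R One)")
      case True
      then show ?thesis by (simp add: mem_box inner_minus_left)
    next
      case False
      then obtain b where "b \<in> Basis" "x \<bullet> b \<notin> {-R..R}" by (auto simp: mem_box)
      then have "(\<Prod>b\<in>Basis. indicator {-R..R} (x \<bullet> b) :: real) = 0"
        by (intro prod_zero bexI[of _ b]) (auto simp: indicator_def)
      then show ?thesis using False by simp
    qed
    finally show ?thesis by simp
  qed
  have "integrable lborel (\<lambda>x :: 'a. \<Prod>b\<in>Basis. f b (x \<bullet> b))"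
    unfolding integrable_iff_bounded
  proof
    show "(\<lambda>x :: 'a. \<Prod>b\<in>Basis. f b (x \<bullet> b)) \<in> borel_measurable lborel"
      using fb by (auto intro!: borel_measurable_prod measurable_compose[OF _ fb])
    have "(\<integral>\<^sup>+x. ennreal (norm (\<Prod>b\<in>Basis. f b (x \<bullet> b))) \<partial>(lborel :: 'a measure)) = (\<integral>\<^sup>+x. (\<Prod>b\<in>Basis. ennreal (f b (x \<bullet> b))) \<partial>(lborel :: 'a measure))"
      using fn by (simp add: prod_ennreal abs_prod)
    also have "\<dots> = (\<Prod>b\<in>Basis. \<integral>\<^sup>+s. ennreal (f b s) \<partial>lborel)"
      using fb by (intro nn_integral_lborel_prod) auto
    also have "\<dots> < \<infinity>" using fin by (simp add: ennreal_prod_eq_top less_top[symmetric])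
    finally show "(\<integral>\<^sup>+x. ennreal (norm (\<Prod>b\<in>Basis. f b (x \<bullet> b))) \<partial>(lborel :: 'a measure)) < \<infinity>" .
  qed
  then show ?thesis by (simp only: eq)
qed

text \<open>By the fundamental lemma, weak derivatives are unique almost everywhere; hence the representative
  chosen by \<open>weak_deriv\<close> may be replaced by any other one.\<close>

lemma has_weak_deriv_unique:
  assumes S: "open S" and bs: "set bs \<subseteq> Basis" and w: "has_weak_deriv S bs u g" "has_weak_deriv S bs u h"
  shows "AE x in lebesgue. x \<in> S \<longrightarrow> g x = h x"
proof -
  define d where "d x = g x + (-1) * h x" for x
  have L: "g \<in> L1_loc S" "h \<in> L1_loc S" using w by (auto simp: has_weak_deriv_def)
  have neg: "negligible {x \<in> S. d x \<noteq> 0}"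
  proof (rule negligible_if_test_zero[OF S])
    show "d \<in> L1_loc S" unfolding d_def[abs_def]
      by (intro L1_loc_add L L1_loc_mult_continuous continuous_on_const)
    fix \<phi> :: "'a \<Rightarrow> real" assume \<phi>: "\<phi> \<in> test_functions S"
    have "(LINT x|lebesgue. d x * \<phi> x) = (LINT x|lebesgue. g x * \<phi> x - h x * \<phi> x)"
      by (simp add: d_def algebra_simps)
    also have "\<dots> = (LINT x|lebesgue. g x * \<phi> x) - (LINT x|lebesgue. h x * \<phi> x)"
      by (rule Bochner_Integration.integral_diff[OF L1_loc_test_integrable[OF L(1) \<phi>] L1_loc_test_integrable[OF L(2) \<phi>]])
    also have "\<dots> = 0" using has_weak_deriv_unique_test[OF S bs w \<phi>] by simp
    finally show "(LINT x|lebesgue. d x * \<phi> x) = 0" .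
  qed
  have "AE x in lebesgue. x \<notin> {x \<in> S. d x \<noteq> 0}"
    using neg by (intro AE_not_in) (simp add: negligible_iff_null_sets)
  then show ?thesis by eventually_elim (auto simp: d_def)
qed

section \<open>Dominated limits of test functions\<close>

lemma AE_lebesgue_on:
  assumes "S \<in> sets lebesgue" "AE x in lebesgue. P x" shows "AE x in lebesgue_on S. P x"
  using assms by (subst AE_restrict_space_iff) auto

lemma integrable_lebesgue_on:
  fixes f :: "'e::euclidean_space \<Rightarrow> real"
  assumes "S \<in> sets lebesgue" "integrable lebesgue f" shows "integrable (lebesgue_on S) f"
  using assms integrable_mult_indicator[of S lebesgue f] by (subst integrable_restrict_space) auto

lemma integrable_imp_L1_loc:
  assumes "integrable lebesgue f" shows "f \<in> L1_loc S"
  unfolding L1_loc_def set_integrable_def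
  using integrable_mult_indicator[OF _ assms] lmeasurable_compact fmeasurableD by blast

lemma L2_I:
  assumes "S \<in> sets lebesgue" "f \<in> borel_measurable lebesgue" "integrable lebesgue (\<lambda>x. (f x)\<^sup>2)"
  shows "f \<in> L2 S"
  unfolding L2_def using measurable_restrict_space1[OF assms(2)] integrable_lebesgue_on[OF assms(1,3)] by simp

text \<open>Let test functions and their derivatives up to order \<open>k\<close> converge almost everywhere
  and be dominated by one function that is integrable and square integrable. Then integration by parts passes
  to the limit, and the limit lies in \<open>H\<^sup>k\<close>, and in \<open>H\<^sup>1\<^sub>0\<close> if
  \<open>k \<ge> 1\<close>. Membership in these spaces is thus reduced to pointwise statements about explicit
  functions.\<close>

context
  fixes S :: "'e::euclidean_space set" and u :: "nat \<Rightarrow> 'e \<Rightarrow> real" and g :: "'e list \<Rightarrow> 'e \<Rightarrow> real"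
    and H :: "'e \<Rightarrow> real" and k :: nat
  assumes S: "open S" and u: "\<And>n. u n \<in> test_functions S"
    and H: "integrable lebesgue H" "integrable lebesgue (\<lambda>x. (H x)\<^sup>2)"
    and g: "\<And>bs. set bs \<subseteq> Basis \<Longrightarrow> length bs \<le> k \<Longrightarrow> g bs \<in> borel_measurable lebesgue"
    and lim: "\<And>bs. set bs \<subseteq> Basis \<Longrightarrow> length bs \<le> k \<Longrightarrow>
      AE x in lebesgue. (\<lambda>n. iter_deriv bs (u n) x) \<longlonglongrightarrow> g bs x"
    and dom: "\<And>bs n. set bs \<subseteq> Basis \<Longrightarrow> length bs \<le> k \<Longrightarrow>
      AE x in lebesgue. \<bar>iter_deriv bs (u n) x\<bar> \<le> H x"
begin

lemma dominated_limit_bound: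
  assumes "set bs \<subseteq> Basis" "length bs \<le> k"
  shows "AE x in lebesgue. \<bar>g bs x\<bar> \<le> H x"
proof -
  have "AE x in lebesgue. \<forall>n. \<bar>iter_deriv bs (u n) x\<bar> \<le> H x"
    using dom[OF assms] by (simp add: AE_all_countable)
  with lim[OF assms] show ?thesis
  proof eventually_elim
    case (elim x)
    then show ?case by (intro LIMSEQ_le_const2[OF tendsto_rabs[OF elim(1)]]) auto
  qed
qed

lemma dominated_limit_integrable:
  assumes "set bs \<subseteq> Basis" "length bs \<le> k"
  shows "integrable lebesgue (g bs)" "integrable lebesgue (\<lambda>x. (g bs x)\<^sup>2)"
proof -
  show "integrable lebesgue (g bs)"
    by (rule Bochner_Integration.integrable_bound[OF H(1) g[OF assms]])
      (use dominated_limit_bound[OF assms] in eventually_elim, auto)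
  show "integrable lebesgue (\<lambda>x. (g bs x)\<^sup>2)"
  proof (rule Bochner_Integration.integrable_bound[OF H(2)])
    show "(\<lambda>x. (g bs x)\<^sup>2) \<in> borel_measurable lebesgue" using g[OF assms] by simp
    show "AE x in lebesgue. norm ((g bs x)\<^sup>2) \<le> norm ((H x)\<^sup>2)"
      using dominated_limit_bound[OF assms] by eventually_elim (auto intro: power_mono simp: abs_le_square_iff[symmetric])
  qed
qed

lemma dominated_limit_L2:
  assumes "set bs \<subseteq> Basis" "length bs \<le> k"
  shows "g bs \<in> L2 S" "g bs \<in> L1_loc S"
  using L2_I[OF open_sets_lebesgue[OF S] g[OF assms] dominated_limit_integrable(2)[OF assms]]
    integrable_imp_L1_loc[OF dominated_limit_integrable(1)[OF assms]] by auto

lemma dominated_limit_test: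
  assumes bs: "set bs \<subseteq> Basis" "length bs \<le> k" and \<phi>: "\<phi> \<in> test_functions S"
  shows "(\<lambda>n. LINT x|lebesgue. iter_deriv bs (u n) x * \<phi> x) \<longlonglongrightarrow> (LINT x|lebesgue. g bs x * \<phi> x)"
proof -
  obtain C where C: "C > 0" "\<And>x. \<bar>\<phi> x\<bar> \<le> C" using test_bounded[OF \<phi>] by metis
  have m\<phi>: "\<phi> \<in> borel_measurable lebesgue" by (rule test_lebesgue[OF \<phi>])
  have mu: "iter_deriv bs (u n) \<in> borel_measurable lebesgue" for n
    by (rule test_lebesgue[OF test_iter_deriv[OF u bs(1)]])
  show ?thesis
  proof (rule integral_dominated_convergence[where w = "\<lambda>x. H x * C"])
    show "AE x in lebesgue. (\<lambda>n. iter_deriv bs (u n) x * \<phi> x) \<longlonglongrightarrow> g bs x * \<phi> x"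
      using lim[OF bs] by eventually_elim (intro tendsto_intros)
    show "AE x in lebesgue. norm (iter_deriv bs (u n) x * \<phi> x) \<le> H x * C" for n
      using dom[OF bs, of n]
    proof eventually_elim
      case (elim x)
      then show ?case using mult_mono'[OF elim C(2)[of x]] by (simp add: abs_mult)
    qed
  qed (use g[OF bs] m\<phi> mu H in auto)
qed

lemma dominated_limit_weak_deriv:
  assumes bs: "set bs \<subseteq> Basis" "length bs \<le> k"
  shows "has_weak_deriv S bs (g []) (g (rev bs))"
proof -
  have nil: "set [] \<subseteq> (Basis :: 'e set)" "length ([] :: 'e list) \<le> k" by auto
  have rbs: "set (rev bs) \<subseteq> Basis" "length (rev bs) \<le> k" using bs by auto
  have "(LINT x|lebesgue. g [] x * iter_deriv bs \<phi> x) = (- 1) ^ length bs * (LINT x|lebesgue. g (rev bs) x * \<phi> x)"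
    if \<phi>: "\<phi> \<in> test_functions S" for \<phi>
  proof (rule LIMSEQ_unique)
    show "(\<lambda>n. LINT x|lebesgue. u n x * iter_deriv bs \<phi> x) \<longlonglongrightarrow> (LINT x|lebesgue. g [] x * iter_deriv bs \<phi> x)"
      using dominated_limit_test[OF nil test_iter_deriv[OF \<phi> bs(1)]] by simp
    show "(\<lambda>n. LINT x|lebesgue. u n x * iter_deriv bs \<phi> x) \<longlonglongrightarrow> (- 1) ^ length bs * (LINT x|lebesgue. g (rev bs) x * \<phi> x)"
      unfolding integral_by_parts_iter[OF test_Cinf[OF u] \<phi> bs(1)]
      by (intro tendsto_intros dominated_limit_test rbs \<phi>)
  qed
  then show ?thesis unfolding has_weak_deriv_iff[OF S bs(1)]
    using dominated_limit_L2(2)[OF nil] dominated_limit_L2(2)[OF rbs] by blast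
qed

lemma dominated_limit_Hk: "g [] \<in> Hk k S"
proof -
  have "\<exists>h\<in>L2 S. has_weak_deriv S bs (g []) h" if bs: "set bs \<subseteq> Basis" "length bs \<le> k" for bs
    using dominated_limit_weak_deriv[OF bs] dominated_limit_L2(1)[of "rev bs"] bs by auto
  then show ?thesis unfolding Hk_def using dominated_limit_L2(1)[of "[]"] by auto
qed

lemma dominated_limit_square:
  assumes bs: "set bs \<subseteq> Basis" "length bs \<le> k"
    and h: "AE x in lebesgue_on S. h x = g bs x"
  shows "(\<lambda>n. LINT x|lebesgue_on S. (h x - iter_deriv bs (u n) x)\<^sup>2) \<longlonglongrightarrow> 0"
proof -
  have SL: "S \<in> sets lebesgue" by (rule open_sets_lebesgue[OF S])
  have mu: "iter_deriv bs (u n) \<in> borel_measurable lebesgue" for n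
    by (rule test_lebesgue[OF test_iter_deriv[OF u bs(1)]])
  have mg: "(\<lambda>x. (g bs x - iter_deriv bs (u n) x)\<^sup>2) \<in> borel_measurable (lebesgue_on S)" for n
    using mu g[OF bs] by (intro measurable_restrict_space1) simp
  have "(\<lambda>n. LINT x|lebesgue_on S. (g bs x - iter_deriv bs (u n) x)\<^sup>2) \<longlonglongrightarrow> (LINT x|lebesgue_on S. 0)"
  proof (rule integral_dominated_convergence[where w = "\<lambda>x. 4 * (H x)\<^sup>2"])
    show "integrable (lebesgue_on S) (\<lambda>x. 4 * (H x)\<^sup>2)"
      using integrable_lebesgue_on[OF SL H(2)] by simp
    show "AE x in lebesgue_on S. (\<lambda>n. (g bs x - iter_deriv bs (u n) x)\<^sup>2) \<longlonglongrightarrow> 0"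
      using AE_lebesgue_on[OF SL lim[OF bs]]
    proof eventually_elim
      case (elim x)
      show ?case using tendsto_power[OF tendsto_diff[OF tendsto_const[of "g bs x"] elim], of 2] by simp
    qed
    show "AE x in lebesgue_on S. norm ((g bs x - iter_deriv bs (u n) x)\<^sup>2) \<le> 4 * (H x)\<^sup>2" for n
      using AE_lebesgue_on[OF SL dom[OF bs, of n]] AE_lebesgue_on[OF SL dominated_limit_bound[OF bs]]
    proof eventually_elim
      case (elim x)
      then have "\<bar>g bs x - iter_deriv bs (u n) x\<bar> \<le> 2 * H x" by linarith
      then have "\<bar>g bs x - iter_deriv bs (u n) x\<bar>\<^sup>2 \<le> (2 * H x)\<^sup>2" by (intro power_mono) auto
      then show ?case by (simp add: power_mult_distrib)
    qed
  qed (use mg in auto)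
  moreover have hm: "h \<in> borel_measurable (lebesgue_on S)"
  proof (rule borel_measurable_if_D, rule borel_measurable_AE)
    show "(\<lambda>x. if x \<in> S then g bs x else 0) \<in> borel_measurable lebesgue"
      using measurable_restrict_space1[OF g[OF bs]] by (rule borel_measurable_if_I[OF _ SL])
    show "AE x in lebesgue. (if x \<in> S then g bs x else 0) = (if x \<in> S then h x else 0)"
      using h by (subst (asm) AE_restrict_space_iff) (use SL in \<open>auto elim: eventually_mono\<close>)
  qed
  moreover have "(LINT x|lebesgue_on S. (h x - iter_deriv bs (u n) x)\<^sup>2) = (LINT x|lebesgue_on S. (g bs x - iter_deriv bs (u n) x)\<^sup>2)" for n
    using h hm measurable_restrict_space1[OF g[OF bs]] measurable_restrict_space1[OF mu]
    by (intro integral_cong_AE) (auto elim: eventually_mono)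
  ultimately show ?thesis by simp
qed

text \<open>The definition of \<open>H\<^sup>1\<^sub>0\<close> refers to the chosen weak derivative, which
  agrees almost everywhere with the pointwise limit.\<close>

lemma dominated_limit_H10:
  assumes k: "k \<ge> 1" shows "g [] \<in> H10 S"
proof -
  have nil: "set [] \<subseteq> (Basis :: 'e set)" "length ([] :: 'e list) \<le> k" by auto
  have "g [] \<in> Hk 1 S" using dominated_limit_Hk k unfolding Hk_def by auto
  moreover have "(\<lambda>n. LINT x|lebesgue_on S. (g [] x - u n x)\<^sup>2) \<longlonglongrightarrow> 0"
    using dominated_limit_square[OF nil, of "g []"] by simp
  moreover have "(\<lambda>n. LINT x|lebesgue_on S. (weak_deriv S [b] (g []) x - partial_deriv b (u n) x)\<^sup>2) \<longlonglongrightarrow> 0"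
    if b: "b \<in> Basis" for b
  proof -
    have bs: "set [b] \<subseteq> Basis" "length [b] \<le> k" using b k by auto
    have w: "has_weak_deriv S [b] (g []) (g [b])" using dominated_limit_weak_deriv[OF bs] by simp
    have "AE x in lebesgue. x \<in> S \<longrightarrow> weak_deriv S [b] (g []) x = g [b] x"
      by (rule has_weak_deriv_unique[OF S bs(1) weak_deriv_works[OF w] w])
    then have "AE x in lebesgue_on S. weak_deriv S [b] (g []) x = g [b] x"
      by (subst AE_restrict_space_iff) (auto simp: open_sets_lebesgue[OF S])
    from dominated_limit_square[OF bs this] show ?thesis by simp
  qed
  ultimately show ?thesis unfolding H10_def using u by blast
qed

end


section \<open>An initial datum with singular Laplacian\<close>

text \<open>With \<open>w = x \<bullet> c - s0\<close>, the datum is \<open>\<zeta> (w\<^sup>2 +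
  e)\<^bsup>7/8\<^esup>\<close> at \<open>e = 0\<close>; for \<open>e > 0\<close> it is a test function. The
  functions \<open>profile_d1\<close> and \<open>profile_d2\<close> are the first two derivatives of
  \<open>(w\<^sup>2 + e)\<^bsup>7/8\<^esup>\<close> in direction \<open>c\<close>, and \<open>datum_deriv e
  bs\<close> is \<open>iter_deriv bs\<close> of the datum for \<open>length bs \<le> 2\<close>. As explicit
  formulas they keep their meaning at \<open>e = 0\<close>, where the classical second derivative does not
  exist on the hyperplane \<open>w = 0\<close>; longer lists are not differentiated further and have no
  meaning.

  The exponent is chosen so that the second derivative, of order
  \<open>\<bar>w\<bar>\<^bsup>-1/4\<^esup>\<close>, is unbounded and still square integrable.\<close>

context
  fixes \<zeta> :: "'a::euclidean_space \<Rightarrow> real" and c :: 'a and s0 :: real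
begin

definition reg_pow :: "real \<Rightarrow> real \<Rightarrow> 'a \<Rightarrow> real" where
  "reg_pow a e x = ((x \<bullet> c - s0)\<^sup>2 + e) powr a"

definition profile_d1 :: "real \<Rightarrow> 'a \<Rightarrow> real" where
  "profile_d1 e x = 7 / 4 * (x \<bullet> c - s0) * reg_pow (- 1 / 8) e x"

definition profile_d2 :: "real \<Rightarrow> 'a \<Rightarrow> real" where
  "profile_d2 e x = 7 / 4 * reg_pow (- 1 / 8) e x - 7 / 16 * (x \<bullet> c - s0)\<^sup>2 * reg_pow (- 9 / 8) e x"

fun datum_deriv :: "real \<Rightarrow> 'a list \<Rightarrow> 'a \<Rightarrow> real" where
  "datum_deriv e [] x = \<zeta> x * reg_pow (7 / 8) e x"
| "datum_deriv e [b] x = partial_deriv b \<zeta> x * reg_pow (7 / 8) e x + \<zeta> x * ((c \<bullet> b) * profile_d1 e x)"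
| "datum_deriv e (b # d # bs) x =
     partial_deriv b (partial_deriv d \<zeta>) x * reg_pow (7 / 8) e x + partial_deriv d \<zeta> x * ((c \<bullet> b) * profile_d1 e x)
     + (partial_deriv b \<zeta> x * ((c \<bullet> d) * profile_d1 e x) + \<zeta> x * ((c \<bullet> d) * ((c \<bullet> b) * profile_d2 e x)))"

abbreviation "weight \<equiv> reg_pow (- 1 / 8) 0"

lemma weight_square: "(weight x)\<^sup>2 = inverse (sqrt \<bar>x \<bullet> c - s0\<bar>)"
proof (cases "x \<bullet> c = s0")
  case True then show ?thesis by (simp add: reg_pow_def)
next
  case False
  then have p: "\<bar>x \<bullet> c - s0\<bar> > 0" by simp
  have eq: "(x \<bullet> c - s0)\<^sup>2 = \<bar>x \<bullet> c - s0\<bar> powr 2" using p by (simp add: powr_numeral)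
  have "weight x = (\<bar>x \<bullet> c - s0\<bar> powr 2) powr (- 1 / 8)" unfolding reg_pow_def eq by simp
  also have "\<dots> = \<bar>x \<bullet> c - s0\<bar> powr (- 1 / 4)" by (simp only: powr_powr) simp
  finally have "weight x = \<bar>x \<bullet> c - s0\<bar> powr (- 1 / 4)" .
  then have "(weight x)\<^sup>2 = \<bar>x \<bullet> c - s0\<bar> powr (- 1 / 2)"
    by (simp add: powr_numeral[symmetric] powr_powr del: powr_numeral)
  also have "\<dots> = inverse (sqrt \<bar>x \<bullet> c - s0\<bar>)" using p by (simp add: powr_half_sqrt[symmetric] powr_minus[symmetric])
  finally show ?thesis .
qed

context
  fixes \<Omega> :: "'a set"
  assumes \<Omega>: "open \<Omega>" and \<zeta>: "\<zeta> \<in> test_functions \<Omega>" and c: "c \<in> Basis"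
begin

lemma Cinf_reg_pow: "e > 0 \<Longrightarrow> reg_pow a e \<in> Cinf_on UNIV"
proof -
  assume e: "e > 0"
  have w: "(\<lambda>x :: 'a. x \<bullet> c - s0) \<in> Cinf_on UNIV"
    by (rule Cinf_on_diff[OF open_UNIV Cinf_on_inner_left[OF open_UNIV] Cinf_on_const[OF open_UNIV]])
  have "(\<lambda>x :: 'a. (x \<bullet> c - s0) * (x \<bullet> c - s0) + e) \<in> Cinf_on UNIV"
    by (rule Cinf_on_add[OF open_UNIV Cinf_on_mult[OF open_UNIV w w] Cinf_on_const[OF open_UNIV]])
  then show ?thesis unfolding reg_pow_def[abs_def] power2_eq_square
    by (rule Cinf_on_compose[OF open_UNIV open_greaterThan Cinf_on_powr]) (use e in \<open>auto intro: add_nonneg_pos\<close>)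
qed

lemma reg_pow_derivative:
  assumes e: "e > 0"
  shows "(reg_pow a e has_derivative (\<lambda>h. (h \<bullet> c) * (2 * a * (x \<bullet> c - s0) * reg_pow (a - 1) e x))) (at x)"
proof -
  have 0: "(x \<bullet> c - s0)\<^sup>2 + e > 0" using e by (auto intro: add_nonneg_pos)
  have "((\<lambda>s. s powr a) has_real_derivative a * ((x \<bullet> c - s0)\<^sup>2 + e) powr (a - 1)) (at ((x \<bullet> c - s0)\<^sup>2 + e))"
    using 0 by (auto intro!: derivative_eq_intros)
  then have 1: "((\<lambda>s. s powr a) has_derivative (*) (a * ((x \<bullet> c - s0)\<^sup>2 + e) powr (a - 1))) (at ((x \<bullet> c - s0)\<^sup>2 + e))"
    by (simp add: has_field_derivative_def)
  have 2: "((\<lambda>x. (x \<bullet> c - s0)\<^sup>2 + e) has_derivative (\<lambda>h. 2 * (x \<bullet> c - s0) * (h \<bullet> c))) (at x)"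
    by (auto intro!: derivative_eq_intros simp: power2_eq_square)
  show ?thesis using has_derivative_compose[OF 2 1] by (simp add: reg_pow_def[abs_def] mult_ac)
qed

lemma partial_deriv_profile:
  assumes e: "e > 0"
  shows "partial_deriv b (reg_pow (7 / 8) e) x = (c \<bullet> b) * profile_d1 e x"
    and "partial_deriv b (profile_d1 e) x = (c \<bullet> b) * profile_d2 e x"
    and "profile_d1 e differentiable (at x)"
proof -
  show "partial_deriv b (reg_pow (7 / 8) e) x = (c \<bullet> b) * profile_d1 e x"
    using partial_derivI[OF reg_pow_derivative[OF e, of "7 / 8" x], of b] by (simp add: profile_d1_def inner_commute)
  have w: "((\<lambda>x. 7 / 4 * (x \<bullet> c - s0)) has_derivative (\<lambda>h. 7 / 4 * (h \<bullet> c))) (at x)"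
    by (auto intro!: derivative_eq_intros)
  have d: "(profile_d1 e has_derivative (\<lambda>h. 7 / 4 * (x \<bullet> c - s0) * ((h \<bullet> c) * (2 * (- 1 / 8) * (x \<bullet> c - s0) * reg_pow (- 1 / 8 - 1) e x))
      + 7 / 4 * (h \<bullet> c) * reg_pow (- 1 / 8) e x)) (at x)"
    unfolding profile_d1_def[abs_def] by (rule has_derivative_mult[OF w reg_pow_derivative[OF e]])
  then show "profile_d1 e differentiable (at x)" by (auto simp: differentiable_def)
  show "partial_deriv b (profile_d1 e) x = (c \<bullet> b) * profile_d2 e x"
    unfolding partial_derivI[OF d, of b] profile_d2_def inner_commute[of b c] power2_eq_square
    by (simp add: field_simps)
qed

lemma datum_test: "e > 0 \<Longrightarrow> datum_deriv e [] \<in> test_functions \<Omega>"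
proof -
  assume e: "e > 0"
  have "(\<lambda>x. reg_pow (7 / 8) e x * \<zeta> x) \<in> test_functions \<Omega>"
    by (rule test_mult[OF \<Omega> Cinf_on_subset[OF open_UNIV \<Omega> _ Cinf_reg_pow[OF e]] \<zeta>]) simp
  also have "(\<lambda>x. reg_pow (7 / 8) e x * \<zeta> x) = datum_deriv e []" by (rule ext) simp
  finally show ?thesis .
qed

lemma iter_deriv_datum:
  assumes e: "e > 0" and bs: "set bs \<subseteq> Basis" "length bs \<le> 2"
  shows "iter_deriv bs (datum_deriv e []) = datum_deriv e bs"
proof -
  have P: "reg_pow (7 / 8) e differentiable (at x)" for x using reg_pow_derivative[OF e] by (auto simp: differentiable_def)
  have Z: "\<zeta> differentiable (at x)" for x by (rule Cinf_on_differentiable[OF open_UNIV test_Cinf[OF \<zeta>]]) simp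
  have dZ: "partial_deriv b \<zeta> differentiable (at x)" if "b \<in> Basis" for b x
    by (rule Cinf_on_differentiable[OF open_UNIV test_Cinf[OF test_partial_deriv[OF \<zeta> that]]]) simp
  have Q: "(\<lambda>x. k * profile_d1 e x) differentiable (at x)" "partial_deriv b (\<lambda>x. k * profile_d1 e x) x = k * ((c \<bullet> b) * profile_d2 e x)" for k b x
    using partial_deriv_profile[OF e] partial_deriv_mult[of "\<lambda>_. k" x "profile_d1 e" b] by (auto simp: partial_deriv_const)
  have 0: "datum_deriv e [] = (\<lambda>x. \<zeta> x * reg_pow (7 / 8) e x)" by (rule ext) simp
  have 1: "partial_deriv b (datum_deriv e []) = datum_deriv e [b]" for b
    unfolding 0 by (rule ext) (simp add: partial_deriv_mult[OF Z P] partial_deriv_profile(1)[OF e])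
  have 2: "partial_deriv b (datum_deriv e [d]) = datum_deriv e [b, d]" if "d \<in> Basis" for b d
  proof
    fix x
    have "datum_deriv e [d] = (\<lambda>x. partial_deriv d \<zeta> x * reg_pow (7 / 8) e x + \<zeta> x * ((c \<bullet> d) * profile_d1 e x))" by (rule ext) simp
    then have "partial_deriv b (datum_deriv e [d]) x =
        partial_deriv b (\<lambda>x. partial_deriv d \<zeta> x * reg_pow (7 / 8) e x) x + partial_deriv b (\<lambda>x. \<zeta> x * ((c \<bullet> d) * profile_d1 e x)) x"
      using partial_deriv_add[OF differentiable_mult[OF dZ[OF that] P] differentiable_mult[OF Z Q(1)]] by simp
    then show "partial_deriv b (datum_deriv e [d]) x = datum_deriv e [b, d] x"
      by (simp add: partial_deriv_mult[OF dZ[OF that] P] partial_deriv_mult[OF Z Q(1)] Q(2) partial_deriv_profile(1)[OF e])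
  qed
  consider "bs = []" | b where "bs = [b]" | b d where "bs = [b, d]"
    using bs(2) by (cases bs; cases "tl bs") (auto simp: Suc_le_eq numeral_2_eq_2)
  then show ?thesis using bs(1) by cases (auto simp: 1 2)
qed

text \<open>All three functions are dominated by multiples of \<open>weight x =
  \<bar>w\<bar>\<^bsup>-1/4\<^esup>\<close>, uniformly in \<open>e \<in> [0,1]\<close>, since the exponents
  \<open>7/8 = 1 - 1/8\<close> and \<open>-9/8 = -1/8 - 1\<close> differ from \<open>-1/8\<close> by one power
  of \<open>w\<^sup>2 + e\<close>.\<close>

lemma profile_bounds:
  assumes x: "x \<bullet> c \<noteq> s0" "\<bar>x \<bullet> c - s0\<bar> \<le> L" and e: "0 \<le> e" "e \<le> 1"
  shows "\<bar>reg_pow (7 / 8) e x\<bar> \<le> (L\<^sup>2 + 1) * weight x" "\<bar>profile_d1 e x\<bar> \<le> 7 / 4 * L * weight x" "\<bar>profile_d2 e x\<bar> \<le> 3 * weight x"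
proof -
  define q where "q = (x \<bullet> c - s0)\<^sup>2"
  have q: "q > 0" using x(1) by (simp add: q_def)
  have qL: "q \<le> L\<^sup>2" using power_mono[OF x(2), of 2] by (simp add: q_def)
  have W: "(q + e) powr (- 1 / 8) \<le> q powr (- 1 / 8)" using q e by (intro powr_mono2') auto
  have W0: "(q + e) powr (- 1 / 8) \<ge> 0" by simp
  have "(q + e) powr (7 / 8) = (q + e) * (q + e) powr (- 1 / 8)"
    using q e powr_add[of "q + e" 1 "- 1 / 8"] by simp
  also have "\<dots> \<le> (L\<^sup>2 + 1) * q powr (- 1 / 8)" using qL e q W by (intro mult_mono) auto
  finally show "\<bar>reg_pow (7 / 8) e x\<bar> \<le> (L\<^sup>2 + 1) * weight x" by (simp add: reg_pow_def q_def)
  have "\<bar>x \<bullet> c - s0\<bar> * (q + e) powr (- 1 / 8) \<le> L * q powr (- 1 / 8)"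
    using x(2) W by (intro mult_mono) auto
  moreover have "\<bar>profile_d1 e x\<bar> = 7 / 4 * (\<bar>x \<bullet> c - s0\<bar> * (q + e) powr (- 1 / 8))"
    unfolding profile_d1_def reg_pow_def q_def abs_mult by simp
  ultimately show "\<bar>profile_d1 e x\<bar> \<le> 7 / 4 * L * weight x" by (simp add: reg_pow_def q_def)
  have "q * (q + e) powr (- 9 / 8) \<le> (q + e) * (q + e) powr (- 9 / 8)" using e by (intro mult_right_mono) auto
  also have "\<dots> = (q + e) powr (- 1 / 8)" using q e powr_add[of "q + e" 1 "- 9 / 8"] by simp
  finally have "q * (q + e) powr (- 9 / 8) \<le> q powr (- 1 / 8)" using W by simp
  moreover have "q * (q + e) powr (- 9 / 8) \<ge> 0" using q by simp
  moreover have "profile_d2 e x = 7 / 4 * (q + e) powr (- 1 / 8) - 7 / 16 * (q * (q + e) powr (- 9 / 8))"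
    by (simp add: profile_d2_def reg_pow_def q_def)
  ultimately have "\<bar>profile_d2 e x\<bar> \<le> 3 * q powr (- 1 / 8)" using W W0 by linarith
  then show "\<bar>profile_d2 e x\<bar> \<le> 3 * weight x" by (simp add: reg_pow_def q_def)
qed

lemma reg_pow_tendsto:
  assumes x: "x \<bullet> c \<noteq> s0" and e: "(\<lambda>n. e n) \<longlonglongrightarrow> 0"
  shows "(\<lambda>n. reg_pow a (e n) x) \<longlonglongrightarrow> reg_pow a 0 x"
  unfolding reg_pow_def by (intro tendsto_intros e) (use x in auto)

lemma datum_deriv_tendsto:
  assumes x: "x \<bullet> c \<noteq> s0" and e: "(\<lambda>n. e n) \<longlonglongrightarrow> 0"
  shows "(\<lambda>n. datum_deriv (e n) bs x) \<longlonglongrightarrow> datum_deriv 0 bs x"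
proof -
  note t = reg_pow_tendsto[OF x e]
  have 1: "(\<lambda>n. profile_d1 (e n) x) \<longlonglongrightarrow> profile_d1 0 x" "(\<lambda>n. profile_d2 (e n) x) \<longlonglongrightarrow> profile_d2 0 x"
    unfolding profile_d1_def profile_d2_def by (intro tendsto_intros t)+
  consider "bs = []" | b where "bs = [b]" | b d bs' where "bs = b # d # bs'"
    by (cases bs; cases "tl bs") auto
  then show ?thesis by cases (auto intro!: tendsto_intros t 1)
qed

lemma datum_deriv_measurable:
  assumes "set bs \<subseteq> Basis" shows "datum_deriv e bs \<in> borel_measurable borel"
proof -
  have s: "(\<lambda>x. reg_pow a e x) \<in> borel_measurable borel" for a unfolding reg_pow_def by measurable
  have s12: "(\<lambda>x. profile_d1 e x) \<in> borel_measurable borel" "(\<lambda>x. profile_d2 e x) \<in> borel_measurable borel"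
    unfolding profile_d1_def profile_d2_def using s by (intro borel_measurable_times borel_measurable_diff borel_measurable_power; simp)+
  have Z: "(\<lambda>x. \<zeta> x) \<in> borel_measurable borel" using test_borel[OF \<zeta>] .
  have dZ: "(\<lambda>x. partial_deriv b \<zeta> x) \<in> borel_measurable borel" if "b \<in> Basis" for b
    using test_borel[OF test_partial_deriv[OF \<zeta> that]] .
  have ddZ: "(\<lambda>x. partial_deriv b (partial_deriv d \<zeta>) x) \<in> borel_measurable borel" if "b \<in> Basis" "d \<in> Basis" for b d
    using test_borel[OF test_partial_deriv[OF test_partial_deriv[OF \<zeta> that(2)] that(1)]] .
  consider "bs = []" | b where "bs = [b]" | b d bs' where "bs = b # d # bs'"
    by (cases bs; cases "tl bs") auto
  then have "(\<lambda>x. datum_deriv e bs x) \<in> borel_measurable borel"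
    using assms by cases (auto intro!: borel_measurable_times borel_measurable_add s s12 Z dZ ddZ)
  then show ?thesis by simp
qed

lemma datum_dominated:
  obtains H where "integrable lebesgue H" "integrable lebesgue (\<lambda>x. (H x)\<^sup>2)"
    "\<And>bs e x. set bs \<subseteq> Basis \<Longrightarrow> 0 \<le> e \<Longrightarrow> e \<le> 1 \<Longrightarrow> x \<bullet> c \<noteq> s0 \<Longrightarrow> \<bar>datum_deriv e bs x\<bar> \<le> H x"
proof -
  obtain K where K: "compact K" "\<And>x. x \<notin> K \<Longrightarrow> \<zeta> x = 0" using testE[OF \<zeta>] by metis
  obtain R where R: "\<And>x. x \<in> K \<Longrightarrow> norm x \<le> R" using compact_imp_bounded[OF K(1)] by (auto simp: bounded_iff)
  define B where "B = cbox (- (R *\<^sub>R One)) (R *\<^sub>R (One :: 'a))"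
  have KB: "K \<subseteq> B"
  proof
    fix x assume "x \<in> K"
    then have "\<bar>x \<bullet> b\<bar> \<le> R" if "b \<in> Basis" for b using R[of x] Basis_le_norm[OF that, of x] by linarith
    then show "x \<in> B" unfolding B_def mem_box by (auto simp: inner_minus_left abs_le_iff) (metis minus_le_iff)
  qed
  define L where "L = \<bar>R\<bar> + \<bar>s0\<bar>"
  have xL: "\<bar>x \<bullet> c - s0\<bar> \<le> L" if "x \<in> K" for x
    using R[OF that] Basis_le_norm[OF c, of x] unfolding L_def by linarith
  have "\<exists>M. \<forall>x. \<bar>\<zeta> x\<bar> \<le> M" using test_bounded[OF \<zeta>] by metis
  then obtain M0 where M0: "\<And>x. \<bar>\<zeta> x\<bar> \<le> M0" by blast
  have "\<forall>b. \<exists>M. b \<in> Basis \<longrightarrow> (\<forall>x. \<bar>partial_deriv b \<zeta> x\<bar> \<le> M)"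
    using test_bounded[OF test_partial_deriv[OF \<zeta>]] by metis
  then obtain M1 where M1: "\<And>b x. b \<in> Basis \<Longrightarrow> \<bar>partial_deriv b \<zeta> x\<bar> \<le> M1 b" by metis
  have "\<forall>b d. \<exists>M. b \<in> Basis \<longrightarrow> d \<in> Basis \<longrightarrow> (\<forall>x. \<bar>partial_deriv b (partial_deriv d \<zeta>) x\<bar> \<le> M)"
    using test_bounded[OF test_partial_deriv[OF test_partial_deriv[OF \<zeta>]]] by metis
  then obtain M2 where M2: "\<And>b d x. b \<in> Basis \<Longrightarrow> d \<in> Basis \<Longrightarrow> \<bar>partial_deriv b (partial_deriv d \<zeta>) x\<bar> \<le> M2 b d" by metis
  define M where "M = M0 + (\<Sum>b\<in>Basis. M1 b) + (\<Sum>b\<in>Basis. \<Sum>d\<in>Basis. M2 b d)"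
  have nn: "0 \<le> M0" "b \<in> Basis \<Longrightarrow> 0 \<le> M1 b" "b \<in> Basis \<Longrightarrow> d \<in> Basis \<Longrightarrow> 0 \<le> M2 b d" for b d
    using order_trans[OF abs_ge_zero M0] order_trans[OF abs_ge_zero M1] order_trans[OF abs_ge_zero M2] by auto
  have snn: "0 \<le> (\<Sum>b\<in>Basis. M1 b)" "0 \<le> (\<Sum>b\<in>Basis. \<Sum>d\<in>Basis. M2 b d)"
    by (intro sum_nonneg nn; assumption)+
  have ZM: "\<bar>\<zeta> x\<bar> \<le> M" for x using M0[of x] snn unfolding M_def by linarith
  have dZM: "\<bar>partial_deriv b \<zeta> x\<bar> \<le> M" if "b \<in> Basis" for b x
    using M1[OF that, of x] member_le_sum[OF that, of M1] nn snn unfolding M_def by force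
  have ddZM: "\<bar>partial_deriv b (partial_deriv d \<zeta>) x\<bar> \<le> M" if "b \<in> Basis" "d \<in> Basis" for b d x
  proof -
    have "M2 b d \<le> (\<Sum>d\<in>Basis. M2 b d)" using that nn by (intro member_le_sum) auto
    also have "\<dots> \<le> (\<Sum>b\<in>Basis. \<Sum>d\<in>Basis. M2 b d)"
      using that nn by (intro member_le_sum[of b Basis "\<lambda>b. \<Sum>d\<in>Basis. M2 b d"] sum_nonneg) auto
    finally show ?thesis using M2[OF that, of x] nn(1) snn unfolding M_def by linarith
  qed
  have cb: "\<bar>c \<bullet> b\<bar> \<le> 1" if "b \<in> Basis" for b using c that by (auto simp: inner_Basis)
  define N where "N = (L\<^sup>2 + 1) + 7 / 4 * L + 3"
  have N: "L\<^sup>2 + 1 \<le> N" "7 / 4 * L \<le> N" "3 \<le> N" "0 \<le> N"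
  proof -
    have "L \<ge> 0" "L\<^sup>2 \<ge> 0" by (simp_all add: L_def)
    then show "L\<^sup>2 + 1 \<le> N" "7 / 4 * L \<le> N" "3 \<le> N" "0 \<le> N" unfolding N_def by linarith+
  qed
  have M: "M \<ge> 0" using nn(1) snn unfolding M_def by linarith
  define H where "H x = indicator B x * (4 * M * N * weight x)" for x
  have weight0: "weight x \<ge> 0" for x by (simp add: reg_pow_def)
  show thesis
  proof (rule that[of H])
    have weightm: "weight \<in> borel_measurable borel" unfolding reg_pow_def[abs_def] by measurable
    have Hm: "H \<in> borel_measurable borel" unfolding H_def[abs_def] using weightm by (simp add: B_def)
    have "integrable lborel (\<lambda>x. (4 * M * N)\<^sup>2 * (indicator B x * (weight x)\<^sup>2))"
      using integrable_inverse_sqrt_slab[OF c, of R s0] unfolding weight_square B_def by simp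
    also have "(\<lambda>x. (4 * M * N)\<^sup>2 * (indicator B x * (weight x)\<^sup>2)) = (\<lambda>x. (H x)\<^sup>2)"
      by (rule ext) (auto simp: H_def power_mult_distrib indicator_def)
    finally have H2: "integrable lborel (\<lambda>x. (H x)\<^sup>2)" .
    have "integrable lborel H"
    proof (rule Bochner_Integration.integrable_bound[of _ "\<lambda>x. indicator B x + (H x)\<^sup>2"])
      show "integrable lborel (\<lambda>x. indicator B x + (H x)\<^sup>2)"
        using H2 emeasure_bounded_finite[OF bounded_cbox]
        by (intro Bochner_Integration.integrable_add integrable_real_indicator) (auto simp: B_def)
      show "AE x in lborel. norm (H x) \<le> norm (indicator B x + (H x)\<^sup>2)"
      proof (rule AE_I2)
        fix x
        have "2 * \<bar>H x\<bar> \<le> 1 + (H x)\<^sup>2" using sum_power2_ge_zero[of "\<bar>H x\<bar> - 1" 0] by (simp add: power2_diff)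
        then show "norm (H x) \<le> norm (indicator B x + (H x)\<^sup>2)"
          by (cases "x \<in> B") (auto simp: H_def)
      qed
    qed (use Hm in simp)
    then show "integrable lebesgue H" "integrable lebesgue (\<lambda>x. (H x)\<^sup>2)"
      using H2 Hm integrable_completion[of H lborel] integrable_completion[of "\<lambda>x. (H x)\<^sup>2" lborel] by auto
    fix bs :: "'a list" and e :: real and x assume bs: "set bs \<subseteq> Basis" and e: "0 \<le> e" "e \<le> 1" and x: "x \<bullet> c \<noteq> s0"
    show "\<bar>datum_deriv e bs x\<bar> \<le> H x"
    proof (cases "x \<in> K")
      case True
      have z: "\<bar>reg_pow (7 / 8) e x\<bar> \<le> N * weight x" "\<bar>profile_d1 e x\<bar> \<le> N * weight x" "\<bar>profile_d2 e x\<bar> \<le> N * weight x"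
        using profile_bounds[OF x xL[OF True] e] mult_right_mono[OF N(1) weight0[of x]] mult_right_mono[OF N(2) weight0[of x]]
          mult_right_mono[OF N(3) weight0[of x]] by linarith+
      have pr: "\<bar>p * v\<bar> \<le> M * (N * weight x)" if "\<bar>p\<bar> \<le> M" "\<bar>v\<bar> \<le> N * weight x" for p v
        unfolding abs_mult using that M by (intro mult_mono) auto
      have cv: "\<bar>(c \<bullet> b) * v\<bar> \<le> N * weight x" if "b \<in> Basis" "\<bar>v\<bar> \<le> N * weight x" for b v
        unfolding abs_mult using mult_mono[OF cb[OF that(1)] that(2)] by simp
      have W: "0 \<le> M * (N * weight x)" using M N weight0 by simp
      have "\<bar>datum_deriv e bs x\<bar> \<le> 4 * (M * (N * weight x))"
      proof -
        consider "bs = []" | b where "bs = [b]" | b d bs' where "bs = b # d # bs'"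
          by (cases bs; cases "tl bs") auto
        then show ?thesis
        proof cases
          case 1 show ?thesis unfolding 1 datum_deriv.simps using pr[OF ZM z(1), of x] W by linarith
        next
          case 2 then have b: "b \<in> Basis" using bs by simp
          show ?thesis unfolding 2 datum_deriv.simps
            using pr[OF dZM[OF b] z(1), of x] pr[OF ZM cv[OF b z(2)], of x] W by linarith
        next
          case 3 then have b: "b \<in> Basis" "d \<in> Basis" using bs by auto
          show ?thesis unfolding 3 datum_deriv.simps
            using pr[OF ddZM[OF b] z(1), of x] pr[OF dZM[OF b(2)] cv[OF b(1) z(2)], of x]
              pr[OF dZM[OF b(1)] cv[OF b(2) z(2)], of x] pr[OF ZM cv[OF b(2) cv[OF b(1) z(3)]], of x]
            by linarith
        qed
      qed
      then show ?thesis using True KB by (simp add: H_def subset_iff mult.assoc)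
    next
      case False
      have o: "open (- K)" using compact_imp_closed[OF K(1)] by auto
      have d1: "partial_deriv b \<zeta> y = 0" if "y \<notin> K" for b y
        using partial_deriv_cong[OF o, of y \<zeta> "\<lambda>_. 0" b] that K(2) by (simp add: partial_deriv_const)
      have d2: "partial_deriv b (partial_deriv d \<zeta>) y = 0" if "y \<notin> K" for b d y
        using partial_deriv_cong[OF o, of y "partial_deriv d \<zeta>" "\<lambda>_. 0" b] that d1 by (simp add: partial_deriv_const)
      consider "bs = []" | b where "bs = [b]" | b d bs' where "bs = b # d # bs'"
        by (cases bs; cases "tl bs") auto
      then have "datum_deriv e bs x = 0" using False by cases (simp_all add: K(2) d1 d2)
      moreover have "H x \<ge> 0" using M N weight0 by (simp add: H_def)
      ultimately show ?thesis by simp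
    qed
  qed
qed

lemma negligible_slice: "negligible {x :: 'a. x \<bullet> c = s0}"
  using negligible_standard_hyperplane[OF c] .

lemma singular_datum:
  shows "datum_deriv 0 [] \<in> Hk 2 \<Omega>" "datum_deriv 0 [] \<in> H10 \<Omega>"
    and "b \<in> Basis \<Longrightarrow> has_weak_deriv \<Omega> [b, b] (datum_deriv 0 []) (datum_deriv 0 [b, b])"
    and "set bs \<subseteq> Basis \<Longrightarrow> length bs \<le> 2 \<Longrightarrow> integrable lebesgue (datum_deriv 0 bs)"
proof -
  obtain H where H: "integrable lebesgue H" "integrable lebesgue (\<lambda>x. (H x)\<^sup>2)"
    "\<And>bs e x. set bs \<subseteq> Basis \<Longrightarrow> 0 \<le> e \<Longrightarrow> e \<le> 1 \<Longrightarrow> x \<bullet> c \<noteq> s0 \<Longrightarrow> \<bar>datum_deriv e bs x\<bar> \<le> H x"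
    using datum_dominated by blast
  define e where "e n = inverse (real (Suc n))" for n
  have e: "e n > 0" "e n \<le> 1" for n by (auto simp: e_def field_simps)
  have e0: "e \<longlonglongrightarrow> 0" unfolding e_def by (rule LIMSEQ_inverse_real_of_nat)
  have ae: "AE x in lebesgue. x \<bullet> c \<noteq> s0"
    using AE_not_in[of "{x. x \<bullet> c = s0}" lebesgue] negligible_slice by (simp add: negligible_iff_null_sets)
  note * = \<Omega> datum_test[OF e(1)] H(1,2)
  have g: "datum_deriv 0 bs \<in> borel_measurable lebesgue" if "set bs \<subseteq> Basis" "length bs \<le> 2" for bs
    using measurable_completion[of "datum_deriv 0 bs" lborel] datum_deriv_measurable[OF that(1)] by simp
  have lim: "AE x in lebesgue. (\<lambda>n. iter_deriv bs (datum_deriv (e n) []) x) \<longlonglongrightarrow> datum_deriv 0 bs x"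
    if "set bs \<subseteq> Basis" "length bs \<le> 2" for bs
    unfolding iter_deriv_datum[OF e(1) that] using ae by eventually_elim (rule datum_deriv_tendsto[OF _ e0])
  have dom: "AE x in lebesgue. \<bar>iter_deriv bs (datum_deriv (e n) []) x\<bar> \<le> H x"
    if "set bs \<subseteq> Basis" "length bs \<le> 2" for bs n
    unfolding iter_deriv_datum[OF e(1) that] using ae
    by eventually_elim (use H(3)[OF that(1)] e less_imp_le in blast)
  show "datum_deriv 0 [] \<in> Hk 2 \<Omega>" by (rule dominated_limit_Hk[OF * g lim dom])
  show "datum_deriv 0 [] \<in> H10 \<Omega>" by (rule dominated_limit_H10[OF * g lim dom]) auto
  show "has_weak_deriv \<Omega> [b, b] (datum_deriv 0 []) (datum_deriv 0 [b, b])" if "b \<in> Basis"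
  proof -
    have "has_weak_deriv \<Omega> [b, b] (datum_deriv 0 []) (datum_deriv 0 (rev [b, b]))"
      by (rule dominated_limit_weak_deriv[OF * g lim dom]) (use that in auto)
    then show ?thesis by (simp only: rev.simps append.simps)
  qed
  show "integrable lebesgue (datum_deriv 0 bs)" if "set bs \<subseteq> Basis" "length bs \<le> 2"
    by (rule dominated_limit_integrable(1)[OF * g lim dom that])
qed

end

end

section \<open>Traces in time and the slab estimate\<close>

text \<open>Extension by zero outside \<open>S\<close> allows all integrals to be taken over the whole
  space.\<close>

definition int_on :: "'e::euclidean_space set \<Rightarrow> ('e \<Rightarrow> real) \<Rightarrow> bool" where
  "int_on S h \<longleftrightarrow> integrable lebesgue h \<and> (\<forall>x. x \<notin> S \<longrightarrow> h x = 0)"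

lemma int_on_add: "int_on S g \<Longrightarrow> int_on S h \<Longrightarrow> int_on S (\<lambda>x. g x + h x)"
  by (auto simp: int_on_def)

lemma int_on_sum: "(\<And>i. i \<in> I \<Longrightarrow> int_on S (g i)) \<Longrightarrow> int_on S (\<lambda>x. \<Sum>i\<in>I. g i x)"
  by (auto simp: int_on_def intro: Bochner_Integration.integrable_sum)

lemma int_on_minus: "int_on S g \<Longrightarrow> int_on S h \<Longrightarrow> int_on S (\<lambda>x. g x - h x)"
  by (auto simp: int_on_def)

lemma int_on_mult:
  assumes S: "open S" and a: "continuous_on S a" and C: "\<And>x. x \<in> S \<Longrightarrow> \<bar>a x\<bar> \<le> C" and h: "int_on S h"
  shows "int_on S (\<lambda>x. a x * h x)"
proof -
  have m: "(\<lambda>x. if x \<in> S then a x else 0) \<in> borel_measurable lebesgue"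
    by (intro borel_measurable_if_I continuous_imp_measurable_on_sets_lebesgue a open_sets_lebesgue S)
  have "integrable lebesgue (\<lambda>x. h x * (if x \<in> S then a x else 0))"
    by (rule integrable_mult_bounded[of _ _ _ "\<bar>C\<bar>", OF _ m]) (use h C in \<open>force simp: int_on_def\<close>)+
  also have "(\<lambda>x. h x * (if x \<in> S then a x else 0)) = (\<lambda>x. a x * h x)"
    using h by (auto simp: int_on_def)
  finally show ?thesis using h by (auto simp: int_on_def)
qed

lemma has_weak_deriv_L2_rep:
  assumes S: "open S" "bounded S" and bs: "set bs \<subseteq> Basis"
    and g: "\<exists>g\<in>L2 S. has_weak_deriv S bs u g"
  obtains h where "int_on S h" "has_weak_deriv S bs u h"
proof -
  obtain g where g: "g \<in> L2 S" "has_weak_deriv S bs u g" using g by blast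
  note SL = open_sets_lebesgue[OF S(1)]
  have SF: "S \<in> lmeasurable" by (rule lmeasurable_open[OF S(2,1)])
  then have fin: "finite_measure (lebesgue_on S)" by (rule finite_measure_lebesgue_on)
  have "integrable (lebesgue_on S) g"
  proof (rule Bochner_Integration.integrable_bound[of _ "\<lambda>x. 1 + (g x)\<^sup>2"])
    show "integrable (lebesgue_on S) (\<lambda>x. 1 + (g x)\<^sup>2)"
      using g(1) finite_measure.integrable_const[OF fin]
      by (intro Bochner_Integration.integrable_add) (auto simp: L2_def)
    show "g \<in> borel_measurable (lebesgue_on S)" using g(1) by (simp add: L2_def)
    show "AE x in lebesgue_on S. norm (g x) \<le> norm (1 + (g x)\<^sup>2)"
    proof (rule AE_I2)
      fix x
      have "2 * \<bar>g x\<bar> \<le> 1 + (g x)\<^sup>2" using sum_power2_ge_zero[of "\<bar>g x\<bar> - 1" 0] by (simp add: power2_diff)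
      then show "norm (g x) \<le> norm (1 + (g x)\<^sup>2)" by simp
    qed
  qed
  then have int: "integrable lebesgue (\<lambda>x. indicator S x * g x)"
    using SL by (subst (asm) integrable_restrict_space) auto
  show thesis
  proof (rule that)
    show "int_on S (\<lambda>x. indicator S x * g x)" using int by (simp add: int_on_def)
    have "(LINT x|lebesgue. (indicator S x * g x) * \<phi> x) = (LINT x|lebesgue. g x * \<phi> x)" if "\<phi> \<in> test_functions S" for \<phi>
      using test_outside[OF that] by (intro Bochner_Integration.integral_cong) (auto simp: indicator_def)
    then show "has_weak_deriv S bs u (\<lambda>x. indicator S x * g x)"
      using g(2) integrable_imp_L1_loc[OF int] unfolding has_weak_deriv_iff[OF S(1) bs] by simp
  qed
qed

lemma has_weak_deriv_add:
  assumes S: "open S" and bs: "set bs \<subseteq> Basis"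
    and w: "has_weak_deriv S bs u g" "has_weak_deriv S bs v h"
  shows "has_weak_deriv S bs (\<lambda>x. u x + v x) (\<lambda>x. g x + h x)"
proof -
  note W = w[unfolded has_weak_deriv_iff[OF S bs]]
  have i: "(LINT x|lebesgue. (f x + k x) * \<phi> x) = (LINT x|lebesgue. f x * \<phi> x) + (LINT x|lebesgue. k x * \<phi> x)"
    if "f \<in> L1_loc S" "k \<in> L1_loc S" "\<phi> \<in> test_functions S" for f k \<phi>
    using Bochner_Integration.integral_add[OF L1_loc_test_integrable[OF that(1,3)] L1_loc_test_integrable[OF that(2,3)]]
    by (simp add: algebra_simps)
  show ?thesis unfolding has_weak_deriv_iff[OF S bs]
  proof (intro conjI ballI)
    show "(\<lambda>x. u x + v x) \<in> L1_loc S" "(\<lambda>x. g x + h x) \<in> L1_loc S" using W L1_loc_add by blast+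
    fix \<phi> :: "'a \<Rightarrow> real" assume \<phi>: "\<phi> \<in> test_functions S"
    show "(LINT x|lebesgue. (u x + v x) * iter_deriv bs \<phi> x) = (- 1) ^ length bs * (LINT x|lebesgue. (g x + h x) * \<phi> x)"
      using W i[of u v "iter_deriv bs \<phi>"] i[of g h \<phi>] \<phi> test_iter_deriv[OF \<phi> bs] by (simp add: distrib_left)
  qed
qed

lemma has_weak_deriv_zero: "has_weak_deriv S bs (\<lambda>_. 0) (\<lambda>_. 0)"
  by (simp add: has_weak_deriv_def L1_loc_def set_integrable_def)

lemma has_weak_deriv_sum:
  assumes S: "open S" and bs: "set bs \<subseteq> Basis" and I: "finite I"
    and w: "\<And>i. i \<in> I \<Longrightarrow> has_weak_deriv S bs (u i) (g i)"
  shows "has_weak_deriv S bs (\<lambda>x. \<Sum>i\<in>I. u i x) (\<lambda>x. \<Sum>i\<in>I. g i x)"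
  using I w by (induction) (auto intro: has_weak_deriv_zero has_weak_deriv_add[OF S bs])

lemma int_on_test:
  assumes "int_on S h" "\<And>x. \<bar>\<phi> x\<bar> \<le> C" "\<phi> \<in> borel_measurable borel"
  shows "integrable lebesgue (\<lambda>x. h x * \<phi> x)"
proof (rule integrable_mult_bounded)
  show "integrable lebesgue h" using assms(1) by (simp add: int_on_def)
  show "\<phi> \<in> borel_measurable lebesgue" by (rule measurable_completion) (simp add: assms(3))
qed (rule assms(2))

lemma borel_fst_comp: "\<phi> \<in> borel_measurable borel \<Longrightarrow> (\<lambda>p :: 'a::euclidean_space \<times> real. \<phi> (fst p)) \<in> borel_measurable borel"
  by (rule measurable_compose[of fst borel borel]) (auto simp: borel_measurable_continuous_onI continuous_on_fst continuous_on_id)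

text \<open>This is where global integrability on the cylinder, and not only local integrability, is used: the
  supports of the cutoffs exhaust the time interval.\<close>

lemma time_cutoff_limit:
  fixes h :: "'a::euclidean_space \<times> real \<Rightarrow> real"
  assumes h: "int_on (cylinder \<Omega> T) h" and \<phi>: "\<phi> \<in> test_functions S"
    and \<eta>: "\<And>n. \<eta> n \<in> test_functions {0<..<T}" "\<And>n t. 0 \<le> \<eta> n t" "\<And>n t. \<eta> n t \<le> 1"
    and lim: "\<And>t. t \<in> {0<..<T} \<Longrightarrow> (\<lambda>n. \<eta> n t) \<longlonglongrightarrow> 1"
  shows "(\<lambda>n. LINT p|lebesgue. h p * (\<phi> \<otimes> \<eta> n) p) \<longlonglongrightarrow> (LINT p|lebesgue. h p * \<phi> (fst p))"
proof -
  obtain C where C: "C > 0" "\<And>x. \<bar>\<phi> x\<bar> \<le> C" using test_bounded[OF \<phi>] by metis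
  have hm: "h \<in> borel_measurable lebesgue" using h by (auto simp: int_on_def)
  have fm: "(\<lambda>p :: 'a \<times> real. \<phi> (fst p)) \<in> borel_measurable lebesgue"
    using borel_fst_comp[OF test_borel[OF \<phi>]] by (intro measurable_completion) simp
  have tm: "\<phi> \<otimes> \<eta> n \<in> borel_measurable lebesgue" for n
    by (rule test_lebesgue[OF tensor_test[OF \<phi> \<eta>(1)]])
  show ?thesis
  proof (rule integral_dominated_convergence[where w = "\<lambda>p. C * \<bar>h p\<bar>"])
    show "integrable lebesgue (\<lambda>p. C * \<bar>h p\<bar>)" using h by (simp add: int_on_def)
    show "AE p in lebesgue. (\<lambda>n. h p * (\<phi> \<otimes> \<eta> n) p) \<longlonglongrightarrow> h p * \<phi> (fst p)"
    proof (rule AE_I2)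
      fix p :: "'a \<times> real"
      show "(\<lambda>n. h p * (\<phi> \<otimes> \<eta> n) p) \<longlonglongrightarrow> h p * \<phi> (fst p)"
      proof (cases "p \<in> cylinder \<Omega> T")
        case True
        then have "(\<lambda>n. \<eta> n (snd p)) \<longlonglongrightarrow> 1" by (intro lim) auto
        then have "(\<lambda>n. h p * (\<phi> (fst p) * \<eta> n (snd p))) \<longlonglongrightarrow> h p * (\<phi> (fst p) * 1)" by (intro tendsto_intros)
        then show ?thesis by (simp add: tensor_def)
      next
        case False
        then have "h p = 0" using h unfolding int_on_def by blast
        then show ?thesis by simp
      qed
    qed
    show "AE p in lebesgue. norm (h p * (\<phi> \<otimes> \<eta> n) p) \<le> C * \<bar>h p\<bar>" for n
    proof (rule AE_I2)
      fix p :: "'a \<times> real"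
      have "\<bar>\<phi> (fst p)\<bar> * \<bar>\<eta> n (snd p)\<bar> \<le> C * 1"
        using C \<eta>(2,3)[of n "snd p"] by (intro mult_mono) auto
      from mult_left_mono[OF this abs_ge_zero[of "h p"]]
      show "norm (h p * (\<phi> \<otimes> \<eta> n) p) \<le> C * \<bar>h p\<bar>" by (simp add: tensor_def abs_mult mult.commute)
    qed
  qed (use hm fm tm in auto)
qed

text \<open>The inequality \<open>\<bar>d\<bar> \<le> \<kappa> + d\<^sup>2 / \<kappa>\<close> for all
  \<open>\<kappa> > 0\<close> converts convergence in \<open>L\<^sup>2\<close> on a bounded set into
  convergence of the pairings.\<close>

lemma L2_continuous_pairing:
  fixes y :: "'a::euclidean_space \<times> real \<Rightarrow> real"
  assumes \<Omega>: "open \<Omega>" "bounded \<Omega>" and y: "\<And>t. t \<in> X \<Longrightarrow> (\<lambda>x. y (x, t)) \<in> L2 \<Omega>"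
    and cont: "\<And>t. t \<in> X \<Longrightarrow> ((\<lambda>s. LINT x|lebesgue_on \<Omega>. (y (x, s) - y (x, t))\<^sup>2) \<longlongrightarrow> 0) (at t within X)"
    and \<xi>: "\<xi> \<in> test_functions \<Omega>"
  shows "continuous_on X (\<lambda>t. LINT x|lebesgue. y (x, t) * \<xi> x)"
  unfolding continuous_on_def
proof
  fix t assume t: "t \<in> X"
  obtain C where C: "C > 0" "\<And>x. \<bar>\<xi> x\<bar> \<le> C" using test_bounded[OF \<xi>] by metis
  note \<Omega>L = open_sets_lebesgue[OF \<Omega>(1)]
  have fin: "finite_measure (lebesgue_on \<Omega>)" by (rule finite_measure_lebesgue_on[OF lmeasurable_open[OF \<Omega>(2,1)]])
  define V where "V = measure (lebesgue_on \<Omega>) \<Omega>"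
  have V0: "V \<ge> 0" by (simp add: V_def)
  have eq: "(LINT x|lebesgue. y (x, t) * \<xi> x) = (LINT x|lebesgue_on \<Omega>. y (x, t) * \<xi> x)" for t
    by (rule LINT_lebesgue_on_test[symmetric, OF \<Omega>L test_outside[OF \<xi>]])
  have \<xi>m: "\<xi> \<in> borel_measurable (lebesgue_on \<Omega>)" by (rule measurable_restrict_space1[OF test_lebesgue[OF \<xi>]])
  have ym: "(\<lambda>x. y (x, s)) \<in> borel_measurable (lebesgue_on \<Omega>)" "integrable (lebesgue_on \<Omega>) (\<lambda>x. (y (x, s))\<^sup>2)" if "s \<in> X" for s
    using y[OF that] by (auto simp: L2_def)
  have young: "\<bar>d\<bar> \<le> \<kappa> + d\<^sup>2 / \<kappa>" if "\<kappa> > 0" for d \<kappa> :: real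
  proof -
    have "0 \<le> (\<bar>d\<bar> - \<kappa>)\<^sup>2 + \<bar>d\<bar> * \<kappa>" using that by simp
    then have "\<bar>d\<bar> * \<kappa> \<le> \<kappa>\<^sup>2 + d\<^sup>2" by (simp add: power2_diff mult.commute)
    then show ?thesis using that by (simp add: field_simps power2_eq_square)
  qed
  have i1: "integrable (lebesgue_on \<Omega>) (\<lambda>x. y (x, s))" if s: "s \<in> X" for s
  proof (rule Bochner_Integration.integrable_bound[of _ "\<lambda>x. 1 + (y (x, s))\<^sup>2"])
    show "integrable (lebesgue_on \<Omega>) (\<lambda>x. 1 + (y (x, s))\<^sup>2)"
      using ym[OF s] finite_measure.integrable_const[OF fin] by (intro Bochner_Integration.integrable_add) auto
    show "AE x in lebesgue_on \<Omega>. norm (y (x, s)) \<le> norm (1 + (y (x, s))\<^sup>2)"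
      using young[of 1] by (intro AE_I2) simp
  qed (rule ym(1)[OF s])
  have i2: "integrable (lebesgue_on \<Omega>) (\<lambda>x. (y (x, s) - y (x, t))\<^sup>2)" if s: "s \<in> X" for s
  proof (rule Bochner_Integration.integrable_bound[of _ "\<lambda>x. 2 * (y (x, s))\<^sup>2 + 2 * (y (x, t))\<^sup>2"])
    show "integrable (lebesgue_on \<Omega>) (\<lambda>x. 2 * (y (x, s))\<^sup>2 + 2 * (y (x, t))\<^sup>2)" using ym[OF s] ym[OF t] by auto
    show "(\<lambda>x. (y (x, s) - y (x, t))\<^sup>2) \<in> borel_measurable (lebesgue_on \<Omega>)" using ym(1)[OF s] ym(1)[OF t] by simp
    have "(a - b)\<^sup>2 \<le> 2 * a\<^sup>2 + 2 * b\<^sup>2" for a b :: real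
      using zero_le_power2[of "a + b"] by (simp add: power2_diff power2_sum)
    then show "AE x in lebesgue_on \<Omega>. norm ((y (x, s) - y (x, t))\<^sup>2) \<le> norm (2 * (y (x, s))\<^sup>2 + 2 * (y (x, t))\<^sup>2)"
      by (intro AE_I2) simp
  qed
  \<comment> \<open>Both terms in the bound are small if first \<open>\<kappa>\<close> is chosen small and then \<open>s\<close> is close to \<open>t\<close>.\<close>
  have bound: "\<bar>(LINT x|lebesgue. y (x, s) * \<xi> x) - (LINT x|lebesgue. y (x, t) * \<xi> x)\<bar>
      \<le> C * (\<kappa> * V + (LINT x|lebesgue_on \<Omega>. (y (x, s) - y (x, t))\<^sup>2) / \<kappa>)" if s: "s \<in> X" and \<kappa>: "\<kappa> > 0" for s \<kappa>
  proof -
    have m: "integrable (lebesgue_on \<Omega>) (\<lambda>x. y (x, s) * \<xi> x)" "integrable (lebesgue_on \<Omega>) (\<lambda>x. y (x, t) * \<xi> x)"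
      by (rule integrable_mult_bounded[OF i1[OF s] \<xi>m C(2)], rule integrable_mult_bounded[OF i1[OF t] \<xi>m C(2)])
    have c1: "integrable (lebesgue_on \<Omega>) (\<lambda>x. \<kappa>)" by (rule finite_measure.integrable_const[OF fin])
    have c2: "integrable (lebesgue_on \<Omega>) (\<lambda>x. (y (x, s) - y (x, t))\<^sup>2 / \<kappa>)" using i2[OF s] by simp
    have "(LINT x|lebesgue. y (x, s) * \<xi> x) - (LINT x|lebesgue. y (x, t) * \<xi> x)
       = (LINT x|lebesgue_on \<Omega>. y (x, s) * \<xi> x - y (x, t) * \<xi> x)"
      unfolding eq by (rule Bochner_Integration.integral_diff[symmetric, OF m])
    also have "\<bar>\<dots>\<bar> \<le> (LINT x|lebesgue_on \<Omega>. C * (\<kappa> + (y (x, s) - y (x, t))\<^sup>2 / \<kappa>))"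
    proof (rule integral_abs_bound_integral)
      show "integrable (lebesgue_on \<Omega>) (\<lambda>x. y (x, s) * \<xi> x - y (x, t) * \<xi> x)" using m by simp
      show "integrable (lebesgue_on \<Omega>) (\<lambda>x. C * (\<kappa> + (y (x, s) - y (x, t))\<^sup>2 / \<kappa>))"
        using Bochner_Integration.integrable_add[OF c1 c2] by simp
      fix x
      have "\<bar>y (x, s) * \<xi> x - y (x, t) * \<xi> x\<bar> = \<bar>\<xi> x\<bar> * \<bar>y (x, s) - y (x, t)\<bar>"
        by (simp add: abs_mult[symmetric] algebra_simps)
      also have "\<dots> \<le> C * (\<kappa> + (y (x, s) - y (x, t))\<^sup>2 / \<kappa>)"
        using C young[OF \<kappa>] by (intro mult_mono) auto
      finally show "\<bar>y (x, s) * \<xi> x - y (x, t) * \<xi> x\<bar> \<le> C * (\<kappa> + (y (x, s) - y (x, t))\<^sup>2 / \<kappa>)" .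
    qed
    also have "\<dots> = C * (\<kappa> * V + (LINT x|lebesgue_on \<Omega>. (y (x, s) - y (x, t))\<^sup>2) / \<kappa>)"
      using Bochner_Integration.integral_add[OF c1 c2] by (simp add: V_def mult.commute)
    finally show ?thesis .
  qed
  show "((\<lambda>t. LINT x|lebesgue. y (x, t) * \<xi> x) \<longlongrightarrow> (LINT x|lebesgue. y (x, t) * \<xi> x)) (at t within X)"
  proof (rule tendstoI)
    fix \<epsilon> :: real assume \<epsilon>: "\<epsilon> > 0"
    define \<kappa> where "\<kappa> = \<epsilon> / (2 * C * (V + 1))"
    have \<kappa>: "\<kappa> > 0" using \<epsilon> C V0 by (simp add: \<kappa>_def)
    have "C * (\<kappa> * V) \<le> C * (\<kappa> * (V + 1))" using C \<kappa> by simp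
    also have "\<dots> = \<epsilon> / 2"
    proof -
      have "C * (\<epsilon> / (2 * C * v) * v) = \<epsilon> / 2" if "v > 0" for v using C(1) that by (simp add: field_simps)
      from this[of "V + 1"] show ?thesis unfolding \<kappa>_def using V0 by linarith
    qed
    finally have k1: "C * (\<kappa> * V) \<le> \<epsilon> / 2" .
    have "eventually (\<lambda>s. (LINT x|lebesgue_on \<Omega>. (y (x, s) - y (x, t))\<^sup>2) < \<epsilon> * \<kappa> / (2 * C)) (at t within X)"
      using order_tendstoD(2)[OF cont[OF t]] \<epsilon> \<kappa> C by simp
    moreover have "eventually (\<lambda>s. s \<in> X) (at t within X)" by (simp add: eventually_at_filter)
    ultimately show "eventually (\<lambda>s. dist (LINT x|lebesgue. y (x, s) * \<xi> x) (LINT x|lebesgue. y (x, t) * \<xi> x) < \<epsilon>) (at t within X)"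
    proof eventually_elim
      case (elim s)
      then have "C * ((LINT x|lebesgue_on \<Omega>. (y (x, s) - y (x, t))\<^sup>2) / \<kappa>) < \<epsilon> / 2"
        using C \<kappa> by (simp add: field_simps)
      then show ?case using bound[OF elim(2) \<kappa>, unfolded distrib_left] k1 unfolding dist_real_def by linarith
    qed
  qed
qed

text \<open>With \<open>\<xi> = \<phi>\<close> the hypothesis on \<open>h\<close> says that \<open>h\<close>
  is the weak time derivative of \<open>y\<close>; with \<open>\<xi>\<close> a second derivative of
  \<open>\<phi>\<close>, that \<open>h\<close> is the time derivative of the corresponding second derivative
  of \<open>y\<close>. Cutoffs in time that tend to one leave the values at the two end points.\<close>

lemma trace_pairing:
  fixes y h :: "'a::euclidean_space \<times> real \<Rightarrow> real"
  assumes \<Omega>: "open \<Omega>" "bounded \<Omega>" and T: "T > 0"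
    and h: "int_on (cylinder \<Omega> T) h"
    and yL: "y \<in> L1_loc (cylinder \<Omega> T)"
    and y: "\<And>t. t \<in> {0..T} \<Longrightarrow> (\<lambda>x. y (x, t)) \<in> L2 \<Omega>"
    and cont: "\<And>t. t \<in> {0..T} \<Longrightarrow> ((\<lambda>s. LINT x|lebesgue_on \<Omega>. (y (x, s) - y (x, t))\<^sup>2) \<longlongrightarrow> 0) (at t within {0..T})"
    and \<phi>: "\<phi> \<in> test_functions \<Omega>" and \<xi>: "\<xi> \<in> test_functions \<Omega>"
    and eq: "\<And>\<eta>. \<eta> \<in> test_functions {0<..<T} \<Longrightarrow>
      (LINT p|lebesgue. h p * (\<phi> \<otimes> \<eta>) p) = - (LINT p|lebesgue. y p * (\<xi> \<otimes> partial_deriv 1 \<eta>) p)"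
  shows "(LINT p|lebesgue. h p * \<phi> (fst p)) = (LINT x|lebesgue. y (x, T) * \<xi> x) - (LINT x|lebesgue. y (x, 0) * \<xi> x)"
proof -
  obtain \<eta> :: "nat \<Rightarrow> real \<Rightarrow> real" where \<eta>: "\<And>n. \<eta> n \<in> test_functions {0<..<T}" "\<And>n t. 0 \<le> \<eta> n t" "\<And>n t. \<eta> n t \<le> 1"
    "\<And>t. t \<in> {0<..<T} \<Longrightarrow> (\<lambda>n. \<eta> n t) \<longlonglongrightarrow> 1"
    and \<eta>': "\<And>p. continuous_on {0..T} p \<Longrightarrow> (\<lambda>n. LINT t|lebesgue. p t * partial_deriv 1 (\<eta> n) t) \<longlonglongrightarrow> p 0 - p T"
    by (rule time_cutoffs[OF T]) (rule that; assumption)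
  define p where "p t = (LINT x|lebesgue. y (x, t) * \<xi> x)" for t
  have p: "continuous_on {0..T} p"
    unfolding p_def[abs_def] by (rule L2_continuous_pairing[OF \<Omega> y cont \<xi>])
  have F: "(LINT q|lebesgue. y q * (\<xi> \<otimes> partial_deriv 1 (\<eta> n)) q) = (LINT t|lebesgue. p t * partial_deriv 1 (\<eta> n) t)" for n
  proof -
    have d: "partial_deriv 1 (\<eta> n) \<in> test_functions {0<..<T}" using test_partial_deriv[OF \<eta>(1)] by simp
    have "(LINT q|lebesgue. y q * (\<xi> \<otimes> partial_deriv 1 (\<eta> n)) q)
       = (LINT t|lebesgue. LINT x|lebesgue. y (x, t) * (\<xi> \<otimes> partial_deriv 1 (\<eta> n)) (x, t))"
      by (rule lebesgue_Fubini_snd[OF L1_loc_test_integrable[OF yL tensor_test[OF \<xi> d]]])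
    also have "\<dots> = (LINT t|lebesgue. p t * partial_deriv 1 (\<eta> n) t)"
      unfolding p_def tensor_def by (simp add: mult.assoc[symmetric])
    finally show ?thesis .
  qed
  have "(\<lambda>n. LINT p|lebesgue. h p * (\<phi> \<otimes> \<eta> n) p) \<longlonglongrightarrow> (LINT p|lebesgue. h p * \<phi> (fst p))"
    by (rule time_cutoff_limit[OF h \<phi> \<eta>])
  moreover have "(\<lambda>n. LINT p|lebesgue. h p * (\<phi> \<otimes> \<eta> n) p) \<longlonglongrightarrow> - (p 0 - p T)"
    unfolding eq[OF \<eta>(1)] F by (intro tendsto_minus \<eta>' p)
  ultimately have "(LINT p|lebesgue. h p * \<phi> (fst p)) = - (p 0 - p T)" by (rule LIMSEQ_unique)
  then show ?thesis by (simp add: p_def)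
qed

text \<open>Where \<open>\<zeta> = 1\<close> on the support of \<open>\<phi>\<close>, the antiderivative
  \<open>\<Phi>\<close> of \<open>\<phi>\<close> satisfies \<open>\<phi> = \<partial>\<^sub>c(\<Phi> \<zeta>)
  - \<Phi> \<partial>\<^sub>c \<zeta>\<close>. Integration by parts against \<open>K\<close> costs one
  derivative of \<open>K\<close> and leaves only factors \<open>\<Phi>\<close>, which are bounded by
  \<open>2\<delta>\<close>. The constant does not depend on \<open>\<phi>\<close>, so that
  \<open>\<phi>\<close> may later approximate an indicator function.\<close>

lemma slab_estimate:
  fixes K M :: "'a::euclidean_space \<times> real \<Rightarrow> real"
  assumes \<Omega>: "open \<Omega>" "bounded \<Omega>" and T: "T > 0" and c: "c \<in> Basis"
    and K: "int_on (cylinder \<Omega> T) K" and M: "int_on (cylinder \<Omega> T) M"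
    and w: "has_weak_deriv (cylinder \<Omega> T) [dir_x c] K M"
    and \<zeta>: "\<zeta> \<in> test_functions \<Omega>"
  obtains C where "\<And>\<phi> \<delta>. \<lbrakk>\<phi> \<in> test_functions \<Omega>; \<And>x. \<bar>\<phi> x\<bar> \<le> 1; \<And>x. \<phi> x \<noteq> 0 \<Longrightarrow> \<zeta> x = 1; \<delta> > 0;
      \<And>x. \<bar>x \<bullet> c - s0\<bar> > \<delta> \<Longrightarrow> \<phi> x = 0\<rbrakk> \<Longrightarrow> \<bar>LINT p|lebesgue. K p * \<phi> (fst p)\<bar> \<le> C * \<delta>"
proof -
  let ?Q = "cylinder \<Omega> T"
  have Q: "open ?Q" using \<Omega> by (intro open_Times) auto
  note dc = Basis_space[OF c]
  note W = w[unfolded has_weak_deriv_iff[OF Q, of "[dir_x c]", simplified, OF dc]]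
  obtain R where R: "\<And>x. x \<in> \<Omega> \<Longrightarrow> norm x \<le> R" using \<Omega>(2) by (auto simp: bounded_iff)
  obtain C0 where C0: "C0 > 0" "\<And>x. \<bar>\<zeta> x\<bar> \<le> C0" using test_bounded[OF \<zeta>] by metis
  obtain C1 where C1: "C1 > 0" "\<And>x. \<bar>partial_deriv c \<zeta> x\<bar> \<le> C1"
    using test_bounded[OF test_partial_deriv[OF \<zeta> c]] by metis
  \<comment> \<open>Translation by \<open>- B c\<close> moves every point of \<open>\<Omega>\<close> out of \<open>\<Omega>\<close>, which removes the second term in the derivative of the antiderivative.\<close>
  define B where "B = \<bar>2 * R\<bar> + 1"
  define C where "C = 2 * (C0 * (LINT p|lebesgue. \<bar>M p\<bar>) + C1 * (LINT p|lebesgue. \<bar>K p\<bar>))"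
  obtain \<eta> :: "nat \<Rightarrow> real \<Rightarrow> real" where \<eta>: "\<And>n. \<eta> n \<in> test_functions {0<..<T}" "\<And>n t. 0 \<le> \<eta> n t" "\<And>n t. \<eta> n t \<le> 1"
    "\<And>t. t \<in> {0<..<T} \<Longrightarrow> (\<lambda>n. \<eta> n t) \<longlonglongrightarrow> 1"
    by (rule time_cutoffs[OF T]) (rule that; assumption)
  show thesis
  proof (rule that[of C])
    fix \<phi> :: "'a \<Rightarrow> real" and \<delta> :: real
    assume \<phi>: "\<phi> \<in> test_functions \<Omega>" "\<And>x. \<bar>\<phi> x\<bar> \<le> 1" "\<And>x. \<phi> x \<noteq> 0 \<Longrightarrow> \<zeta> x = 1"
      and \<delta>: "\<delta> > 0" and slab: "\<And>x. \<bar>x \<bullet> c - s0\<bar> > \<delta> \<Longrightarrow> \<phi> x = 0"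
    define \<Phi> where "\<Phi> = ray_integral c B \<phi>"
    note \<phi>C = test_Cinf[OF \<phi>(1)]
    have \<Phi>C: "\<Phi> \<in> Cinf_on UNIV" unfolding \<Phi>_def by (rule Cinf_on_ray_integral[OF \<phi>C])
    have \<Phi>\<Omega>: "\<Phi> \<in> Cinf_on \<Omega>" by (rule Cinf_on_subset[OF open_UNIV \<Omega>(1) _ \<Phi>C]) simp
    have \<Phi>b: "\<bar>\<Phi> x\<bar> \<le> 2 * \<delta>" for x unfolding \<Phi>_def by (rule ray_integral_bound[OF \<phi>C c \<delta> \<phi>(2) slab])
    have t1: "(\<lambda>x. \<Phi> x * \<zeta> x) \<in> test_functions \<Omega>" by (rule test_mult[OF \<Omega>(1) \<Phi>\<Omega> \<zeta>])
    have t2: "(\<lambda>x. \<Phi> x * partial_deriv c \<zeta> x) \<in> test_functions \<Omega>"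
      by (rule test_mult[OF \<Omega>(1) \<Phi>\<Omega> test_partial_deriv[OF \<zeta> c]])
    have d: "partial_deriv c (\<lambda>x. \<Phi> x * \<zeta> x) x = \<phi> x + \<Phi> x * partial_deriv c \<zeta> x" for x
    proof -
      have "partial_deriv c (\<lambda>x. \<Phi> x * \<zeta> x) x = partial_deriv c \<Phi> x * \<zeta> x + \<Phi> x * partial_deriv c \<zeta> x"
        by (rule partial_deriv_mult) (auto intro!: Cinf_on_differentiable[OF open_UNIV] \<Phi>C test_Cinf[OF \<zeta>])
      also have "partial_deriv c \<Phi> x = \<phi> x - \<phi> (x - B *\<^sub>R c)"
        unfolding \<Phi>_def by (rule partial_deriv_ray_integral[OF \<phi>C c]) (simp add: B_def)
      also have "(\<phi> x - \<phi> (x - B *\<^sub>R c)) * \<zeta> x = \<phi> x"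
      proof (cases "x \<in> \<Omega>")
        case True
        have "B = norm (B *\<^sub>R c)" using c by (simp add: B_def)
        also have "\<dots> \<le> norm x + norm (x - B *\<^sub>R c)" using norm_triangle_ineq4[of x "x - B *\<^sub>R c"] by simp
        finally have "x - B *\<^sub>R c \<notin> \<Omega>" using R[OF True] R[of "x - B *\<^sub>R c"] by (auto simp: B_def)
        then have "\<phi> (x - B *\<^sub>R c) = 0" by (rule test_outside[OF \<phi>(1)])
        then show ?thesis using \<phi>(3)[of x] by (cases "\<phi> x = 0") auto
      next
        case False then show ?thesis using test_outside[OF \<phi>(1)] test_outside[OF \<zeta>] by simp
      qed
      finally show ?thesis .
    qed
    have est: "\<bar>LINT p|lebesgue. K p * (\<phi> \<otimes> \<eta> n) p\<bar> \<le> C * \<delta>" for n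
    proof -
      let ?a = "(\<lambda>x. \<Phi> x * \<zeta> x) \<otimes> \<eta> n" and ?b = "(\<lambda>x. \<Phi> x * partial_deriv c \<zeta> x) \<otimes> \<eta> n"
      have ta: "?a \<in> test_functions ?Q" by (rule tensor_test[OF t1 \<eta>(1)])
      have tb: "?b \<in> test_functions ?Q" by (rule tensor_test[OF t2 \<eta>(1)])
      have KL: "K \<in> L1_loc ?Q" "M \<in> L1_loc ?Q" using W by auto
      have pa: "partial_deriv (dir_x c) ?a p = (\<phi> \<otimes> \<eta> n) p + ?b p" for p
        unfolding partial_deriv_x_tensor[OF test_Cinf[OF t1] test_Cinf[OF \<eta>(1)] c]
        by (simp add: tensor_def d distrib_right)
      have "(LINT p|lebesgue. K p * (\<phi> \<otimes> \<eta> n) p) = (LINT p|lebesgue. K p * partial_deriv (dir_x c) ?a p - K p * ?b p)"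
        by (intro Bochner_Integration.integral_cong refl) (simp add: pa algebra_simps)
      also have "\<dots> = (LINT p|lebesgue. K p * partial_deriv (dir_x c) ?a p) - (LINT p|lebesgue. K p * ?b p)"
        by (rule Bochner_Integration.integral_diff[OF L1_loc_test_integrable[OF KL(1) test_partial_deriv[OF ta dc]] L1_loc_test_integrable[OF KL(1) tb]])
      also have "(LINT p|lebesgue. K p * partial_deriv (dir_x c) ?a p) = - (LINT p|lebesgue. M p * ?a p)"
        using W ta by auto
      finally have e1: "\<bar>LINT p|lebesgue. K p * (\<phi> \<otimes> \<eta> n) p\<bar> \<le> \<bar>LINT p|lebesgue. M p * ?a p\<bar> + \<bar>LINT p|lebesgue. K p * ?b p\<bar>"
        by linarith
      have bnd: "\<bar>LINT p|lebesgue. N p * ((\<lambda>x. \<Phi> x * z x) \<otimes> \<eta> n) p\<bar> \<le> 2 * \<delta> * D * (LINT p|lebesgue. \<bar>N p\<bar>)"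
        if N: "int_on ?Q N" and z: "\<And>x. \<bar>z x\<bar> \<le> D" and zt: "(\<lambda>x. \<Phi> x * z x) \<in> test_functions \<Omega>" for N z D
      proof -
        have NL: "N \<in> L1_loc ?Q" using N integrable_imp_L1_loc by (auto simp: int_on_def)
        have "\<bar>LINT p|lebesgue. N p * ((\<lambda>x. \<Phi> x * z x) \<otimes> \<eta> n) p\<bar> \<le> (LINT p|lebesgue. 2 * \<delta> * D * \<bar>N p\<bar>)"
        proof (rule integral_abs_bound_integral)
          show "integrable lebesgue (\<lambda>p. N p * ((\<lambda>x. \<Phi> x * z x) \<otimes> \<eta> n) p)"
            by (rule L1_loc_test_integrable[OF NL tensor_test[OF zt \<eta>(1)]])
          show "integrable lebesgue (\<lambda>p. 2 * \<delta> * D * \<bar>N p\<bar>)" using N by (simp add: int_on_def)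
          fix p :: "'a \<times> real"
          have "\<bar>\<Phi> (fst p)\<bar> * \<bar>z (fst p)\<bar> * \<bar>\<eta> n (snd p)\<bar> \<le> 2 * \<delta> * D * 1"
            using \<Phi>b z \<eta>(2,3)[of n "snd p"] \<delta> order_trans[OF abs_ge_zero z] by (intro mult_mono) auto
          from mult_right_mono[OF this abs_ge_zero[of "N p"]]
          show "\<bar>N p * ((\<lambda>x. \<Phi> x * z x) \<otimes> \<eta> n) p\<bar> \<le> 2 * \<delta> * D * \<bar>N p\<bar>"
            by (simp add: tensor_def abs_mult mult_ac)
        qed
        then show ?thesis by simp
      qed
      show ?thesis using e1 bnd[OF M C0(2) t1] bnd[OF K C1(2) t2] unfolding C_def by (simp add: algebra_simps)
    qed
    have "(\<lambda>n. LINT p|lebesgue. K p * (\<phi> \<otimes> \<eta> n) p) \<longlonglongrightarrow> (LINT p|lebesgue. K p * \<phi> (fst p))"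
      by (rule time_cutoff_limit[OF K \<phi>(1) \<eta>])
    then show "\<bar>LINT p|lebesgue. K p * \<phi> (fst p)\<bar> \<le> C * \<delta>"
      using est by (intro LIMSEQ_le_const2[OF tendsto_rabs]) auto
  qed
qed

section \<open>The two terms of the equation\<close>

lemma partial_deriv_component:
  assumes "f differentiable (at x)"
  shows "partial_deriv b (\<lambda>x. f x \<bullet> c) x = partial_deriv b f x \<bullet> c"
proof -
  obtain F where F: "(f has_derivative F) (at x)" using assms by (auto simp: differentiable_def)
  have "((\<lambda>x. f x \<bullet> c) has_derivative (\<lambda>h. F h \<bullet> c)) (at x)" by (auto intro!: derivative_eq_intros F)
  then show ?thesis using F by (simp add: partial_derivI)
qed

lemma iter_deriv_component:
  assumes S: "open S" and f: "f \<in> Cinf_on S" and x: "x \<in> S" and bs: "set bs \<subseteq> Basis"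
  shows "iter_deriv bs (\<lambda>x. f x \<bullet> c) x = iter_deriv bs f x \<bullet> c"
  using x bs
proof (induction bs arbitrary: x)
  case (Cons b bs)
  have "iter_deriv (b # bs) (\<lambda>x. f x \<bullet> c) x = partial_deriv b (\<lambda>x. iter_deriv bs f x \<bullet> c) x"
    unfolding iter_deriv_Cons
  proof (rule partial_deriv_cong[OF S Cons.prems(1)])
    show "iter_deriv bs (\<lambda>x. f x \<bullet> c) z = iter_deriv bs f z \<bullet> c" if "z \<in> S" for z
      using Cons.IH[OF that] Cons.prems(2) by simp
  qed
  also have "\<dots> = partial_deriv b (iter_deriv bs f) x \<bullet> c"
    using Cons.prems by (intro partial_deriv_component Cinf_on_differentiable[OF S Cinf_on_iter_deriv[OF S f]]) auto
  finally show ?case by simp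
qed simp

lemma Cinf_closure_bounded:
  assumes S: "open S" "bounded S" and f: "f \<in> Cinf_closure S" and bs: "set bs \<subseteq> Basis"
  obtains C where "\<And>x. x \<in> S \<Longrightarrow> \<bar>iter_deriv bs (\<lambda>x. f x \<bullet> c) x\<bar> \<le> C"
proof -
  have fS: "f \<in> Cinf_on S" using f by (simp add: Cinf_closure_def)
  obtain g where g: "continuous_on (closure S) g" "\<And>x. x \<in> S \<Longrightarrow> g x = iter_deriv bs f x"
    using f bs unfolding Cinf_closure_def by blast
  have "compact (closure S)" using S(2) by simp
  then have "bounded (g ` closure S)" using compact_continuous_image[OF g(1)] compact_imp_bounded by blast
  then obtain B where B: "\<And>x. x \<in> closure S \<Longrightarrow> norm (g x) \<le> B" unfolding bounded_iff by auto
  show thesis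
  proof (rule that[of "B * norm c"])
    fix x assume x: "x \<in> S"
    have "\<bar>iter_deriv bs (\<lambda>x. f x \<bullet> c) x\<bar> = \<bar>g x \<bullet> c\<bar>"
      using iter_deriv_component[OF S(1) fS x bs] g(2)[OF x] by simp
    also have "\<dots> \<le> norm (g x) * norm c" by (rule Cauchy_Schwarz_ineq2)
    also have "\<dots> \<le> B * norm c" using B[of x] x closure_subset[of S] by (intro mult_right_mono) auto
    finally show "\<bar>iter_deriv bs (\<lambda>x. f x \<bullet> c) x\<bar> \<le> B * norm c" .
  qed
qed

lemma int_on_mult_Cinf_closure:
  assumes S: "open S" "bounded S" and f: "f \<in> Cinf_closure S" and bs: "set bs \<subseteq> Basis" and h: "int_on S h"
  shows "int_on S (\<lambda>x. iter_deriv bs (\<lambda>x. f x \<bullet> c) x * h x)"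
proof -
  obtain C where C: "\<And>x. x \<in> S \<Longrightarrow> \<bar>iter_deriv bs (\<lambda>x. f x \<bullet> c) x\<bar> \<le> C"
    using Cinf_closure_bounded[OF S f bs] by blast
  have "f \<in> Cinf_on S" using f by (simp add: Cinf_closure_def)
  then have "iter_deriv bs (\<lambda>x. f x \<bullet> c) \<in> Cinf_on S"
    by (intro Cinf_on_iter_deriv[OF S(1) Cinf_on_component[OF S(1)] bs])
  then show ?thesis by (rule int_on_mult[OF S(1) Cinf_on_imp_continuous_on[OF S(1)] C h])
qed

text \<open>The gain of one derivative: \<open>div(A y)\<close> involves first derivatives of
  \<open>y\<close>, and second derivatives of \<open>y\<close> are integrable, so the product rule can be
  applied a second time. Smoothness of \<open>A\<close> up to the boundary bounds the coefficients on the
  whole cylinder.\<close>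

lemma transport_term:
  fixes y :: "'a::euclidean_space \<times> real \<Rightarrow> real" and A :: "'a \<times> real \<Rightarrow> 'a"
  assumes \<Omega>: "open \<Omega>" "bounded \<Omega>" and c: "c \<in> Basis"
    and y: "y \<in> solution_space \<Omega> T" and A: "A \<in> Cinf_closure (cylinder \<Omega> T)"
  obtains K M where "int_on (cylinder \<Omega> T) K" "int_on (cylinder \<Omega> T) M"
    "has_weak_deriv (cylinder \<Omega> T) [dir_x c] K M"
    "AE p in lebesgue. p \<in> cylinder \<Omega> T \<longrightarrow>
      (\<Sum>b\<in>Basis. weak_deriv (cylinder \<Omega> T) [dir_x b] (\<lambda>q. (A q \<bullet> b) * y q) p) = K p"
proof -
  let ?Q = "cylinder \<Omega> T"
  have Q: "open ?Q" "bounded ?Q" using \<Omega> by (auto intro: open_Times bounded_Times)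
  have A': "A \<in> Cinf_on ?Q" using A by (simp add: Cinf_closure_def)
  define a where "a b q = A q \<bullet> b" for b q
  have aC: "a b \<in> Cinf_on ?Q" for b unfolding a_def[abs_def] by (rule Cinf_on_component[OF Q(1) A'])
  have ys: "\<exists>g\<in>L2 ?Q. has_weak_deriv ?Q (map dir_x bs) y g" if "set bs \<subseteq> Basis" "length bs \<le> 2" for bs
    using y that unfolding solution_space_def by blast
  obtain g0 where g0: "int_on ?Q g0" "has_weak_deriv ?Q [] y g0"
    using has_weak_deriv_L2_rep[OF Q _ ys[of "[]", simplified]] by auto
  have "\<exists>g. int_on ?Q g \<and> has_weak_deriv ?Q [dir_x b] y g" if "b \<in> Basis" for b
    using has_weak_deriv_L2_rep[OF Q, of "[dir_x b]" y] ys[of "[b]"] that by auto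
  then obtain gx where gx: "\<And>b. b \<in> Basis \<Longrightarrow> int_on ?Q (gx b)" "\<And>b. b \<in> Basis \<Longrightarrow> has_weak_deriv ?Q [dir_x b] y (gx b)"
    by metis
  have "\<exists>g. int_on ?Q g \<and> has_weak_deriv ?Q [dir_x b, dir_x c] y g" if "b \<in> Basis" for b
    using has_weak_deriv_L2_rep[OF Q, of "[dir_x b, dir_x c]" y] ys[of "[b, c]"] that c by auto
  then obtain gxx where gxx: "\<And>b. b \<in> Basis \<Longrightarrow> int_on ?Q (gxx b)" "\<And>b. b \<in> Basis \<Longrightarrow> has_weak_deriv ?Q [dir_x b, dir_x c] y (gxx b)"
    by metis
  define k where "k b p = a b p * gx b p + partial_deriv (dir_x b) (a b) p * g0 p" for b p
  define m where "m b p = (a b p * gxx b p + partial_deriv (dir_x c) (a b) p * gx b p)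
    + (partial_deriv (dir_x b) (a b) p * gx c p + partial_deriv (dir_x c) (partial_deriv (dir_x b) (a b)) p * g0 p)" for b p
  have ik: "int_on ?Q (k b)" if "b \<in> Basis" for b
    unfolding k_def[abs_def] a_def[abs_def]
    using int_on_mult_Cinf_closure[OF Q A, of "[]"] int_on_mult_Cinf_closure[OF Q A, of "[dir_x b]"] that gx(1)[OF that] g0(1)
    by (auto intro!: int_on_add)
  have im: "int_on ?Q (m b)" if "b \<in> Basis" for b
    unfolding m_def[abs_def] a_def[abs_def]
    using int_on_mult_Cinf_closure[OF Q A, of "[]"] int_on_mult_Cinf_closure[OF Q A, of "[dir_x b]"]
      int_on_mult_Cinf_closure[OF Q A, of "[dir_x c]"] int_on_mult_Cinf_closure[OF Q A, of "[dir_x c, dir_x b]"]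
      that c gx(1)[OF that] gx(1)[OF c] gxx(1)[OF that] g0(1)
    by (auto intro!: int_on_add)
  have wk: "has_weak_deriv ?Q [dir_x c] (k b) (m b)" if b: "b \<in> Basis" for b
  proof -
    note db = Basis_space[OF b] and dc = Basis_space[OF c]
    have 1: "has_weak_deriv ?Q [dir_x c] (gx b) (gxx b)"
      by (rule has_weak_deriv_Cons_trans[OF Q(1) db dc gx(2)[OF b] gxx(2)[OF b]])
    have 2: "has_weak_deriv ?Q [dir_x c] g0 (gx c)"
      by (rule has_weak_deriv_Nil_trans[OF Q(1) dc g0(2) gx(2)[OF c]])
    show ?thesis unfolding k_def[abs_def] m_def[abs_def]
      by (intro has_weak_deriv_add[OF Q(1)] has_weak_deriv_mult_smooth[OF Q(1) dc] 1 2 aC Cinf_on_partial_deriv[OF Q(1) aC db])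
        (use dc in simp)
  qed
  have ae: "AE p in lebesgue. p \<in> ?Q \<longrightarrow> weak_deriv ?Q [dir_x b] (\<lambda>q. (A q \<bullet> b) * y q) p = k b p" if b: "b \<in> Basis" for b
  proof -
    note db = Basis_space[OF b]
    have w: "has_weak_deriv ?Q [dir_x b] (\<lambda>q. a b q * y q) (\<lambda>q. a b q * gx b q + partial_deriv (dir_x b) (a b) q * y q)"
      by (rule has_weak_deriv_mult_smooth[OF Q(1) db gx(2)[OF b] aC])
    have 1: "AE p in lebesgue. p \<in> ?Q \<longrightarrow> weak_deriv ?Q [dir_x b] (\<lambda>q. a b q * y q) p = a b p * gx b p + partial_deriv (dir_x b) (a b) p * y p"
      by (rule has_weak_deriv_unique[OF Q(1) _ weak_deriv_works[OF w] w]) (use db in simp)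
    have "has_weak_deriv ?Q [] y y" using g0(2) by (simp add: has_weak_deriv_def)
    then have 2: "AE p in lebesgue. p \<in> ?Q \<longrightarrow> y p = g0 p"
      by (intro has_weak_deriv_unique[OF Q(1) _ _ g0(2)]) auto
    show ?thesis using 1 2 by eventually_elim (auto simp: k_def a_def)
  qed
  have aeall: "AE p in lebesgue. \<forall>b\<in>Basis. p \<in> ?Q \<longrightarrow> weak_deriv ?Q [dir_x b] (\<lambda>q. (A q \<bullet> b) * y q) p = k b p"
    using ae by (intro AE_finite_allI) auto
  show thesis
  proof (rule that[of "\<lambda>p. \<Sum>b\<in>Basis. k b p" "\<lambda>p. \<Sum>b\<in>Basis. m b p"])
    show "int_on ?Q (\<lambda>p. \<Sum>b\<in>Basis. k b p)" "int_on ?Q (\<lambda>p. \<Sum>b\<in>Basis. m b p)"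
      by (intro int_on_sum ik, assumption) (intro int_on_sum im, assumption)
    show "has_weak_deriv ?Q [dir_x c] (\<lambda>p. \<Sum>b\<in>Basis. k b p) (\<lambda>p. \<Sum>b\<in>Basis. m b p)"
      by (rule has_weak_deriv_sum[OF Q(1) _ finite_Basis wk]) (use c in auto)
    show "AE p in lebesgue. p \<in> ?Q \<longrightarrow> (\<Sum>b\<in>Basis. weak_deriv ?Q [dir_x b] (\<lambda>q. (A q \<bullet> b) * y q) p) = (\<Sum>b\<in>Basis. k b p)"
      using aeall by eventually_elim (auto intro: sum.cong)
  qed
qed

text \<open>Each of \<open>y\<^sub>t\<close> and \<open>\<partial>\<^sub>b\<partial>\<^sub>b y\<^sub>t\<close>
  is integrated over time by \<open>trace_pairing\<close>, the latter after moving the two space derivatives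
  to the test function.\<close>

lemma pseudo_parabolic_term:
  fixes y :: "'a::euclidean_space \<times> real \<Rightarrow> real"
  assumes \<Omega>: "open \<Omega>" "bounded \<Omega>" and T: "T > 0" and y: "y \<in> solution_space \<Omega> T"
  obtains J where "int_on (cylinder \<Omega> T) J"
    "AE p in lebesgue. p \<in> cylinder \<Omega> T \<longrightarrow> weak_deriv (cylinder \<Omega> T) [dir_t] y p
       - (\<Sum>b\<in>Basis. weak_deriv (cylinder \<Omega> T) [dir_t, dir_x b, dir_x b] y p) = J p"
    "\<And>\<phi>. \<phi> \<in> test_functions \<Omega> \<Longrightarrow> (LINT p|lebesgue. J p * \<phi> (fst p)) =
       ((LINT x|lebesgue. y (x, T) * \<phi> x) - (LINT x|lebesgue. y (x, 0) * \<phi> x))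
       - (\<Sum>b\<in>Basis. (LINT x|lebesgue. y (x, T) * iter_deriv [b, b] \<phi> x) - (LINT x|lebesgue. y (x, 0) * iter_deriv [b, b] \<phi> x))"
proof -
  let ?Q = "cylinder \<Omega> T"
  have Q: "open ?Q" "bounded ?Q" using \<Omega> by (auto intro: open_Times bounded_Times)
  have ys: "\<exists>g\<in>L2 ?Q. has_weak_deriv ?Q (dir_t # map dir_x bs) y g" if "set bs \<subseteq> Basis" "length bs \<le> 2" for bs
    using y that unfolding solution_space_def by blast
  obtain gt where gt: "int_on ?Q gt" "has_weak_deriv ?Q [dir_t] y gt"
    using has_weak_deriv_L2_rep[OF Q _ ys[of "[]", simplified]] by auto
  have "\<exists>g. int_on ?Q g \<and> has_weak_deriv ?Q [dir_t, dir_x b, dir_x b] y g" if "b \<in> Basis" for b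
    using has_weak_deriv_L2_rep[OF Q, of "[dir_t, dir_x b, dir_x b]" y] ys[of "[b, b]"] that by auto
  then obtain gb where gb: "\<And>b. b \<in> Basis \<Longrightarrow> int_on ?Q (gb b)" "\<And>b. b \<in> Basis \<Longrightarrow> has_weak_deriv ?Q [dir_t, dir_x b, dir_x b] y (gb b)"
    by metis
  have yL: "y \<in> L1_loc ?Q" using gt(2) by (simp add: has_weak_deriv_def)
  have yt: "(\<lambda>x. y (x, t)) \<in> L2 \<Omega>" if "t \<in> {0..T}" for t
    using y that unfolding solution_space_def Hk_def by blast
  have cont: "((\<lambda>s. LINT x|lebesgue_on \<Omega>. (y (x, s) - y (x, t))\<^sup>2) \<longlongrightarrow> 0) (at t within {0..T})" if "t \<in> {0..T}" for t
    using y that unfolding solution_space_def by blast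
  note trace = trace_pairing[OF \<Omega> T _ yL yt cont]
  have tr_t: "(LINT p|lebesgue. gt p * \<phi> (fst p)) = (LINT x|lebesgue. y (x, T) * \<phi> x) - (LINT x|lebesgue. y (x, 0) * \<phi> x)"
    if \<phi>: "\<phi> \<in> test_functions \<Omega>" for \<phi>
  proof (rule trace[OF gt(1) _ _ \<phi> \<phi>])
    fix \<eta> assume \<eta>: "\<eta> \<in> test_functions {0<..<T}"
    have "(LINT p|lebesgue. y p * iter_deriv [dir_t] (\<phi> \<otimes> \<eta>) p) = - (LINT p|lebesgue. gt p * (\<phi> \<otimes> \<eta>) p)"
      using gt(2) tensor_test[OF \<phi> \<eta>] by (subst (asm) has_weak_deriv_iff[OF Q(1)]) auto
    then show "(LINT p|lebesgue. gt p * (\<phi> \<otimes> \<eta>) p) = - (LINT p|lebesgue. y p * (\<phi> \<otimes> partial_deriv 1 \<eta>) p)"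
      by (simp add: partial_deriv_t_tensor[OF test_Cinf[OF \<phi>] test_Cinf[OF \<eta>]])
  qed
  have tr_b: "(LINT p|lebesgue. gb b p * \<phi> (fst p)) = (LINT x|lebesgue. y (x, T) * iter_deriv [b, b] \<phi> x) - (LINT x|lebesgue. y (x, 0) * iter_deriv [b, b] \<phi> x)"
    if \<phi>: "\<phi> \<in> test_functions \<Omega>" and b: "b \<in> Basis" for \<phi> b
  proof -
    have b\<phi>: "partial_deriv b \<phi> \<in> test_functions \<Omega>" "partial_deriv b (partial_deriv b \<phi>) \<in> test_functions \<Omega>"
      using test_partial_deriv[OF _ b] \<phi> by auto
    have t: "iter_deriv [b, b] \<phi> \<in> test_functions \<Omega>" using b\<phi> by simp
    show ?thesis
    proof (rule trace[OF gb(1)[OF b] _ _ \<phi> t])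
      fix \<eta> assume \<eta>: "\<eta> \<in> test_functions {0<..<T}"
      note \<eta>C = test_Cinf[OF \<eta>]
      have "(LINT p|lebesgue. y p * iter_deriv [dir_t, dir_x b, dir_x b] (\<phi> \<otimes> \<eta>) p) = - (LINT p|lebesgue. gb b p * (\<phi> \<otimes> \<eta>) p)"
        using gb(2)[OF b] tensor_test[OF \<phi> \<eta>] b by (subst (asm) has_weak_deriv_iff[OF Q(1)]) auto
      then show "(LINT p|lebesgue. gb b p * (\<phi> \<otimes> \<eta>) p) = - (LINT p|lebesgue. y p * (iter_deriv [b, b] \<phi> \<otimes> partial_deriv 1 \<eta>) p)"
        using b by (simp add: partial_deriv_x_tensor[OF test_Cinf[OF \<phi>] \<eta>C] partial_deriv_x_tensor[OF test_Cinf[OF b\<phi>(1)] \<eta>C]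
            partial_deriv_t_tensor[OF test_Cinf[OF b\<phi>(2)] \<eta>C])
    qed
  qed
  have ae_t: "AE p in lebesgue. p \<in> ?Q \<longrightarrow> weak_deriv ?Q [dir_t] y p = gt p"
    by (rule has_weak_deriv_unique[OF Q(1) _ weak_deriv_works[OF gt(2)] gt(2)]) simp
  have ae_b: "AE p in lebesgue. \<forall>b\<in>Basis. p \<in> ?Q \<longrightarrow> weak_deriv ?Q [dir_t, dir_x b, dir_x b] y p = gb b p"
  proof (rule AE_finite_allI[OF finite_Basis])
    fix b :: 'a assume b: "b \<in> Basis"
    show "AE p in lebesgue. p \<in> ?Q \<longrightarrow> weak_deriv ?Q [dir_t, dir_x b, dir_x b] y p = gb b p"
      by (rule has_weak_deriv_unique[OF Q(1) _ weak_deriv_works[OF gb(2)[OF b]] gb(2)[OF b]]) (use b in simp)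
  qed
  show thesis
  proof (rule that[of "\<lambda>p. gt p - (\<Sum>b\<in>Basis. gb b p)"])
    show "int_on ?Q (\<lambda>p. gt p - (\<Sum>b\<in>Basis. gb b p))"
      by (intro int_on_minus int_on_sum gt gb)
    show "AE p in lebesgue. p \<in> ?Q \<longrightarrow> weak_deriv ?Q [dir_t] y p
       - (\<Sum>b\<in>Basis. weak_deriv ?Q [dir_t, dir_x b, dir_x b] y p) = gt p - (\<Sum>b\<in>Basis. gb b p)"
      using ae_t ae_b by eventually_elim (auto intro!: sum.cong)
    fix \<phi> :: "'a \<Rightarrow> real" assume \<phi>: "\<phi> \<in> test_functions \<Omega>"
    obtain C where C: "\<And>x. \<bar>\<phi> x\<bar> \<le> C" using test_bounded[OF \<phi>] by metis
    have i: "integrable lebesgue (\<lambda>p. h p * \<phi> (fst p))" if "int_on ?Q h" for h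
      by (rule int_on_test[OF that C borel_fst_comp[OF test_borel[OF \<phi>]]])
    have "(LINT p|lebesgue. (gt p - (\<Sum>b\<in>Basis. gb b p)) * \<phi> (fst p))
       = (LINT p|lebesgue. gt p * \<phi> (fst p) - (\<Sum>b\<in>Basis. gb b p * \<phi> (fst p)))"
      by (simp add: left_diff_distrib sum_distrib_right)
    also have "\<dots> = (LINT p|lebesgue. gt p * \<phi> (fst p)) - (LINT p|lebesgue. (\<Sum>b\<in>Basis. gb b p * \<phi> (fst p)))"
      by (intro Bochner_Integration.integral_diff Bochner_Integration.integrable_sum i gt gb)
    also have "(LINT p|lebesgue. (\<Sum>b\<in>Basis. gb b p * \<phi> (fst p))) = (\<Sum>b\<in>Basis. LINT p|lebesgue. gb b p * \<phi> (fst p))"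
      by (intro Bochner_Integration.integral_sum i gb)
    finally show "(LINT p|lebesgue. (gt p - (\<Sum>b\<in>Basis. gb b p)) * \<phi> (fst p)) =
       ((LINT x|lebesgue. y (x, T) * \<phi> x) - (LINT x|lebesgue. y (x, 0) * \<phi> x))
       - (\<Sum>b\<in>Basis. (LINT x|lebesgue. y (x, T) * iter_deriv [b, b] \<phi> x) - (LINT x|lebesgue. y (x, 0) * iter_deriv [b, b] \<phi> x))"
      using tr_t[OF \<phi>] tr_b[OF \<phi>] by simp
  qed
qed

lemma bounded_limit:
  fixes h :: "'e::euclidean_space \<Rightarrow> real"
  assumes h: "integrable lebesgue h" and g: "\<And>n. g n \<in> borel_measurable lebesgue"
    and b: "\<And>n x. \<bar>g n x\<bar> \<le> 1" and lim: "\<And>x. (\<lambda>n. g n x) \<longlonglongrightarrow> G x"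
  shows "(\<lambda>n. LINT x|lebesgue. h x * g n x) \<longlonglongrightarrow> (LINT x|lebesgue. h x * G x)"
proof (rule integral_dominated_convergence[where w = "\<lambda>x. \<bar>h x\<bar>"])
  have "G \<in> borel_measurable lebesgue" by (rule borel_measurable_LIMSEQ_real[OF lim g])
  then show "(\<lambda>x. h x * G x) \<in> borel_measurable lebesgue" using h by auto
  show "(\<lambda>x. h x * g n x) \<in> borel_measurable lebesgue" for n using h g by auto
  show "AE x in lebesgue. (\<lambda>n. h x * g n x) \<longlonglongrightarrow> h x * G x" by (intro AE_I2 tendsto_intros lim)
  show "AE x in lebesgue. norm (h x * g n x) \<le> \<bar>h x\<bar>" for n
    using b by (intro AE_I2) (simp add: abs_mult mult_left_le)
qed (use h in simp)

text \<open>Where \<open>\<zeta> = 1\<close> only the second derivative in direction \<open>c\<close> survives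
  in the Laplacian. It equals \<open>(7/4 - 7/16) \<bar>w\<bar>\<^bsup>-1/4\<^esup>\<close>, that is
  \<open>21/16 \<bar>w\<bar>\<^bsup>-1/4\<^esup>\<close>, while the datum itself is at most \<open>1 \<le>
  \<delta>\<^bsup>-1/4\<^esup>\<close>; the difference leaves the factor \<open>-5/16\<close>.\<close>

lemma datum_singular:
  fixes c :: "'a::euclidean_space"
  assumes c: "c \<in> Basis" and V: "open V" "\<And>x. x \<in> V \<Longrightarrow> \<zeta> x = 1" and x: "x \<in> V" "x \<bullet> c \<noteq> s0" "\<bar>x \<bullet> c - s0\<bar> \<le> \<delta>" and \<delta>: "\<delta> \<le> 1"
  shows "datum_deriv \<zeta> c s0 0 [] x - (\<Sum>b\<in>Basis. datum_deriv \<zeta> c s0 0 [b, b] x) \<le> - (5 / 16) * inverse (sqrt (sqrt \<delta>))"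
proof -
  define w where "w = x \<bullet> c - s0"
  have w: "w \<noteq> 0" "\<bar>w\<bar> \<le> \<delta>" using x by (auto simp: w_def)
  have \<delta>0: "\<delta> > 0" using w by linarith
  have d1: "partial_deriv b \<zeta> y = 0" if "y \<in> V" for b y
    using partial_deriv_cong[OF V(1) that, of \<zeta> "\<lambda>_. 1" b] V(2) by (simp add: partial_deriv_const)
  have d2: "partial_deriv b (partial_deriv b \<zeta>) x = 0" for b
    using partial_deriv_cong[OF V(1) x(1), of "partial_deriv b \<zeta>" "\<lambda>_. 0" b] d1 by (simp add: partial_deriv_const)
  have "datum_deriv \<zeta> c s0 0 [b, b] x = (c \<bullet> b) * ((c \<bullet> b) * profile_d2 c s0 0 x)" for b
    using x(1) V(2) by (simp add: d1 d2)
  then have "(\<Sum>b\<in>Basis. datum_deriv \<zeta> c s0 0 [b, b] x) = profile_d2 c s0 0 x"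
    using sum_Basis_single[OF c, of "\<lambda>b. (c \<bullet> b) * profile_d2 c s0 0 x"] c by simp
  moreover have "profile_d2 c s0 0 x = 21 / 16 * reg_pow c s0 (- 1 / 8) 0 x"
  proof -
    have "w\<^sup>2 * (w\<^sup>2) powr (- 9 / 8) = (w\<^sup>2) powr (- 1 / 8)"
      using w powr_add[of "w\<^sup>2" 1 "- 9 / 8"] by simp
    then show ?thesis by (simp add: profile_d2_def reg_pow_def w_def)
  qed
  moreover have "reg_pow c s0 (7 / 8) 0 x \<le> 1"
  proof -
    have "w\<^sup>2 \<le> 1" using w \<delta> abs_square_le_1[of w] by simp
    then show ?thesis unfolding reg_pow_def w_def[symmetric] by (simp add: powr_le1)
  qed
  moreover have "inverse (sqrt (sqrt \<delta>)) \<le> reg_pow c s0 (- 1 / 8) 0 x"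
  proof (rule power2_le_imp_le)
    have "(inverse (sqrt (sqrt \<delta>)))\<^sup>2 = inverse (sqrt \<delta>)" using \<delta>0 by (simp add: power_inverse)
    also have "\<dots> \<le> inverse (sqrt \<bar>w\<bar>)" using w by (intro le_imp_inverse_le) auto
    also have "\<dots> = (reg_pow c s0 (- 1 / 8) 0 x)\<^sup>2" unfolding w_def by (rule weight_square[symmetric]) 
    finally show "(inverse (sqrt (sqrt \<delta>)))\<^sup>2 \<le> (reg_pow c s0 (- 1 / 8) 0 x)\<^sup>2" .
  qed (simp add: reg_pow_def)
  moreover have "1 \<le> inverse (sqrt (sqrt \<delta>))" using \<delta> \<delta>0 by (simp add: one_le_inverse_iff)
  moreover have "datum_deriv \<zeta> c s0 0 [] x = reg_pow c s0 (7 / 8) 0 x" using x(1) V(2) by simp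
  ultimately show ?thesis by linarith
qed

section \<open>The obstruction to null controllability\<close>

text \<open>Off \<open>\<omega>\<close> the equation reads \<open>J = - K\<close> with \<open>J = y\<^sub>t -
  \<Delta>y\<^sub>t\<close> and \<open>K = div(A y)\<close>. Time integration of \<open>J\<close> gives
  \<open>- (y0 - \<Delta>y0)\<close>, as \<open>y\<close> vanishes at time \<open>T\<close>, and
  \<open>K\<close> satisfies the slab estimate. The test functions spread beyond \<open>F\<close> into
  \<open>\<omega>\<close>, where the control acts; this contribution disappears only in the limit, which is
  why the identities for \<open>J\<close> and \<open>K\<close> are passed to the indicator function separately
  before they are compared.\<close>

lemma null_controllable_imp_slab_bound:
  fixes \<Omega> \<omega> :: "'a::euclidean_space set"
  assumes \<Omega>: "open \<Omega>" "bounded \<Omega>" and T: "T > 0" and c: "c \<in> Basis"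
    and A: "A \<in> Cinf_closure (cylinder \<Omega> T)"
    and nc: "null_controllable_from \<Omega> T A (\<omega> \<times> {0<..<T}) ch y0"
    and L: "\<And>b. b \<in> Basis \<Longrightarrow> has_weak_deriv \<Omega> [b, b] y0 (l b)" "integrable lebesgue y0" "\<And>b. b \<in> Basis \<Longrightarrow> integrable lebesgue (l b)"
    and F: "compact F" "F \<subseteq> \<Omega> - \<omega>" and \<zeta>: "\<zeta> \<in> test_functions \<Omega>"
    and V: "open V" "F \<subseteq> V" "V \<subseteq> \<Omega>" "\<And>x. x \<in> V \<Longrightarrow> \<zeta> x = 1"
  obtains C where "\<And>\<delta>. \<delta> > 0 \<Longrightarrow>
    \<bar>LINT x|lebesgue. (y0 x - (\<Sum>b\<in>Basis. l b x)) * indicator (F \<inter> {x. \<bar>x \<bullet> c - s0\<bar> \<le> \<delta>}) x\<bar> \<le> C * \<delta>"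
proof -
  let ?Q = "cylinder \<Omega> T"
  have Q: "open ?Q" using \<Omega> by (intro open_Times) auto
  obtain v y where sol: "is_solution \<Omega> T A (\<omega> \<times> {0<..<T}) ch v y0 y"
    and yT: "AE x in lebesgue_on \<Omega>. y (x, T) = 0"
    using nc unfolding null_controllable_from_def by blast
  have y: "y \<in> solution_space \<Omega> T"
    and eqn: "AE p in lebesgue_on ?Q. weak_deriv ?Q [dir_t] y p
          - (\<Sum>b\<in>Basis. weak_deriv ?Q [dir_t, dir_x b, dir_x b] y p)
          + (\<Sum>b\<in>Basis. weak_deriv ?Q [dir_x b] (\<lambda>q. (A q \<bullet> b) * y q) p)
          = (if p \<in> \<omega> \<times> {0<..<T} then v p * ch p else 0)"
    and y0: "AE x in lebesgue_on \<Omega>. y (x, 0) = y0 x"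
    using sol by (auto simp: is_solution_def Let_def)
  obtain K M where K: "int_on ?Q K" and M: "int_on ?Q M" and KM: "has_weak_deriv ?Q [dir_x c] K M"
    and Kae: "AE p in lebesgue. p \<in> ?Q \<longrightarrow> (\<Sum>b\<in>Basis. weak_deriv ?Q [dir_x b] (\<lambda>q. (A q \<bullet> b) * y q) p) = K p"
    by (rule transport_term[OF \<Omega> c y A])
  obtain J where J: "int_on ?Q J"
    and Jae: "AE p in lebesgue. p \<in> ?Q \<longrightarrow> weak_deriv ?Q [dir_t] y p
       - (\<Sum>b\<in>Basis. weak_deriv ?Q [dir_t, dir_x b, dir_x b] y p) = J p"
    and Jtest: "\<And>\<phi>. \<phi> \<in> test_functions \<Omega> \<Longrightarrow> (LINT p|lebesgue. J p * \<phi> (fst p)) =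
       ((LINT x|lebesgue. y (x, T) * \<phi> x) - (LINT x|lebesgue. y (x, 0) * \<phi> x))
       - (\<Sum>b\<in>Basis. (LINT x|lebesgue. y (x, T) * iter_deriv [b, b] \<phi> x) - (LINT x|lebesgue. y (x, 0) * iter_deriv [b, b] \<phi> x))"
    by (rule pseudo_parabolic_term[OF \<Omega> T y]) (rule that; assumption)
  obtain C where C: "\<And>\<phi> \<delta>. \<lbrakk>\<phi> \<in> test_functions \<Omega>; \<And>x. \<bar>\<phi> x\<bar> \<le> 1; \<And>x. \<phi> x \<noteq> 0 \<Longrightarrow> \<zeta> x = 1; \<delta> > 0;
      \<And>x. \<bar>x \<bullet> c - s0\<bar> > \<delta> \<Longrightarrow> \<phi> x = 0\<rbrakk> \<Longrightarrow> \<bar>LINT p|lebesgue. K p * \<phi> (fst p)\<bar> \<le> C * \<delta>"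
    using slab_estimate[OF \<Omega> T c K M KM \<zeta>, of s0] by blast
  define f where "f x = y0 x - (\<Sum>b\<in>Basis. l b x)" for x
  have fint: "integrable lebesgue f" unfolding f_def[abs_def]
    by (intro Bochner_Integration.integrable_diff Bochner_Integration.integrable_sum L)
  \<comment> \<open>Outside the cylinder both sides vanish, so the identity holds for all times.\<close>
  have balance: "AE p in lebesgue. fst p \<notin> \<omega> \<longrightarrow> J p = - K p"
  proof -
    have "AE p in lebesgue. p \<in> ?Q \<longrightarrow> weak_deriv ?Q [dir_t] y p
          - (\<Sum>b\<in>Basis. weak_deriv ?Q [dir_t, dir_x b, dir_x b] y p)
          + (\<Sum>b\<in>Basis. weak_deriv ?Q [dir_x b] (\<lambda>q. (A q \<bullet> b) * y q) p)
          = (if p \<in> \<omega> \<times> {0<..<T} then v p * ch p else 0)"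
      using eqn by (subst (asm) AE_restrict_space_iff) (simp_all add: open_sets_lebesgue[OF Q])
    with Kae Jae show ?thesis
    proof eventually_elim
      case (elim p)
      show ?case
      proof (intro impI)
        assume o: "fst p \<notin> \<omega>"
        show "J p = - K p"
        proof (cases "p \<in> ?Q")
          case True
          have "p \<notin> \<omega> \<times> {0<..<T}" using o by (cases p) auto
          then have "J p + K p = 0" using elim True by simp
          then show ?thesis by simp
        next
          case False then have "J p = 0" "K p = 0" using J K unfolding int_on_def by blast+
          then show ?thesis by simp
        qed
      qed
    qed
  qed
  have slice: "(LINT x|lebesgue. z x * \<phi> x) = (LINT x|lebesgue. z' x * \<phi> x)"
    if z: "AE x in lebesgue_on \<Omega>. z x = z' x" and z': "z' \<in> L1_loc \<Omega>" and \<phi>: "\<phi> \<in> test_functions \<Omega>" for z z' \<phi>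
  proof -
    have "AE x in lebesgue. x \<in> \<Omega> \<longrightarrow> z x = z' x"
      using z by (subst (asm) AE_restrict_space_iff) (simp_all add: open_sets_lebesgue[OF \<Omega>(1)])
    then have ae: "AE x in lebesgue. z' x * \<phi> x = z x * \<phi> x"
      by eventually_elim (use test_outside[OF \<phi>] in fastforce)
    have m: "(\<lambda>x. z' x * \<phi> x) \<in> borel_measurable lebesgue" using L1_loc_test_integrable[OF z' \<phi>] by blast
    show ?thesis using integral_cong_AE[OF m borel_measurable_AE[OF m ae] ae] by simp
  qed
  have zero: "(\<lambda>_. 0) \<in> L1_loc \<Omega>" by (rule integrable_imp_L1_loc) simp
  have y0L: "y0 \<in> L1_loc \<Omega>" by (rule integrable_imp_L1_loc[OF L(2)])
  have Jf: "(LINT p|lebesgue. J p * \<phi> (fst p)) = - (LINT x|lebesgue. f x * \<phi> x)" if \<phi>: "\<phi> \<in> test_functions \<Omega>" for \<phi>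
  proof -
    have bb: "iter_deriv [b, b] \<phi> \<in> test_functions \<Omega>" if "b \<in> Basis" for b
      using test_iter_deriv[OF \<phi>, of "[b, b]"] that by simp
    have lb: "(LINT x|lebesgue. y0 x * iter_deriv [b, b] \<phi> x) = (LINT x|lebesgue. l b x * \<phi> x)" if b: "b \<in> Basis" for b
      using L(1)[OF b] \<phi> b by (subst (asm) has_weak_deriv_iff[OF \<Omega>(1)]) auto
    have i: "integrable lebesgue (\<lambda>x. y0 x * \<phi> x)" "\<And>b. b \<in> Basis \<Longrightarrow> integrable lebesgue (\<lambda>x. l b x * \<phi> x)"
      using L1_loc_test_integrable[OF integrable_imp_L1_loc \<phi>] L by auto
    have "(LINT x|lebesgue. f x * \<phi> x) = (LINT x|lebesgue. y0 x * \<phi> x - (\<Sum>b\<in>Basis. l b x * \<phi> x))"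
      by (simp add: f_def left_diff_distrib sum_distrib_right)
    also have "\<dots> = (LINT x|lebesgue. y0 x * \<phi> x) - (\<Sum>b\<in>Basis. LINT x|lebesgue. l b x * \<phi> x)"
      by (simp add: i Bochner_Integration.integral_diff Bochner_Integration.integral_sum)
    finally have fe: "(LINT x|lebesgue. f x * \<phi> x) = (LINT x|lebesgue. y0 x * \<phi> x) - (\<Sum>b\<in>Basis. LINT x|lebesgue. l b x * \<phi> x)" .
    have bT: "(LINT x|lebesgue. y (x, T) * iter_deriv [b, b] \<phi> x) - (LINT x|lebesgue. y (x, 0) * iter_deriv [b, b] \<phi> x)
       = - (LINT x|lebesgue. l b x * \<phi> x)" if b: "b \<in> Basis" for b
      using slice[OF yT zero bb[OF b]] slice[OF y0 y0L bb[OF b]] lb[OF b] by simp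
    have "(LINT p|lebesgue. J p * \<phi> (fst p)) = - (LINT x|lebesgue. y0 x * \<phi> x) - (\<Sum>b\<in>Basis. - (LINT x|lebesgue. l b x * \<phi> x))"
      unfolding Jtest[OF \<phi>] using slice[OF yT zero \<phi>] slice[OF y0 y0L \<phi>] bT by simp
    then show ?thesis unfolding fe by (simp add: sum_negf)
  qed
  show thesis
  proof (rule that[of "2 * C"])
    fix \<delta> :: real assume \<delta>: "\<delta> > 0"
    define E where "E = F \<inter> {x. \<bar>x \<bullet> c - s0\<bar> \<le> \<delta>}"
    \<comment> \<open>A slab of twice the width leaves room for smooth approximations of the indicator of \<open>E\<close>.\<close>
    define U where "U = V \<inter> {x. \<bar>x \<bullet> c - s0\<bar> < 2 * \<delta>}"
    have E: "compact E" unfolding E_def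
      by (intro compact_Int_closed F closed_Collect_le continuous_intros)
    have U: "open U" unfolding U_def by (intro open_Int V open_Collect_less continuous_intros)
    have EU: "E \<subseteq> U" using V(2) \<delta> by (auto simp: E_def U_def)
    obtain \<phi> :: "nat \<Rightarrow> 'a \<Rightarrow> real" where \<phi>: "\<And>n. \<phi> n \<in> test_functions U" "\<And>n x. 0 \<le> \<phi> n x" "\<And>n x. \<phi> n x \<le> 1"
      "\<And>x. (\<lambda>n. \<phi> n x) \<longlonglongrightarrow> indicator E x"
      by (rule indicator_approx[OF E U EU]) (rule that; assumption)
    have \<phi>\<Omega>: "\<phi> n \<in> test_functions \<Omega>" for n
      by (rule test_mono[OF _ \<phi>(1)]) (use V(3) in \<open>auto simp: U_def\<close>)
    have \<phi>1: "\<bar>\<phi> n x\<bar> \<le> 1" for n x using \<phi>(2,3)[of n x] by simp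
    have \<phi>m: "\<phi> n \<in> borel_measurable lebesgue" "(\<lambda>p :: 'a \<times> real. \<phi> n (fst p)) \<in> borel_measurable lebesgue" for n
      using test_borel[OF \<phi>(1)[of n]] borel_fst_comp[OF test_borel[OF \<phi>(1)[of n]]]
      by (auto intro!: measurable_completion)
    have Kn: "\<bar>LINT p|lebesgue. K p * \<phi> n (fst p)\<bar> \<le> C * (2 * \<delta>)" for n
    proof (rule C[OF \<phi>\<Omega> \<phi>1])
      show "\<zeta> x = 1" if "\<phi> n x \<noteq> 0" for x
        using that test_outside[OF \<phi>(1)[of n], of x] V(4) by (auto simp: U_def)
      show "\<phi> n x = 0" if "2 * \<delta> < \<bar>x \<bullet> c - s0\<bar>" for x
        by (rule test_outside[OF \<phi>(1)]) (use that in \<open>auto simp: U_def\<close>)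
    qed (use \<delta> in auto)
    have limK: "(\<lambda>n. LINT p|lebesgue. K p * \<phi> n (fst p)) \<longlonglongrightarrow> (LINT p|lebesgue. K p * indicator E (fst p))"
      by (rule bounded_limit) (use K \<phi>m \<phi>1 \<phi>(4) in \<open>auto simp: int_on_def\<close>)
    have limJ: "(\<lambda>n. LINT p|lebesgue. J p * \<phi> n (fst p)) \<longlonglongrightarrow> (LINT p|lebesgue. J p * indicator E (fst p))"
      by (rule bounded_limit) (use J \<phi>m \<phi>1 \<phi>(4) in \<open>auto simp: int_on_def\<close>)
    have limf: "(\<lambda>n. LINT x|lebesgue. f x * \<phi> n x) \<longlonglongrightarrow> (LINT x|lebesgue. f x * indicator E x)"
      by (rule bounded_limit[OF fint \<phi>m(1) \<phi>1 \<phi>(4)])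
    have "(LINT p|lebesgue. J p * indicator E (fst p)) = - (LINT x|lebesgue. f x * indicator E x)"
      using LIMSEQ_unique[OF limJ] tendsto_minus[OF limf] unfolding Jf[OF \<phi>\<Omega>] by blast
    moreover have "(LINT p|lebesgue. J p * indicator E (fst p)) = (LINT p|lebesgue. - (K p * indicator E (fst p)))"
    proof (rule integral_cong_AE)
      have Em: "(\<lambda>p :: 'a \<times> real. indicator E (fst p) :: real) \<in> borel_measurable lebesgue"
        by (rule borel_measurable_LIMSEQ_real[OF \<phi>(4) \<phi>m(2)])
      show "(\<lambda>p. J p * indicator E (fst p)) \<in> borel_measurable lebesgue"
        "(\<lambda>p. - (K p * indicator E (fst p))) \<in> borel_measurable lebesgue"
        using J K Em unfolding int_on_def by auto
      show "AE p in lebesgue. J p * indicator E (fst p) = - (K p * indicator E (fst p))"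
        using balance by eventually_elim (use F(2) in \<open>auto simp: E_def indicator_def\<close>)
    qed
    ultimately have e: "(LINT x|lebesgue. f x * indicator E x) = (LINT p|lebesgue. K p * indicator E (fst p))"
      by simp
    have "\<bar>LINT p|lebesgue. K p * indicator E (fst p)\<bar> \<le> C * (2 * \<delta>)"
      using Kn by (intro LIMSEQ_le_const2[OF tendsto_rabs[OF limK]]) auto
    then show "\<bar>LINT x|lebesgue. (y0 x - (\<Sum>b\<in>Basis. l b x)) * indicator (F \<inter> {x. \<bar>x \<bullet> c - s0\<bar> \<le> \<delta>}) x\<bar> \<le> 2 * C * \<delta>"
      using e unfolding f_def E_def by simp
  qed
qed

theorem theorem1p2:
  fixes \<Omega> \<omega> :: "'a::euclidean_space set"
    and T :: real
    and A :: "'a \<times> real \<Rightarrow> 'a"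
    and D :: "('a \<times> real) set"
    and chi :: "'a \<times> real \<Rightarrow> real"
  assumes "open \<Omega>" and "connected \<Omega>" and "bounded \<Omega>" and "C2_boundary \<Omega>"
    and "T > 0"
    and "open \<omega>" and "\<omega> \<noteq> {}" and "\<omega> \<subset> \<Omega>" and "\<not> negligible (\<Omega> - \<omega>)"
    and "A \<in> Cinf_closure (cylinder \<Omega> T)"
    and "D = \<omega> \<times> {0<..<T}"
    and "chi \<in> Cinf_on (cylinder \<Omega> T)"
    and "closure {p \<in> cylinder \<Omega> T. chi p \<noteq> 0} \<subseteq> closure D"
  shows "\<exists>y0 \<in> Hk 2 \<Omega> \<inter> H10 \<Omega>. \<not> null_controllable_from \<Omega> T A D chi y0"
proof -
  note \<Omega> = \<open>open \<Omega>\<close> \<open>bounded \<Omega>\<close>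
  have "\<Omega> - \<omega> \<in> sets lebesgue"
    using open_sets_lebesgue[OF \<Omega>(1)] open_sets_lebesgue[OF \<open>open \<omega>\<close>] by (rule sets.Diff)
  then obtain F where F: "compact F" "F \<subseteq> \<Omega> - \<omega>" "\<not> negligible F"
    using nonnegligible_contains_compact \<open>\<not> negligible (\<Omega> - \<omega>)\<close> by metis
  obtain c :: 'a where c: "c \<in> Basis" using nonempty_Basis by blast
  obtain s0 where s0: "\<not> ((\<lambda>\<delta>. measure lebesgue (F \<inter> {x. \<bar>x \<bullet> c - s0\<bar> \<le> \<delta>}) / \<delta>) \<longlongrightarrow> 0) (at_right 0)"
    using thick_slice_exists[OF F(1,3) c] by blast
  have F\<Omega>: "F \<subseteq> \<Omega>" using F(2) by blast
  obtain \<zeta> V where \<zeta>: "\<zeta> \<in> test_functions \<Omega>" and V: "open V" "F \<subseteq> V" "\<And>x. x \<in> V \<Longrightarrow> \<zeta> x = 1"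
    using smooth_Urysohn[OF F(1) \<Omega>(1) F\<Omega>] by metis
  have V\<Omega>: "V \<subseteq> \<Omega>"
  proof
    fix x assume "x \<in> V"
    then have "\<zeta> x \<noteq> 0" using V(3) by simp
    then show "x \<in> \<Omega>" using test_outside[OF \<zeta>] by blast
  qed
  let ?d = "datum_deriv \<zeta> c s0 0"
  note datum = singular_datum[OF \<Omega>(1) \<zeta> c, where ?s0.0 = s0]
  have "\<not> null_controllable_from \<Omega> T A (\<omega> \<times> {0<..<T}) chi (?d [])"
  proof
    assume nc: "null_controllable_from \<Omega> T A (\<omega> \<times> {0<..<T}) chi (?d [])"
    define f where "f x = ?d [] x - (\<Sum>b\<in>Basis. ?d [b, b] x)" for x
    define E where "E \<delta> = F \<inter> {x. \<bar>x \<bullet> c - s0\<bar> \<le> \<delta>}" for \<delta>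
    have d0: "integrable lebesgue (?d [])" "\<And>b. b \<in> Basis \<Longrightarrow> integrable lebesgue (?d [b, b])"
      using datum(4)[of "[]"] datum(4)[of "[b, b]" for b] by auto
    obtain C where "\<And>\<delta>. \<delta> > 0 \<Longrightarrow> \<bar>LINT x|lebesgue. (?d [] x - (\<Sum>b\<in>Basis. ?d [b, b] x))
        * indicator (F \<inter> {x. \<bar>x \<bullet> c - s0\<bar> \<le> \<delta>}) x\<bar> \<le> C * \<delta>"
      by (rule null_controllable_imp_slab_bound[where ?s0.0 = s0, OF \<Omega> \<open>T > 0\<close> c \<open>A \<in> _\<close> nc datum(3) d0 F(1,2) \<zeta> V(1,2) V\<Omega> V(3)])
        (assumption | (rule that, assumption))+
    then have C: "\<And>\<delta>. \<delta> > 0 \<Longrightarrow> \<bar>LINT x|lebesgue. f x * indicator (E \<delta>) x\<bar> \<le> C * \<delta>"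
      unfolding f_def E_def .
    have fint: "integrable lebesgue f" unfolding f_def[abs_def]
      by (intro Bochner_Integration.integrable_diff Bochner_Integration.integrable_sum d0)
    have Em: "E \<delta> \<in> lmeasurable" for \<delta> unfolding E_def
      by (intro lmeasurable_compact compact_Int_closed F closed_Collect_le continuous_intros)
    have ae: "AE x in lebesgue. x \<bullet> c \<noteq> s0"
      using AE_not_in[of "{x. x \<bullet> c = s0}" lebesgue] negligible_standard_hyperplane[OF c, of s0] by (simp add: negligible_iff_null_sets)
    \<comment> \<open>The slab bound is \<open>C \<delta>\<close>, while \<open>- f\<close> is at least \<open>5/16 \<delta>\<^bsup>-1/4\<^esup>\<close> almost everywhere on \<open>E \<delta>\<close>.\<close>
    have small: "measure lebesgue (E \<delta>) / \<delta> \<le> 16 / 5 * C * sqrt (sqrt \<delta>)" if \<delta>: "\<delta> > 0" "\<delta> \<le> 1" for \<delta>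
    proof -
      define r where "r = inverse (sqrt (sqrt \<delta>))"
      have r: "r > 0" using \<delta> by (simp add: r_def)
      have fi: "integrable lebesgue (\<lambda>x. f x * indicator (E \<delta>) x)"
        using integrable_mult_indicator[OF fmeasurableD[OF Em] fint, of \<delta>] by (simp add: mult.commute)
      have ii: "integrable lebesgue (\<lambda>x. - (5 / 16) * r * indicator (E \<delta>) x)"
        using Em[of \<delta>] by (intro integrable_mult_right integrable_real_indicator) (auto simp: fmeasurable_def)
      have "(LINT x|lebesgue. f x * indicator (E \<delta>) x) \<le> (LINT x|lebesgue. - (5 / 16) * r * indicator (E \<delta>) x)"
      proof (rule integral_mono_AE[OF fi ii])
        show "AE x in lebesgue. f x * indicator (E \<delta>) x \<le> - (5 / 16) * r * indicator (E \<delta>) x"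
          using ae
        proof eventually_elim
          case (elim x)
          show ?case
          proof (cases "x \<in> E \<delta>")
            case True
            then have "x \<in> V" "\<bar>x \<bullet> c - s0\<bar> \<le> \<delta>" using V(2) by (auto simp: E_def)
            then have "f x \<le> - (5 / 16) * r" unfolding f_def r_def
              by (intro datum_singular[OF c V(1) V(3) _ elim _ \<delta>(2)])
            then show ?thesis using True by simp
          qed simp
        qed
      qed
      also have "\<dots> = - (5 / 16) * r * measure lebesgue (E \<delta>)" by simp
      finally have "5 / 16 * r * measure lebesgue (E \<delta>) \<le> C * \<delta>" using C[OF \<delta>(1)] by linarith
      then have "measure lebesgue (E \<delta>) \<le> 16 / 5 * C * \<delta> * inverse r" using r by (simp add: field_simps)
      then show ?thesis using \<delta> by (simp add: field_simps r_def)
    qed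
    have "((\<lambda>\<delta>. measure lebesgue (E \<delta>) / \<delta>) \<longlongrightarrow> 0) (at_right 0)"
    proof (rule Lim_null_comparison)
      have "eventually (\<lambda>\<delta>::real. 0 < \<delta> \<and> \<delta> \<le> 1) (at_right 0)"
        unfolding eventually_at_right_field by (intro exI[of _ 1]) auto
      then show "\<forall>\<^sub>F \<delta> in at_right 0. norm (measure lebesgue (E \<delta>) / \<delta>) \<le> 16 / 5 * C * sqrt (sqrt \<delta>)"
        by eventually_elim (use small in auto)
      have "((\<lambda>\<delta>. 16 / 5 * C * sqrt (sqrt \<delta>)) \<longlongrightarrow> 16 / 5 * C * sqrt (sqrt 0)) (at_right 0)"
        by (intro tendsto_intros)
      then show "((\<lambda>\<delta>. 16 / 5 * C * sqrt (sqrt \<delta>)) \<longlongrightarrow> 0) (at_right 0)" by simp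
    qed
    then show False using s0 unfolding E_def by blast
  qed
  then show ?thesis using datum(1,2) \<open>D = _\<close> by blast
qed

end
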